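(* Let $\gamma>0$, let $\bar X\in\mathbb{R}^{m_1\times m_2}$ with $\|\bar X\|_\infty\le\gamma$, and let $f=(f^1,f^2)$ be a $2$-link function satisfying the link assumption of the context with constants $H_\gamma,L_\gamma,K_\gamma>0$. Assume that the sampling distribution $\Pi=(\pi_{k,k'})$ satisfies $\min_{k,k'}\pi_{k,k'}\ge 1/(\mu m_1m_2)$ for a constant $\mu>0$ and $\max_{k\in[m_1],\,l\in[m_2]}\max(R_k,C_l)\le \nu/(m_1\wedge m_2)$ for a constant $\nu\ge1$. Assume in addition that $n\ge 2m\log(d)/(9\nu)$, and take $$\lambda=6L_\gamma\sqrt{\frac{2\nu\log(d)}{mn}}.$$ Let $\hat X$ be the estimator (defined in the context) with this $\lambda$. Then, with probability at least $1-3d^{-1}$, $$\frac{\|\bar X-\hat X\|_{\sigma,2}^2}{m_1m_2}\le \mu\max\left(\bar c\,\mu\nu\,\frac{L_\gamma^2\,\mathrm{rank}(\bar X)}{K_\gamma^2}\,\frac{M\log(d)}{n},\ \frac{e\,H_\gamma}{K_\gamma}\sqrt{\frac{\log(d)}{n}}\right),$$ where $\bar c$ is a universal constant and $e=\exp(1)$.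
   Context: For integers, $[n]=\{1,\dots,n\}$; $d=m_1+m_2$, $M=\max(m_1,m_2)$, $m=m_1\wedge m_2=\min(m_1,m_2)$. For a matrix $X$, $\|X\|_\infty=\max_{i,j}|X_{i,j}|$, $\|X\|_{\sigma,1}$ is the nuclear norm (sum of singular values) and $\|X\|_{\sigma,2}$ is the Frobenius norm. A $2$-link function is a map $f=(f^1,f^2):\mathbb{R}\to\{(a,b):a,b\ge0,\ a+b=1\}$. Link assumption: $f^1,f^2$ are differentiable and positive (so that the expressions below make sense), the functions $x\mapsto-\log f^j(x)$, $j=1,2$, are convex, and $H_\gamma,L_\gamma,K_\gamma$ are positive constants with $H_\gamma\ge 2\sup_{|x|\le\gamma}\max(|\log f^1(x)|,|\log f^2(x)|)$, $L_\gamma\ge\max\big(\sup_{|x|\le\gamma}|(f^1)'(x)|/f^1(x),\ \sup_{|x|\le\gamma}|(f^2)'(x)|/f^2(x)\big)$, $K_\gamma=\inf_{|x|\le\gamma}g(x)$, where $g(x)=\dfrac{((f^1)'(x))^2}{8f^1(x)(1-f^1(x))}$. Observation model: $\omega_1,\dots,\omega_n$ are i.i.d. in $[m_1]\times[m_2]$ with distribution $\Pi$, $\pi_{k,k'}=\mathbb{P}(\omega_1=(k,k'))$; $R_k=\sum_{k'=1}^{m_2}\pi_{k,k'}$, $C_{k'}=\sum_{k=1}^{m_1}\pi_{k,k'}$. The pairs $(\omega_i,Y_i)$ are independent, $Y_i\in\{1,2\}$, and conditionally on $\omega_i$, $\mathbb{P}(Y_i=j)=f^j(\bar X_{\omega_i})$,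 $j\in\{1,2\}$. Estimator: with $\Phi(X)=-\frac1n\sum_{i=1}^n\sum_{j=1}^2\mathbf 1_{\{Y_i=j\}}\log f^j(X_{\omega_i})$, $\hat X$ is a minimizer of $\Phi(X)+\lambda\|X\|_{\sigma,1}$ over $\{X\in\mathbb{R}^{m_1\times m_2}:\|X\|_\infty\le\gamma\}$. *)

theory Defs
  imports
    "HOL-Probability.Probability"
    "Jordan_Normal_Form.Char_Poly"
    "Jordan_Normal_Form.DL_Rank"
begin

section \<open>Matrix norms\<close>

definition sup_norm :: "real mat \<Rightarrow> real" where
  "sup_norm X = Max {\<bar>X $$ (k, l)\<bar> | k l. k < dim_row X \<and> l < dim_col X}"

text \<open>
  Square roots of the eigenvalues of \<open>X\<^sup>T X\<close> with algebraic multiplicity. The real symmetric matrix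
  \<open>X\<^sup>T X\<close> has only real nonnegative eigenvalues, so no root of its characteristic polynomial is
  lost by working over the reals. If \<open>X\<close> has more columns than rows the multiset contains
  additional zeros, which do not affect the sum.
\<close>
definition singular_values :: "real mat \<Rightarrow> real multiset" where
  "singular_values X = image_mset sqrt (proots (char_poly (transpose_mat X * X)))"

definition nuclear_norm :: "real mat \<Rightarrow> real" where
  "nuclear_norm X = sum_mset (singular_values X)"

definition frobenius_norm :: "real mat \<Rightarrow> real" where
  "frobenius_norm X = sqrt (\<Sum>k<dim_row X. \<Sum>l<dim_col X. (X $$ (k, l))\<^sup>2)"


section \<open>Link functions\<close>

text \<open>A pair \<open>(f\<^sup>1, f\<^sup>2)\<close> of real functions is encoded as \<open>f 1\<close>, \<open>f 2\<close>; other indices are irrelevant.\<close>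

definition two_link_function :: "(nat \<Rightarrow> real \<Rightarrow> real) \<Rightarrow> bool" where
  "two_link_function f \<longleftrightarrow> (\<forall>x. 0 \<le> f 1 x \<and> 0 \<le> f 2 x \<and> f 1 x + f 2 x = 1)"

definition smooth_log_concave_link :: "(nat \<Rightarrow> real \<Rightarrow> real) \<Rightarrow> bool" where
  "smooth_log_concave_link f \<longleftrightarrow>
     (\<forall>j\<in>{1, 2}. f j differentiable_on UNIV \<and> (\<forall>x. 0 < f j x) \<and> convex_on UNIV (\<lambda>x. - ln (f j x)))"

definition curvature :: "(nat \<Rightarrow> real \<Rightarrow> real) \<Rightarrow> real \<Rightarrow> real" where
  "curvature f x = (deriv (f 1) x)\<^sup>2 / (8 * f 1 x * (1 - f 1 x))"

text \<open>
  The suprema and the infimum below are taken over sets bounded above and below, respectively: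
  see \<open>bdd_above_log_link\<close>, \<open>bdd_above_score_link\<close> and \<open>bdd_below_curvature\<close>.
\<close>
definition link_assumption ::
    "(nat \<Rightarrow> real \<Rightarrow> real) \<Rightarrow> real \<Rightarrow> real \<Rightarrow> real \<Rightarrow> real \<Rightarrow> bool" where
  "link_assumption f \<gamma> H L K \<longleftrightarrow>
     smooth_log_concave_link f \<and> 0 < H \<and> 0 < L \<and> 0 < K \<and>
     H \<ge> 2 * (SUP x\<in>{-\<gamma>..\<gamma>}. max \<bar>ln (f 1 x)\<bar> \<bar>ln (f 2 x)\<bar>) \<and>
     L \<ge> max (SUP x\<in>{-\<gamma>..\<gamma>}. \<bar>deriv (f 1) x\<bar> / f 1 x) (SUP x\<in>{-\<gamma>..\<gamma>}. \<bar>deriv (f 2) x\<bar> / f 2 x) \<and>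
     K = (INF x\<in>{-\<gamma>..\<gamma>}. curvature f x)"

lemma smooth_linkD:
  assumes "smooth_log_concave_link f" "j \<in> {1, 2}"
  shows "f j field_differentiable (at x)" "0 < f j x" "convex_on UNIV (\<lambda>x. - ln (f j x))"
        "((\<lambda>x. - ln (f j x)) has_real_derivative - (deriv (f j) x / f j x)) (at x)"
proof -
  show d: "f j field_differentiable (at x)"
    using assms unfolding smooth_log_concave_link_def differentiable_on_def
    by (metis UNIV_I field_differentiable_def real_differentiable_def)
  show p: "0 < f j x" and "convex_on UNIV (\<lambda>x. - ln (f j x))"
    using assms unfolding smooth_log_concave_link_def by auto
  have "(f j has_real_derivative deriv (f j) x) (at x)"
    using d by (simp add: field_differentiable_derivI)
  then show "((\<lambda>x. - ln (f j x)) has_real_derivative - (deriv (f j) x / f j x)) (at x)"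
    using p by (auto intro!: derivative_eq_intros)
qed

lemma continuous_neg_log_link:
  assumes "smooth_log_concave_link f" "j \<in> {1, 2}"
  shows "continuous_on S (\<lambda>x. - ln (f j x))"
  using smooth_linkD(4)[OF assms] by (meson DERIV_isCont continuous_at_imp_continuous_on)

lemma bdd_above_log_link:
  assumes "smooth_log_concave_link f"
  shows "bdd_above ((\<lambda>x. max \<bar>ln (f 1 x)\<bar> \<bar>ln (f 2 x)\<bar>) ` {-\<gamma>..\<gamma>})"
proof -
  have "continuous_on {-\<gamma>..\<gamma>} (\<lambda>x. \<bar>- ln (f 1 x)\<bar>)" "continuous_on {-\<gamma>..\<gamma>} (\<lambda>x. \<bar>- ln (f 2 x)\<bar>)"
    by (intro continuous_on_rabs continuous_neg_log_link[OF assms], simp)+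
  then have "continuous_on {-\<gamma>..\<gamma>} (\<lambda>x. max \<bar>ln (f 1 x)\<bar> \<bar>ln (f 2 x)\<bar>)"
    by (intro continuous_on_max) simp_all
  then show ?thesis
    by (intro bounded_imp_bdd_above compact_imp_bounded compact_continuous_image) auto
qed

lemma bdd_above_score_link:
  assumes "smooth_log_concave_link f" "j \<in> {1, 2}"
  shows "bdd_above ((\<lambda>x. \<bar>deriv (f j) x\<bar> / f j x) ` {-\<gamma>..\<gamma>})"
proof -
  define h where "h = (\<lambda>x. - ln (f j x))"
  have "compact (h ` {-\<gamma>-1..\<gamma>+1})"
    unfolding h_def by (intro compact_continuous_image continuous_neg_log_link[OF assms]) auto
  then obtain B where B: "\<And>x. x \<in> {-\<gamma>-1..\<gamma>+1} \<Longrightarrow> \<bar>h x\<bar> \<le> B"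
    using compact_imp_bounded bounded_real by (metis imageI)
  have "\<bar>deriv (f j) x\<bar> / f j x \<le> 2 * B" if x: "x \<in> {-\<gamma>..\<gamma>}" for x
  proof -
    define s where "s = deriv (f j) x / f j x"
    have t: "h y - h x \<ge> (- s) * (y - x)" for y
      unfolding h_def s_def
      by (rule convex_on_imp_above_tangent[OF smooth_linkD(3)[OF assms]])
         (use smooth_linkD(4)[OF assms] in auto)
    have "\<bar>s\<bar> \<le> 2 * B"
      using t[of "x + 1"] t[of "x - 1"] B[of x] B[of "x + 1"] B[of "x - 1"] x by auto
    moreover have "\<bar>deriv (f j) x\<bar> / f j x = \<bar>s\<bar>"
      using smooth_linkD(2)[OF assms, of x] by (simp add: s_def)
    ultimately show ?thesis by simp
  qed
  then show ?thesis by (intro bdd_aboveI2)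
qed

lemma bdd_below_curvature:
  assumes "two_link_function f"
  shows "bdd_below (curvature f ` S)"
proof (rule bdd_belowI2[where m = 0])
  fix x
  have "0 \<le> f 1 x" "0 \<le> f 2 x" "f 1 x + f 2 x = 1"
    using assms unfolding two_link_function_def by blast+
  then have "0 \<le> f 1 x" "0 \<le> 1 - f 1 x" by linarith+
  then show "0 \<le> curvature f x" by (simp add: curvature_def)
qed


section \<open>Observation model\<close>

text \<open>
  Row and column indices start at 0. An observation is a pair \<open>(\<omega>, y)\<close> of a matrix position and
  a label in \<open>{1, 2}\<close>; the parameter \<open>P\<close> is the sampling distribution, with weights \<open>\<pi>\<^sub>k\<^sub>l = pmf P (k, l)\<close>.
\<close>
type_synonym observation = "(nat \<times> nat) \<times> nat"

definition row_weight :: "(nat \<times> nat) pmf \<Rightarrow> nat \<Rightarrow> nat \<Rightarrow> real" where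
  "row_weight P m2 k = (\<Sum>l<m2. pmf P (k, l))"

definition col_weight :: "(nat \<times> nat) pmf \<Rightarrow> nat \<Rightarrow> nat \<Rightarrow> real" where
  "col_weight P m1 l = (\<Sum>k<m1. pmf P (k, l))"

definition label_pmf :: "(nat \<Rightarrow> real \<Rightarrow> real) \<Rightarrow> real \<Rightarrow> nat pmf" where
  "label_pmf f x = map_pmf (\<lambda>b. if b then 1 else 2) (bernoulli_pmf (f 1 x))"

lemma pmf_label_pmf:
  assumes "two_link_function f"
  shows "pmf (label_pmf f x) y = (if y \<in> {1, 2} then f y x else 0)"
proof -
  have f: "0 \<le> f 1 x" "0 \<le> f 2 x" "f 1 x + f 2 x = 1"
    using assms unfolding two_link_function_def by blast+
  have "label_pmf f x = bind_pmf (bernoulli_pmf (f 1 x)) (\<lambda>b. return_pmf (if b then 1 else 2))"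
    by (simp add: label_pmf_def map_pmf_def)
  then show ?thesis
    using f by (auto simp: pmf_bind)
qed

definition observation_pmf ::
    "(nat \<times> nat) pmf \<Rightarrow> (nat \<Rightarrow> real \<Rightarrow> real) \<Rightarrow> real mat \<Rightarrow> observation pmf" where
  "observation_pmf P f X =
     bind_pmf P (\<lambda>\<omega>. bind_pmf (label_pmf f (X $$ \<omega>)) (\<lambda>y. return_pmf (\<omega>, y)))"

lemma pmf_observation_pmf:
  "pmf (observation_pmf P f X) (\<omega>, y) = pmf P \<omega> * pmf (label_pmf f (X $$ \<omega>)) y"
proof -
  have "observation_pmf P f X = bind_pmf P (\<lambda>\<omega>. map_pmf (Pair \<omega>) (label_pmf f (X $$ \<omega>)))"
    by (simp add: observation_pmf_def map_pmf_def)
  moreover have "pmf (map_pmf (Pair z) q) (\<omega>, y) = indicator {\<omega>} z * pmf q y" for z :: "nat \<times> nat" and q :: "nat pmf"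
  proof (cases "z = \<omega>")
    case True
    then show ?thesis by (simp add: pmf_map_inj' inj_def)
  next
    case False
    then have "(\<omega>, y) \<notin> set_pmf (map_pmf (Pair z) q)" by auto
    then have "pmf (map_pmf (Pair z) q) (\<omega>, y) = 0" by (simp only: set_pmf_iff not_not)
    then show ?thesis using False by simp
  qed
  ultimately have "pmf (observation_pmf P f X) (\<omega>, y) =
      measure_pmf.expectation P (\<lambda>z. indicator {\<omega>} z * pmf (label_pmf f (X $$ z)) y)"
    by (simp add: pmf_bind)
  also have "\<dots> = measure_pmf.expectation P (\<lambda>z. indicator {\<omega>} z * pmf (label_pmf f (X $$ \<omega>)) y)"
    by (intro Bochner_Integration.integral_cong) (auto simp: indicator_def)
  also have "\<dots> = pmf P \<omega> * pmf (label_pmf f (X $$ \<omega>)) y"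
    by (simp add: pmf.rep_eq)
  finally show ?thesis .
qed

text \<open>The law of \<open>n\<close> i.i.d. observations \<open>s 1, \<dots>, s n\<close>.\<close>
definition sample_pmf ::
    "nat \<Rightarrow> (nat \<times> nat) pmf \<Rightarrow> (nat \<Rightarrow> real \<Rightarrow> real) \<Rightarrow> real mat \<Rightarrow> (nat \<Rightarrow> observation) pmf" where
  "sample_pmf n P f X = Pi_pmf {1..n} undefined (\<lambda>_. observation_pmf P f X)"

text \<open>
  Working with \<open>sample_pmf\<close> is no loss of generality: random variables on an arbitrary probability
  space that follow the observation model have this joint law.
\<close>
lemma (in prob_space) prob_sample_eq:
  fixes \<omega> :: "nat \<Rightarrow> 'a \<Rightarrow> nat \<times> nat" and Y :: "nat \<Rightarrow> 'a \<Rightarrow> nat"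
  assumes link: "two_link_function f"
    and indep: "indep_vars (\<lambda>_. count_space UNIV) (\<lambda>i x. (\<omega> i x, Y i x)) {1..n}"
    and law: "\<And>i z. i \<in> {1..n} \<Longrightarrow> prob {x \<in> space M. \<omega> i x = z} = pmf P z"
    and labels: "\<And>i x. i \<in> {1..n} \<Longrightarrow> x \<in> space M \<Longrightarrow> Y i x \<in> {1, 2}"
    and cond: "\<And>i z j. i \<in> {1..n} \<Longrightarrow> j \<in> {1, 2} \<Longrightarrow> z \<in> set_pmf P \<Longrightarrow>
       \<P>(x in M. Y i x = j \<bar> \<omega> i x = z) = f j (X $$ z)"
  shows "prob {x \<in> space M. (\<lambda>i. if i \<in> {1..n} then (\<omega> i x, Y i x) else undefined) \<in> A} =
    measure_pmf.prob (sample_pmf n P f X) A"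
proof -
  define S where "S x = (\<lambda>i. if i \<in> {1..n} then (\<omega> i x, Y i x) else undefined)" for x
  define E where "E = {1..n} \<rightarrow>\<^sub>E (UNIV :: observation set)"
  have cE: "countable E" unfolding E_def by (intro countable_PiE) auto
  have SE: "S x \<in> E" for x by (auto simp: S_def E_def)
  have meas: "(\<lambda>x. (\<omega> i x, Y i x)) \<in> measurable M (count_space UNIV)" if "i \<in> {1..n}" for i
    using indep that unfolding indep_vars_def by blast
  have mev: "{x \<in> space M. Q (\<omega> i x, Y i x)} \<in> events" if "i \<in> {1..n}" for i Q
    using measurable_sets[OF meas[OF that], of "{u. Q u}"]
    by (simp add: vimage_def Int_def conj_commute)
  have one: "prob {x \<in> space M. (\<omega> i x, Y i x) = (z, y)} = pmf (observation_pmf P f X) (z, y)"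
    if i: "i \<in> {1..n}" for i z y
  proof (cases "z \<in> set_pmf P \<and> y \<in> {1, 2}")
    case True
    then have "pmf P z > 0" by (simp add: pmf_positive)
    then have "prob {x \<in> space M. Y i x = y \<and> \<omega> i x = z} = f y (X $$ z) * pmf P z"
      using cond[OF i, of y z] True law[OF i, of z]
      unfolding cond_prob_def by (simp add: field_simps)
    then show ?thesis
      using True by (simp add: pmf_observation_pmf pmf_label_pmf[OF link] conj_commute mult.commute)
  next
    case False
    have "prob {x \<in> space M. (\<omega> i x, Y i x) = (z, y)} = 0"
    proof (cases "y \<in> {1, 2}")
      case True
      then have "prob {x \<in> space M. \<omega> i x = z} = 0"
        using False law[OF i] by (simp add: set_pmf_iff)
      moreover have "prob {x \<in> space M. (\<omega> i x, Y i x) = (z, y)} \<le> prob {x \<in> space M. \<omega> i x = z}"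
        using mev[OF i, of "\<lambda>u. fst u = z"] by (intro finite_measure_mono) auto
      ultimately show ?thesis by (simp add: measure_le_0_iff)
    next
      case False
      then have "{x \<in> space M. (\<omega> i x, Y i x) = (z, y)} = {}" using labels[OF i] by auto
      then show ?thesis by (simp only: measure_empty)
    qed
    then show ?thesis
      using False by (auto simp: pmf_observation_pmf pmf_label_pmf[OF link] set_pmf_iff)
  qed
  have sets_S: "{x \<in> space M. S x = s} \<in> events" for s
  proof (cases "s \<in> E")
    case True
    have "S x = s \<longleftrightarrow> (\<forall>i\<in>{1..n}. (\<omega> i x, Y i x) = s i)" for x
      using True unfolding S_def E_def by (auto simp: fun_eq_iff PiE_def extensional_def)
    moreover have "{x \<in> space M. \<forall>i\<in>{1..n}. (\<omega> i x, Y i x) = s i} \<in> events"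
      by (intro sets.sets_Collect_finite_All mev) auto
    ultimately show ?thesis by simp
  next
    case False
    then have "{x \<in> space M. S x = s} = {}" using SE by auto
    then show ?thesis by (simp only: sets.empty_sets)
  qed
  have pt: "prob {x \<in> space M. S x = s} = pmf (sample_pmf n P f X) s" for s
  proof (cases "s \<in> E")
    case True
    have eq: "S x = s \<longleftrightarrow> (\<forall>i\<in>{1..n}. (\<omega> i x, Y i x) = s i)" for x
      using True unfolding S_def E_def by (auto simp: fun_eq_iff PiE_def extensional_def)
    have "prob {x \<in> space M. \<forall>i\<in>{1..n}. (\<omega> i x, Y i x) = s i} =
        (\<Prod>i\<in>{1..n}. prob {x \<in> space M. (\<omega> i x, Y i x) = s i})"
    proof (cases "n = 0")
      case True
      then show ?thesis by (simp add: prob_space)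
    next
      case False
      then have "prob (\<Inter>i\<in>{1..n}. (\<lambda>x. (\<omega> i x, Y i x)) -` {s i} \<inter> space M) =
          (\<Prod>i\<in>{1..n}. prob ((\<lambda>x. (\<omega> i x, Y i x)) -` {s i} \<inter> space M))"
        by (intro indep_varsD[OF indep]) auto
      moreover have "(\<Inter>i\<in>{1..n}. (\<lambda>x. (\<omega> i x, Y i x)) -` {s i} \<inter> space M) =
          {x \<in> space M. \<forall>i\<in>{1..n}. (\<omega> i x, Y i x) = s i}"
        using False by (auto simp: atLeastAtMost_def)
      moreover have "(\<lambda>x. (\<omega> i x, Y i x)) -` {s i} \<inter> space M = {x \<in> space M. (\<omega> i x, Y i x) = s i}" for i
        by auto
      ultimately show ?thesis by simp
    qed
    also have "\<dots> = (\<Prod>i\<in>{1..n}. pmf (observation_pmf P f X) (s i))"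
    proof (intro prod.cong refl)
      show "prob {x \<in> space M. (\<omega> i x, Y i x) = s i} = pmf (observation_pmf P f X) (s i)"
        if "i \<in> {1..n}" for i
        using one[OF that, of "fst (s i)" "snd (s i)"] by (simp only: prod.collapse)
    qed
    also have "\<dots> = pmf (sample_pmf n P f X) s"
      using True unfolding sample_pmf_def E_def
      by (subst pmf_Pi') (auto simp: PiE_def extensional_def)
    finally show ?thesis by (simp add: eq)
  next
    case False
    then have "{x \<in> space M. S x = s} = {}" using SE by auto
    moreover have "pmf (sample_pmf n P f X) s = 0"
      using False unfolding sample_pmf_def E_def
      by (intro pmf_Pi_outside) (auto simp: PiE_def extensional_def)
    ultimately show ?thesis by (simp only: measure_empty)
  qed
  have mS: "S \<in> measurable M (count_space E)"
  proof (subst measurable_count_space_eq_countable[OF cE], intro conjI ballI)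
    show "S \<in> space M \<rightarrow> E" using SE by blast
    show "S -` {s} \<inter> space M \<in> events" for s
    proof -
      have "S -` {s} \<inter> space M = {x \<in> space M. S x = s}" by blast
      then show ?thesis using sets_S by (simp only:)
    qed
  qed
  have "distr M (count_space E) S = restrict_space (measure_pmf (sample_pmf n P f X)) E"
  proof (rule measure_eqI_countable[OF _ _ cE])
    show "sets (distr M (count_space E) S) = Pow E" by simp
    show "sets (restrict_space (measure_pmf (sample_pmf n P f X)) E) = Pow E"
      by (auto simp: sets_restrict_space)
    show "emeasure (distr M (count_space E) S) {s} =
        emeasure (restrict_space (measure_pmf (sample_pmf n P f X)) E) {s}" if "s \<in> E" for s
    proof -
      have "S -` {s} \<inter> space M = {x \<in> space M. S x = s}" by blast
      then have "emeasure (distr M (count_space E) S) {s} = emeasure M {x \<in> space M. S x = s}"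
        using emeasure_distr[OF mS, of "{s}"] that by (simp only: sets_count_space) simp
      also have "\<dots> = ennreal (pmf (sample_pmf n P f X) s)"
        by (simp only: emeasure_eq_measure pt)
      finally show ?thesis
        using that emeasure_restrict_space[of E "measure_pmf (sample_pmf n P f X)" "{s}"]
        by (simp add: emeasure_pmf_single)
    qed
  qed
  then have "measure (distr M (count_space E) S) (A \<inter> E) =
      measure (restrict_space (measure_pmf (sample_pmf n P f X)) E) (A \<inter> E)" by (simp only:)
  moreover have "measure (distr M (count_space E) S) (A \<inter> E) = prob {x \<in> space M. S x \<in> A}"
  proof -
    have "S -` (A \<inter> E) \<inter> space M = {x \<in> space M. S x \<in> A}" using SE by blast
    then show ?thesis using measure_distr[OF mS, of "A \<inter> E"] by simp
  qed
  moreover have "measure (restrict_space (measure_pmf (sample_pmf n P f X)) E) (A \<inter> E) =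
      measure_pmf.prob (sample_pmf n P f X) A"
  proof -
    have "set_pmf (sample_pmf n P f X) \<subseteq> E"
      using set_Pi_pmf_subset[of "{1..n}" undefined "\<lambda>_. observation_pmf P f X"]
      unfolding sample_pmf_def E_def PiE_def extensional_def by blast
    then have "A \<inter> E \<inter> set_pmf (sample_pmf n P f X) = A \<inter> set_pmf (sample_pmf n P f X)" by blast
    then have "measure_pmf.prob (sample_pmf n P f X) (A \<inter> E) = measure_pmf.prob (sample_pmf n P f X) A"
      by (metis measure_Int_set_pmf)
    then show ?thesis
      using measure_restrict_space[of E "measure_pmf (sample_pmf n P f X)" "A \<inter> E"] by simp
  qed
  ultimately show ?thesis unfolding S_def by (simp only:)
qed


section \<open>Estimator\<close>

definition neg_log_likelihood ::
    "nat \<Rightarrow> (nat \<Rightarrow> real \<Rightarrow> real) \<Rightarrow> (nat \<Rightarrow> observation) \<Rightarrow> real mat \<Rightarrow> real" where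
  "neg_log_likelihood n f s X =
     - (1 / real n) * (\<Sum>i=1..n. \<Sum>j\<in>{1, 2}. of_bool (snd (s i) = j) * ln (f j (X $$ fst (s i))))"

definition is_estimator ::
    "nat \<Rightarrow> nat \<Rightarrow> nat \<Rightarrow> (nat \<Rightarrow> real \<Rightarrow> real) \<Rightarrow> real \<Rightarrow> real \<Rightarrow> (nat \<Rightarrow> observation) \<Rightarrow> real mat \<Rightarrow> bool" where
  "is_estimator m1 m2 n f \<gamma> reg s X \<longleftrightarrow>
     is_arg_min (\<lambda>X. neg_log_likelihood n f s X + reg * nuclear_norm X)
       (\<lambda>X. X \<in> carrier_mat m1 m2 \<and> sup_norm X \<le> \<gamma>) X"

end

theory Submission
  imports Defs "Jordan_Normal_Form.Schur_Decomposition"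
begin

text \<open>
  Write \<open>\<Delta> = Xhat - Xbar\<close>. Convexity of the loss bounds its increment from below by the score term, which is
  at most \<open>(9/10) reg \<parallel>\<Delta>\<parallel>\<^sub>*\<close> with high probability. Optimality of the estimator and a dual certificate for
  the nuclear norm then give the cone condition \<open>\<parallel>\<Delta>\<parallel>\<^sub>* \<le> 30 sqrt r \<parallel>\<Delta>\<parallel>\<^sub>F\<close>. Shrink \<open>\<Delta>\<close> towards 0 until its nuclear
  norm is at most a deterministic radius \<open>\<rho>\<close>; by convexity the shrunk point still satisfies the basic
  inequality. A second event, uniform over the nuclear ball of radius \<open>\<rho>\<close>, compares the empirical increment
  with the expected Kullback--Leibler divergence, which dominates \<open>\<parallel>\<Delta>\<parallel>\<^sub>F\<^sup>2\<close>. For \<open>\<rho>\<close> slightly too large for the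
  cone condition no shrinking can have occurred, so a single radius suffices and no peeling is needed. The
  term with \<open>e H\<close> is only needed when the rank is 0, where it leaves room for a positive \<open>\<rho>\<close>.

  Both events are obtained by comparing exponential moments, one observation at a time, with those of a
  random sign sum \<open>\<Sum>\<^sub>i \<epsilon>\<^sub>i E\<^sub>\<omega>\<^sub>i\<close> of matrix units. Its operator norm is bounded through traces of even powers, by
  counting walks in the bipartite multigraph of the sampled positions; this replaces the matrix Bernstein
  inequality.
\<close>

section \<open>Spectral theorem for real symmetric matrices\<close>

text \<open>The estimator is an arbitrary function of the sample, so a bound at a fixed matrix says
  nothing about it. Positions and labels take finitely many values, hence the sample has finite
  support \<open>T\<close>, and it suffices to control a maximum over the candidates
  \<open>Xhat \<tau>\<close> with \<tau> in \<open>T\<close>. Duality between the nuclear and the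
  operator norm makes the bound independent of the size of \<open>T\<close>. Observations can be
  replaced one by one because each one-step inequality holds for every offset \<open>h\<close>,
  which absorbs the other observations.

  The constants: the score takes the share 9/10 of \<open>reg\<close>, so the cone constant is 3 /
  (1 - 9/10) = 30, where 3 counts the pieces of the dual certificate that cost a Frobenius norm.
  Symmetrization doubles 9/10 to 9/5 in the second event and optimality adds 1, hence 14/5. Then
  2520 = 900 * 14/5, and 1016064 = 72 * 14/5 * 2 * 2520, where 72 = 2 * 6^2 comes from the square of
  \<open>reg\<close>. Each event fails with probability at most 1/d, so the proof yields 1 -
  2/d.\<close>

lemma orthogonal_mat_with_first_col:
  fixes v :: "real vec"
  assumes v: "v \<in> carrier_vec n" "v \<noteq> 0\<^sub>v n"
  obtains W c where "W \<in> carrier_mat n n" "transpose_mat W * W = 1\<^sub>m n" "c \<noteq> 0" "col W 0 = c \<cdot>\<^sub>v v"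
proof -
  interpret cof_vec_space n "TYPE(real)" .
  define b where "b = basis_completion v"
  define ws where "ws = gram_schmidt n b"
  from basis_completion[OF v, folded b_def]
  have b: "span (set b) = carrier_vec n" "distinct b" "\<not> lin_dep (set b)" "set b \<subseteq> carrier_vec n"
    "hd b = v" "length b = n" by auto
  have n0: "n > 0" using v by (cases n) auto
  then obtain vs where bv: "b = v # vs" using b by (cases b) auto
  from gram_schmidt_result[OF b(4,2,3) ws_def]
  have ws: "set ws \<subseteq> carrier_vec n" "corthogonal ws" "length ws = n" by (auto simp: b)
  have hd: "hd ws = v" using gram_schmidt_hd[OF v(1), of vs, folded bv] by (simp add: ws_def)
  have ws0: "ws ! 0 = v" using hd ws n0 by (metis hd_conv_nth length_greater_0_conv)
  have wsc: "ws ! i \<in> carrier_vec n" if "i < n" for i using ws that by auto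
  have orth: "(ws ! i \<bullet> ws ! j = 0) = (i \<noteq> j)" if "i < n" "j < n" for i j
    using corthogonalD[OF ws(2), of i j] that ws(3) by simp
  have pos: "ws ! i \<bullet> ws ! i > 0" if "i < n" for i
  proof -
    have "ws ! i \<bullet> ws ! i \<ge> 0" unfolding scalar_prod_def by (auto intro!: sum_nonneg)
    then show ?thesis using orth[OF that that] by simp
  qed
  define q where "q i = sqrt (ws ! i \<bullet> ws ! i)" for i
  define W where "W = mat n n (\<lambda>(k, i). (ws ! i $ k) / q i)"
  have WW: "transpose_mat W * W = 1\<^sub>m n"
  proof (rule eq_matI)
    fix i j assume "i < dim_row (1\<^sub>m n :: real mat)" "j < dim_col (1\<^sub>m n :: real mat)"
    then have ij: "i < n" "j < n" by auto
    have "(transpose_mat W * W) $$ (i, j) = (ws ! i \<bullet> ws ! j) / (q i * q j)"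
      using ij wsc[OF ij(2)] wsc[OF ij(1)]
      by (simp add: W_def scalar_prod_def sum_divide_distrib)
    also have "\<dots> = 1\<^sub>m n $$ (i, j)"
      using ij orth[OF ij] pos[OF ij(1)] by (auto simp: q_def)
    finally show "(transpose_mat W * W) $$ (i, j) = 1\<^sub>m n $$ (i, j)" .
  qed (auto simp: W_def)
  have col: "col W 0 = (1 / q 0) \<cdot>\<^sub>v v"
    using v n0 ws0 by (intro eq_vecI) (auto simp: W_def)
  have "1 / q 0 \<noteq> 0" using pos[OF n0] by (simp add: q_def)
  then show ?thesis using that[of W "1 / q 0"] WW col by (auto simp: W_def)
qed

text \<open>The characteristic polynomial has a complex root, the Hermitian form of a complex
  eigenvector forces this root to be real, and a real root has a real eigenvector.\<close>

lemma symmetric_mat_real_eigenvector: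
  fixes A :: "real mat"
  assumes A: "A \<in> carrier_mat n n" and sym: "transpose_mat A = A" and n0: "n > 0"
  obtains v e where "v \<in> carrier_vec n" "v \<noteq> 0\<^sub>v n" "A *\<^sub>v v = e \<cdot>\<^sub>v v"
proof -
  define C where "C = map_mat complex_of_real A"
  have C: "C \<in> carrier_mat n n" using A by (simp add: C_def)
  obtain as where as: "char_poly C = (\<Prod>a\<leftarrow>as. [:- a, 1:])" "length as = n"
    using char_poly_factorized[OF C] by blast
  then obtain z where "z \<in> set as" using n0 by (cases as) auto
  then have root: "poly (char_poly C) z = 0" by (auto simp: as poly_prod_list prod_list_zero_iff)
  then obtain x where x: "x \<in> carrier_vec n" "x \<noteq> 0\<^sub>v n" "C *\<^sub>v x = z \<cdot>\<^sub>v x"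
    using eigenvalue_root_char_poly[OF C] C unfolding eigenvalue_def eigenvector_def by auto
  have Aij: "A $$ (i, j) = A $$ (j, i)" if "i < n" "j < n" for i j
    using arg_cong[OF sym, of "\<lambda>B. B $$ (i, j)"] A that by simp
  have row: "(\<Sum>j<n. complex_of_real (A $$ (i, j)) * x $ j) = z * x $ i" if "i < n" for i
    using arg_cong[OF x(3), of "\<lambda>w. w $ i"] that A x(1)
    by (simp add: C_def scalar_prod_def atLeast0LessThan)
  \<comment> \<open>By symmetry of \<open>A\<close> this Hermitian form equals its conjugate; it is
    also \<open>z\<close> times a nonzero real number.\<close>
  define S where "S = (\<Sum>i<n. \<Sum>j<n. cnj (x $ i) * (complex_of_real (A $$ (i, j)) * x $ j))"
  have S: "S = z * of_real (\<Sum>i<n. (cmod (x $ i))\<^sup>2)"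
  proof -
    have "S = (\<Sum>i<n. cnj (x $ i) * (z * x $ i))"
      unfolding S_def sum_distrib_left[symmetric] by (intro sum.cong) (auto simp: row)
    also have "\<dots> = z * of_real (\<Sum>i<n. (cmod (x $ i))\<^sup>2)"
      unfolding of_real_sum sum_distrib_left
      by (intro sum.cong) (auto simp: complex_norm_square simp del: of_real_power)
    finally show ?thesis .
  qed
  have "cnj S = S"
  proof -
    have "cnj S = (\<Sum>i<n. \<Sum>j<n. x $ i * (complex_of_real (A $$ (i, j)) * cnj (x $ j)))"
      by (simp add: S_def)
    also have "\<dots> = (\<Sum>j<n. \<Sum>i<n. x $ i * (complex_of_real (A $$ (i, j)) * cnj (x $ j)))"
      by (rule sum.swap)
    also have "\<dots> = S" unfolding S_def
      by (intro sum.cong refl) (auto simp: Aij)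
    finally show ?thesis .
  qed
  moreover have nz: "(\<Sum>i<n. (cmod (x $ i))\<^sup>2) \<noteq> 0"
  proof
    assume "(\<Sum>i<n. (cmod (x $ i))\<^sup>2) = 0"
    then have "\<forall>i<n. x $ i = 0" by (subst (asm) sum_nonneg_eq_0_iff) auto
    then show False using x by auto
  qed
  ultimately have "cnj z = z" unfolding S by (simp del: of_real_sum)
  then have z: "z = of_real (Re z)" by (simp add: complex_eq_iff)
  have "char_poly C = map_poly of_real (char_poly A)"
    unfolding C_def by (rule of_real_hom.char_poly_hom[OF A])
  with root z have "poly (map_poly complex_of_real (char_poly A)) (of_real (Re z)) = 0" by simp
  then have "poly (char_poly A) (Re z) = 0" by simp
  then obtain w where "w \<in> carrier_vec n" "w \<noteq> 0\<^sub>v n" "A *\<^sub>v w = Re z \<cdot>\<^sub>v w"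
    using eigenvalue_root_char_poly[OF A] A unfolding eigenvalue_def eigenvector_def by auto
  then show ?thesis by (rule that)
qed

text \<open>Deflation: conjugation by an orthogonal matrix whose first column is an eigenvector
  clears the rest of that column, symmetry clears the first row, and the induction hypothesis
  handles the remaining block.\<close>

theorem symmetric_mat_diagonalizable:
  fixes A :: "real mat"
  assumes "A \<in> carrier_mat n n" and "transpose_mat A = A"
  shows "\<exists>P D. P \<in> carrier_mat n n \<and> D \<in> carrier_mat n n \<and> transpose_mat P * P = 1\<^sub>m n \<and>
    diagonal_mat D \<and> A = P * D * transpose_mat P"
  using assms
proof (induction n arbitrary: A)
  case 0
  then show ?case by (intro exI[of _ "1\<^sub>m 0"]) (auto simp: diagonal_mat_def)
next
  case (Suc n)
  note A = Suc.prems(1) and sym = Suc.prems(2)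
  let ?N = "Suc n"
  obtain v e where v: "v \<in> carrier_vec ?N" "v \<noteq> 0\<^sub>v ?N" and Av: "A *\<^sub>v v = e \<cdot>\<^sub>v v"
    using symmetric_mat_real_eigenvector[OF A sym] by auto
  obtain W c where W: "W \<in> carrier_mat ?N ?N" and WW: "transpose_mat W * W = 1\<^sub>m ?N"
    and c: "c \<noteq> 0" "col W 0 = c \<cdot>\<^sub>v v"
    using orthogonal_mat_with_first_col[OF v] by metis
  define Wt where "Wt = transpose_mat W"
  have Wt: "Wt \<in> carrier_mat ?N ?N" using W by (simp add: Wt_def)
  have WtW: "Wt * W = 1\<^sub>m ?N" using WW by (simp add: Wt_def)
  have WWt: "W * Wt = 1\<^sub>m ?N" using mat_mult_left_right_inverse[OF Wt W WtW] .
  define A' where "A' = Wt * (A * W)"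
  have A': "A' \<in> carrier_mat ?N ?N" using A W Wt by (simp add: A'_def)
  have symA': "transpose_mat A' = A'"
  proof -
    have "transpose_mat A' = transpose_mat (A * W) * transpose_mat Wt"
      unfolding A'_def by (rule transpose_mult[OF Wt]) (use A W in auto)
    also have "transpose_mat (A * W) = Wt * A" using transpose_mult[OF A W] sym by (simp add: Wt_def)
    also have "Wt * A * transpose_mat Wt = A'" using A W Wt by (simp add: A'_def Wt_def)
    finally show ?thesis .
  qed
  have AWcol: "A *\<^sub>v col W 0 = e \<cdot>\<^sub>v col W 0"
    unfolding c(2) using Av A v by (simp add: mult_mat_vec smult_smult_assoc mult.commute)
  have col0: "A' $$ (i, 0) = (if i = 0 then e else 0)" if i: "i < ?N" for i
  proof -
    have "A' $$ (i, 0) = row Wt i \<bullet> col (A * W) 0" using i A W Wt by (simp add: A'_def)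
    also have "col (A * W) 0 = e \<cdot>\<^sub>v col W 0" using AWcol A W by (simp only: col_mult2[OF A W zero_less_Suc])
    also have "row Wt i \<bullet> (e \<cdot>\<^sub>v col W 0) = e * (row Wt i \<bullet> col W 0)" 
      using i W Wt by (intro scalar_prod_smult_right) auto
    also have "row Wt i \<bullet> col W 0 = (Wt * W) $$ (i, 0)" using i W Wt by simp
    also have "\<dots> = (if i = 0 then 1 else 0)" using WtW i by simp
    finally show ?thesis by simp
  qed
  have row0: "A' $$ (0, i) = (if i = 0 then e else 0)" if i: "i < ?N" for i
    using col0[OF i] arg_cong[OF symA', of "\<lambda>B. B $$ (0, i)"] A' i by simp
  define A3 where "A3 = mat n n (\<lambda>(i, j). A' $$ (Suc i, Suc j))"
  have A3: "A3 \<in> carrier_mat n n" by (simp add: A3_def)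
  have symA3: "transpose_mat A3 = A3"
  proof (rule eq_matI)
    fix i j assume "i < dim_row A3" "j < dim_col A3"
    then have ij: "i < n" "j < n" by (auto simp: A3_def)
    then show "transpose_mat A3 $$ (i, j) = A3 $$ (i, j)"
      using arg_cong[OF symA', of "\<lambda>B. B $$ (Suc i, Suc j)"] A' by (simp add: A3_def)
  qed (auto simp: A3_def)
  obtain P D where P: "P \<in> carrier_mat n n" and D: "D \<in> carrier_mat n n"
    and PP: "transpose_mat P * P = 1\<^sub>m n" and diag: "diagonal_mat D" and A3_eq: "A3 = P * D * transpose_mat P"
    using Suc.IH[OF A3 symA3] by blast
  define E where "E = mat 1 1 (\<lambda>_::nat\<times>nat. e)"
  have E: "E \<in> carrier_mat 1 1" by (simp add: E_def)
  let ?Z1 = "0\<^sub>m 1 n :: real mat" and ?Z2 = "0\<^sub>m n 1 :: real mat"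
  have A'_eq: "A' = four_block_mat E ?Z1 ?Z2 A3"
    using A' by (intro eq_matI) (auto simp: col0 row0 E_def A3_def Let_def)
  define Q where "Q = four_block_mat (1\<^sub>m 1) ?Z1 ?Z2 P"
  define Qt where "Qt = four_block_mat (1\<^sub>m 1) ?Z1 ?Z2 (transpose_mat P)"
  define D' where "D' = four_block_mat E ?Z1 ?Z2 D"
  have Q: "Q \<in> carrier_mat ?N ?N" using P by (auto simp: Q_def)
  have D': "D' \<in> carrier_mat ?N ?N" using E D by (auto simp: D'_def)
  have Qt_eq: "transpose_mat Q = Qt"
    unfolding Q_def Qt_def
    using transpose_four_block_mat[of "1\<^sub>m 1" 1 1 ?Z1 n ?Z2 n P] P by simp
  have Qt: "Qt \<in> carrier_mat ?N ?N" using P by (auto simp: Qt_def)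
  have QQ: "Qt * Q = 1\<^sub>m ?N"
  proof -
    have "Qt * Q = four_block_mat (1\<^sub>m 1) ?Z1 ?Z2 (transpose_mat P * P)"
      unfolding Q_def Qt_def
      using P by (subst mult_four_block_mat[of _ 1 1 _ n _ n _ _ 1 _ n]) auto
    also have "\<dots> = 1\<^sub>m ?N" using PP by simp
    finally show ?thesis .
  qed
  have A'_diag: "A' = Q * D' * Qt"
  proof -
    have "Q * D' = four_block_mat E ?Z1 ?Z2 (P * D)"
      unfolding Q_def D'_def
      using P D E by (subst mult_four_block_mat[of _ 1 1 _ n _ n _ _ 1 _ n]) auto
    moreover have "four_block_mat E ?Z1 ?Z2 (P * D) * Qt = four_block_mat E ?Z1 ?Z2 (P * D * transpose_mat P)"
      unfolding Qt_def
      using P D E by (subst mult_four_block_mat[of _ 1 1 _ n _ n _ _ 1 _ n]) auto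
    ultimately show ?thesis unfolding A'_eq A3_eq by simp
  qed
  have "A = W * A' * Wt"
  proof -
    have "W * A' = A * W"
    proof -
      have "W * A' = (W * Wt) * (A * W)" unfolding A'_def using W Wt A by (subst assoc_mult_mat) auto
      then show ?thesis using WWt A W by simp
    qed
    then have "W * A' * Wt = A * (W * Wt)" using W Wt A by (simp add: assoc_mult_mat[of A ?N ?N W ?N Wt])
    then show ?thesis using WWt A by simp
  qed
  also have "\<dots> = (W * Q) * D' * (Qt * Wt)"
    unfolding A'_diag using W Q Qt D' Wt
    by (simp add: assoc_mult_mat[of _ ?N ?N _ ?N _ ?N])
  also have "Qt * Wt = transpose_mat (W * Q)"
    using transpose_mult[OF W Q] by (simp add: Qt_eq Wt_def)
  finally have eq: "A = (W * Q) * D' * transpose_mat (W * Q)" .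
  have "transpose_mat (W * Q) * (W * Q) = Qt * (Wt * W) * Q"
    using transpose_mult[OF W Q] W Q Qt Wt
    by (simp add: Qt_eq Wt_def[symmetric] assoc_mult_mat[of _ ?N ?N _ ?N _ ?N])
  also have "\<dots> = 1\<^sub>m ?N" using WtW QQ Qt by simp
  finally have orth: "transpose_mat (W * Q) * (W * Q) = 1\<^sub>m ?N" .
  have "diagonal_mat D'"
    using diag D E by (auto simp: diagonal_mat_def D'_def Let_def)
  then show ?case
    using eq orth W Q D' by (intro exI[of _ "W * Q"] exI[of _ D']) auto
qed


section \<open>Duality for the nuclear norm\<close>

text \<open>Vectors and matrices become plain functions with the dimension as an argument, and
  values beyond it never enter. This keeps carrier conditions out of the certificate
  constructions.\<close>

definition ip :: "nat \<Rightarrow> (nat \<Rightarrow> real) \<Rightarrow> (nat \<Rightarrow> real) \<Rightarrow> real" where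
  "ip n x y = (\<Sum>i<n. x i * y i)"

definition mv :: "nat \<Rightarrow> (nat \<Rightarrow> nat \<Rightarrow> real) \<Rightarrow> (nat \<Rightarrow> real) \<Rightarrow> nat \<Rightarrow> real" where
  "mv n A x = (\<lambda>k. \<Sum>l<n. A k l * x l)"

definition minner :: "nat \<Rightarrow> nat \<Rightarrow> (nat \<Rightarrow> nat \<Rightarrow> real) \<Rightarrow> (nat \<Rightarrow> nat \<Rightarrow> real) \<Rightarrow> real" where
  "minner m1 m2 A B = (\<Sum>k<m1. \<Sum>l<m2. A k l * B k l)"

text \<open>The closed unit ball of the operator norm, which is the norm dual to the nuclear
  norm.\<close>

definition contraction :: "nat \<Rightarrow> nat \<Rightarrow> (nat \<Rightarrow> nat \<Rightarrow> real) \<Rightarrow> bool" where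
  "contraction m1 m2 Z \<longleftrightarrow> (\<forall>x. ip m1 (mv m2 Z x) (mv m2 Z x) \<le> ip m2 x x)"

definition orthonormal :: "nat \<Rightarrow> 'a set \<Rightarrow> ('a \<Rightarrow> nat \<Rightarrow> real) \<Rightarrow> bool" where
  "orthonormal n I u \<longleftrightarrow> (\<forall>a\<in>I. \<forall>b\<in>I. ip n (u a) (u b) = (if a = b then 1 else 0))"

abbreviation entries :: "real mat \<Rightarrow> nat \<Rightarrow> nat \<Rightarrow> real" where
  "entries X \<equiv> \<lambda>k l. X $$ (k, l)"

section \<open>Coordinate algebra of vector and matrix inner products\<close>

lemma ip_commute: "ip n x y = ip n y x"
  by (simp add: ip_def mult.commute)

lemma ip_self_nonneg: "ip n x x \<ge> 0"
  by (auto simp: ip_def intro!: sum_nonneg)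

lemma ip_sum_left: "ip n (\<lambda>i. \<Sum>a\<in>I. c a * u a i) y = (\<Sum>a\<in>I. c a * ip n (u a) y)"
  unfolding ip_def sum_distrib_right sum_distrib_left by (subst sum.swap) (simp add: mult.assoc)

lemma ip_sum_right: "ip n y (\<lambda>i. \<Sum>a\<in>I. c a * u a i) = (\<Sum>a\<in>I. c a * ip n y (u a))"
  using ip_sum_left[of n c u I y] by (simp add: ip_commute)

lemma ip_add_left: "ip n (\<lambda>i. x i + y i) z = ip n x z + ip n y z"
  by (simp add: ip_def distrib_right sum.distrib)

lemma ip_add_right: "ip n z (\<lambda>i. x i + y i) = ip n z x + ip n z y"
  by (simp add: ip_def distrib_left sum.distrib)

lemma ip_diff_left: "ip n (\<lambda>i. x i - y i) z = ip n x z - ip n y z"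
  by (simp add: ip_def left_diff_distrib sum_subtractf)

lemma ip_diff_right: "ip n z (\<lambda>i. x i - y i) = ip n z x - ip n z y"
  by (simp add: ip_def right_diff_distrib sum_subtractf)

lemma ip_zero [simp]: "ip n (\<lambda>_. 0) z = 0" "ip n z (\<lambda>_. 0) = 0"
  by (simp_all add: ip_def)

lemma ip_Cauchy_Schwarz: "ip n x y \<le> sqrt (ip n x x) * sqrt (ip n y y)"
proof -
  have "(ip n x y)\<^sup>2 \<le> ip n x x * ip n y y"
    using Cauchy_Schwarz_ineq_sum[of x y "{..<n}"] by (simp add: ip_def power2_eq_square)
  then have "\<bar>ip n x y\<bar> \<le> sqrt (ip n x x * ip n y y)"
    by (simp add: real_le_rsqrt)
  then show ?thesis by (simp add: real_sqrt_mult)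
qed

lemma minner_Cauchy_Schwarz:
  "minner m1 m2 A B \<le> sqrt (minner m1 m2 A A) * sqrt (minner m1 m2 B B)"
proof -
  have *: "minner m1 m2 A B = (\<Sum>p\<in>{..<m1}\<times>{..<m2}. A (fst p) (snd p) * B (fst p) (snd p))" for A B
    unfolding minner_def by (simp add: sum.cartesian_product split_def)
  have "(minner m1 m2 A B)\<^sup>2 \<le> minner m1 m2 A A * minner m1 m2 B B"
    unfolding * using Cauchy_Schwarz_ineq_sum[of "\<lambda>p. A (fst p) (snd p)" "\<lambda>p. B (fst p) (snd p)" "{..<m1}\<times>{..<m2}"]
    by (simp add: power2_eq_square)
  then have "\<bar>minner m1 m2 A B\<bar> \<le> sqrt (minner m1 m2 A A * minner m1 m2 B B)"
    by (simp add: real_le_rsqrt)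
  then show ?thesis by (simp add: real_sqrt_mult)
qed

lemma minner_self_nonneg: "minner m1 m2 A A \<ge> 0"
  by (auto simp: minner_def intro!: sum_nonneg)

lemma minner_add_right: "minner m1 m2 A (\<lambda>k l. B k l + C k l) = minner m1 m2 A B + minner m1 m2 A C"
  by (simp add: minner_def distrib_left sum.distrib)

lemma minner_diff_right: "minner m1 m2 A (\<lambda>k l. B k l - C k l) = minner m1 m2 A B - minner m1 m2 A C"
  by (simp add: minner_def right_diff_distrib sum_subtractf)

lemma minner_add_left: "minner m1 m2 (\<lambda>k l. B k l + C k l) A = minner m1 m2 B A + minner m1 m2 C A"
  by (simp add: minner_def distrib_right sum.distrib)

lemma minner_scale_left: "minner m1 m2 (\<lambda>k l. c * B k l) A = c * minner m1 m2 B A"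
  by (simp add: minner_def sum_distrib_left mult.assoc)

lemma minner_scale_right: "minner m1 m2 B (\<lambda>k l. c * A k l) = c * minner m1 m2 B A"
  by (simp add: minner_def sum_distrib_left mult_ac)

lemma minner_cong:
  "(\<And>k l. k < m1 \<Longrightarrow> l < m2 \<Longrightarrow> A k l = A' k l) \<Longrightarrow> minner m1 m2 A B = minner m1 m2 A' B"
  unfolding minner_def by (intro sum.cong) auto

lemma minner_sum_left:
  "minner m1 m2 (\<lambda>k l. \<Sum>a\<in>I. u a k * v a l) B = (\<Sum>a\<in>I. ip m1 (u a) (mv m2 B (v a)))"
proof -
  have "minner m1 m2 (\<lambda>k l. \<Sum>a\<in>I. u a k * v a l) B = (\<Sum>k<m1. \<Sum>l<m2. \<Sum>a\<in>I. u a k * v a l * B k l)"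
    by (simp add: minner_def sum_distrib_right)
  also have "\<dots> = (\<Sum>k<m1. \<Sum>a\<in>I. \<Sum>l<m2. u a k * v a l * B k l)"
    by (intro sum.cong refl sum.swap)
  also have "\<dots> = (\<Sum>a\<in>I. \<Sum>k<m1. \<Sum>l<m2. u a k * v a l * B k l)"
    by (rule sum.swap)
  finally show ?thesis
    by (simp add: ip_def mv_def sum_distrib_left mult_ac)
qed

lemma minner_sum_self:
  assumes "finite I"
  shows "minner m1 m2 (\<lambda>k l. \<Sum>a\<in>I. u a k * v a l) (\<lambda>k l. \<Sum>a\<in>I. u a k * v a l) =
    (\<Sum>a\<in>I. \<Sum>b\<in>I. ip m1 (u a) (u b) * ip m2 (v b) (v a))"
proof -
  have "mv m2 (\<lambda>k l. \<Sum>a\<in>I. u a k * v a l) x = (\<lambda>k. \<Sum>b\<in>I. ip m2 (v b) x * u b k)" for x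
    unfolding mv_def ip_def sum_distrib_right
    by (subst sum.swap) (simp add: mult_ac)
  then have "minner m1 m2 (\<lambda>k l. \<Sum>a\<in>I. u a k * v a l) (\<lambda>k l. \<Sum>a\<in>I. u a k * v a l) =
      (\<Sum>a\<in>I. \<Sum>b\<in>I. ip m2 (v b) (v a) * ip m1 (u a) (u b))"
    by (simp only: minner_sum_left ip_sum_right)
  then show ?thesis by (simp only: mult.commute)
qed

text \<open>Orthonormality of one factor kills the cross terms of the double sum; the other factors
  may be arbitrary.\<close>

lemma minner_sum_orthonormal_left:
  assumes "finite I" "orthonormal m1 I u"
  shows "minner m1 m2 (\<lambda>k l. \<Sum>a\<in>I. u a k * v a l) (\<lambda>k l. \<Sum>a\<in>I. u a k * v a l) = (\<Sum>a\<in>I. ip m2 (v a) (v a))"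
proof -
  have "(\<Sum>b\<in>I. ip m1 (u a) (u b) * ip m2 (v b) (v a)) = (\<Sum>b\<in>I. if a = b then ip m2 (v b) (v a) else 0)"
    if "a \<in> I" for a
    using assms that by (intro sum.cong) (auto simp: orthonormal_def)
  then show ?thesis using assms by (simp add: minner_sum_self)
qed

lemma minner_sum_orthonormal_right:
  assumes "finite I" "orthonormal m2 I v"
  shows "minner m1 m2 (\<lambda>k l. \<Sum>a\<in>I. u a k * v a l) (\<lambda>k l. \<Sum>a\<in>I. u a k * v a l) = (\<Sum>a\<in>I. ip m1 (u a) (u a))"
proof -
  have "(\<Sum>b\<in>I. ip m1 (u a) (u b) * ip m2 (v b) (v a)) = (\<Sum>b\<in>I. if a = b then ip m1 (u a) (u b) else 0)"
    if "a \<in> I" for a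
    using assms that by (intro sum.cong) (auto simp: orthonormal_def)
  then show ?thesis using assms by (simp add: minner_sum_self)
qed

text \<open>For an orthonormal family \<open>u\<close> this is the orthogonal projection of
  \<open>x\<close> onto the complement of its span.\<close>

definition resid :: "nat \<Rightarrow> 'a set \<Rightarrow> ('a \<Rightarrow> nat \<Rightarrow> real) \<Rightarrow> (nat \<Rightarrow> real) \<Rightarrow> nat \<Rightarrow> real" where
  "resid n I u x = (\<lambda>i. x i - (\<Sum>a\<in>I. ip n (u a) x * u a i))"

lemma ip_resid:
  assumes "finite I" "orthonormal n I u" "b \<in> I"
  shows "ip n (u b) (resid n I u x) = 0"
proof -
  have "(\<Sum>a\<in>I. ip n (u a) x * ip n (u b) (u a)) = (\<Sum>a\<in>I. if b = a then ip n (u a) x else 0)"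
    using assms by (intro sum.cong) (auto simp: orthonormal_def)
  then show ?thesis using assms by (simp add: resid_def ip_diff_right ip_sum_right)
qed

text \<open>Pythagoras: the residual is orthogonal to every \<open>u a\<close>, so only its pairing
  with \<open>x\<close> survives.\<close>

lemma ip_resid_self:
  assumes "finite I" "orthonormal n I u"
  shows "ip n (resid n I u x) (resid n I u x) = ip n x x - (\<Sum>a\<in>I. (ip n (u a) x)\<^sup>2)"
proof -
  have "ip n (resid n I u x) (resid n I u x) =
      ip n x (resid n I u x) - (\<Sum>a\<in>I. ip n (u a) x * ip n (u a) (resid n I u x))"
    by (simp add: resid_def[of n I u x] ip_diff_left ip_sum_left)
  also have "\<dots> = ip n x (resid n I u x)" using assms by (simp add: ip_resid)
  also have "\<dots> = ip n x x - (\<Sum>a\<in>I. (ip n (u a) x)\<^sup>2)"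
  proof -
    have "ip n x (u a) = ip n (u a) x" for a by (rule ip_commute)
    then show ?thesis by (simp add: resid_def ip_diff_right ip_sum_right power2_eq_square)
  qed
  finally show ?thesis .
qed

lemma ip_resid_self_le:
  assumes "finite I" "orthonormal n I u"
  shows "ip n (resid n I u x) (resid n I u x) \<le> ip n x x"
  unfolding ip_resid_self[OF assms] by (simp add: sum_nonneg)

section \<open>Scaling and transposing contractions\<close>

lemma contraction_scale:
  assumes "\<And>x. ip m1 (mv m2 W x) (mv m2 W x) \<le> B\<^sup>2 * ip m2 x x" "B > 0"
  shows "contraction m1 m2 (\<lambda>k l. W k l / B)"
proof -
  have "mv m2 (\<lambda>k l. W k l / B) x = (\<lambda>k. mv m2 W x k / B)" for x
    by (simp add: mv_def sum_divide_distrib)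
  then have "ip m1 (mv m2 (\<lambda>k l. W k l / B) x) (mv m2 (\<lambda>k l. W k l / B) x) = ip m1 (mv m2 W x) (mv m2 W x) / B\<^sup>2" for x
    by (simp add: ip_def sum_divide_distrib power2_eq_square)
  then show ?thesis
    using assms by (simp add: contraction_def divide_le_eq mult.commute)
qed

text \<open>For w the image of y under the transpose, the squared length of w is the pairing of y
  with the image of w under \<open>Z\<close>. Cauchy-Schwarz bounds it by |y| |w|, and one factor
  |w| cancels.\<close>

lemma contraction_transpose:
  assumes "contraction m1 m2 Z"
  shows "contraction m2 m1 (\<lambda>l k. Z k l)"
  unfolding contraction_def
proof
  fix y
  define w where "w = mv m1 (\<lambda>l k. Z k l) y"
  have "ip m2 w w = ip m1 y (mv m2 Z w)"
  proof -
    have "ip m2 w w = (\<Sum>l<m2. \<Sum>k<m1. Z k l * y k * w l)"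
      by (simp add: ip_def w_def mv_def sum_distrib_right)
    also have "\<dots> = (\<Sum>k<m1. \<Sum>l<m2. Z k l * y k * w l)" by (rule sum.swap)
    finally show ?thesis by (simp add: ip_def mv_def sum_distrib_left mult_ac)
  qed
  also have "\<dots> \<le> sqrt (ip m1 y y) * sqrt (ip m1 (mv m2 Z w) (mv m2 Z w))" by (rule ip_Cauchy_Schwarz)
  also have "\<dots> \<le> sqrt (ip m1 y y) * sqrt (ip m2 w w)"
    using assms by (intro mult_left_mono) (auto simp: contraction_def ip_self_nonneg)
  finally have le: "ip m2 w w \<le> sqrt (ip m1 y y) * sqrt (ip m2 w w)" .
  have "ip m2 w w \<le> ip m1 y y"
  proof (cases "ip m2 w w = 0")
    case True
    then show ?thesis by (simp add: ip_self_nonneg)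
  next
    case False
    then have p: "sqrt (ip m2 w w) > 0" using ip_self_nonneg[of m2 w] by simp
    have "sqrt (ip m2 w w) * sqrt (ip m2 w w) \<le> sqrt (ip m1 y y) * sqrt (ip m2 w w)"
      using le ip_self_nonneg[of m2 w] by simp
    then have "sqrt (ip m2 w w) \<le> sqrt (ip m1 y y)" using p by (rule mult_right_le_imp_le)
    then show ?thesis by simp
  qed
  then show "ip m2 (mv m1 (\<lambda>l k. Z k l) y) (mv m1 (\<lambda>l k. Z k l) y) \<le> ip m1 y y"
    by (simp add: w_def)
qed

section \<open>Singular values and the compact singular value decomposition\<close>

lemma right_singular_vectors:
  assumes X: "X \<in> carrier_mat m1 m2"
  obtains p s where "orthonormal m2 {..<m2} p" "\<And>a. s a \<ge> 0"
    "\<And>l l'. l < m2 \<Longrightarrow> l' < m2 \<Longrightarrow> (\<Sum>a<m2. p a l * p a l') = (if l = l' then 1 else 0)"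
    "\<And>a b. a < m2 \<Longrightarrow> b < m2 \<Longrightarrow>
       ip m1 (mv m2 (entries X) (p a)) (mv m2 (entries X) (p b)) = (if a = b then (s a)\<^sup>2 else 0)"
    "nuclear_norm X = (\<Sum>a<m2. s a)"
proof -
  define A where "A = transpose_mat X * X"
  have Xt: "transpose_mat X \<in> carrier_mat m2 m1" using X by simp
  have A: "A \<in> carrier_mat m2 m2" using X by (simp add: A_def)
  have symA: "transpose_mat A = A" unfolding A_def using transpose_mult[OF Xt X] by simp
  obtain P D where P: "P \<in> carrier_mat m2 m2" and D: "D \<in> carrier_mat m2 m2"
    and PP: "transpose_mat P * P = 1\<^sub>m m2" and diag: "diagonal_mat D" and A_eq: "A = P * D * transpose_mat P"
    using symmetric_mat_diagonalizable[OF A symA] by blast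
  have Pt: "transpose_mat P \<in> carrier_mat m2 m2" using P by simp
  have PPt: "P * transpose_mat P = 1\<^sub>m m2" using mat_mult_left_right_inverse[OF Pt P PP] .
  define p where "p a l = P $$ (l, a)" for a l
  \<comment> \<open>The absolute value makes \<open>s a\<close> nonnegative for every index, also
    outside the range of the matrix.\<close>
  define s where "s a = sqrt \<bar>D $$ (a, a)\<bar>" for a
  have orth: "orthonormal m2 {..<m2} p"
    unfolding orthonormal_def
  proof (intro ballI)
    fix a b assume "a \<in> {..<m2}" "b \<in> {..<m2}"
    then show "ip m2 (p a) (p b) = (if a = b then 1 else 0)"
      using arg_cong[OF PP, of "\<lambda>B. B $$ (a, b)"] P
      by (simp add: ip_def p_def scalar_prod_def atLeast0LessThan)
  qed
  have rows: "(\<Sum>a<m2. p a l * p a l') = (if l = l' then 1 else 0)" if "l < m2" "l' < m2" for l l'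
    using arg_cong[OF PPt, of "\<lambda>B. B $$ (l, l')"] P that
    by (simp add: p_def scalar_prod_def atLeast0LessThan)
  \<comment> \<open>\<open>D\<close> is the Gram matrix of the images of the \<open>p a\<close>
    under \<open>X\<close>: these images are orthogonal and the diagonal entries are their squared
    lengths.\<close>
  have D_eq: "D = transpose_mat (X * P) * (X * P)"
  proof -
    have "transpose_mat (X * P) * (X * P) = transpose_mat P * (A * P)"
      using transpose_mult[OF X P] X P by (simp add: A_def assoc_mult_mat[of _ m2 m2 _ m1 _ m2] assoc_mult_mat[of _ m2 m1 _ m2 _ m2])
    also have "A * P = P * D * (transpose_mat P * P)"
      unfolding A_eq using P D by (simp add: assoc_mult_mat[of _ m2 m2 _ m2 _ m2])
    also have "\<dots> = P * D" using PP P D by simp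
    also have "transpose_mat P * (P * D) = (transpose_mat P * P) * D"
      using P D by (simp add: assoc_mult_mat[of _ m2 m2 _ m2 _ m2])
    also have "\<dots> = D" using PP D by simp
    finally show ?thesis by simp
  qed
  have Dab: "D $$ (a, b) = ip m1 (mv m2 (entries X) (p a)) (mv m2 (entries X) (p b))" if "a < m2" "b < m2" for a b
  proof -
    have "(X * P) $$ (k, a) = mv m2 (entries X) (p a) k" if "k < m1" "a < m2" for k a
      using that X P by (simp add: mv_def p_def scalar_prod_def atLeast0LessThan)
    then show ?thesis
      unfolding D_eq using that X P by (simp add: scalar_prod_def ip_def atLeast0LessThan)
  qed
  have Daa: "D $$ (a, a) \<ge> 0" if "a < m2" for a using Dab[OF that that] ip_self_nonneg by simp
  have sing: "ip m1 (mv m2 (entries X) (p a)) (mv m2 (entries X) (p b)) = (if a = b then (s a)\<^sup>2 else 0)"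
    if "a < m2" "b < m2" for a b
    using Dab[OF that] Daa[OF that(1)] that diag D by (auto simp: s_def diagonal_mat_def)
  \<comment> \<open>Similarity matches the roots of the characteristic polynomial, with
    multiplicity, to the diagonal of \<open>D\<close>. This ties the vectors \<open>p\<close> to the
    nuclear norm as it is defined.\<close>
  have "similar_mat_wit A D P (transpose_mat P)"
    by (rule similar_mat_witI[OF PPt PP A_eq A D P Pt])
  then have "char_poly A = char_poly D" by (intro char_poly_similar) (auto simp: similar_mat_def)
  also have "\<dots> = (\<Prod>a\<leftarrow>diag_mat D. [:- a, 1:])"
    by (rule char_poly_upper_triangular[OF D]) (use diag D in \<open>auto simp: diagonal_mat_def upper_triangular_def\<close>)
  finally have cp: "char_poly A = (\<Prod>a\<leftarrow>diag_mat D. [:- a, 1:])" .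
  have "proots (char_poly A) = mset (diag_mat D)"
  proof -
    have "proots (\<Prod>a\<leftarrow>xs. [:- a, 1:]) = mset xs" for xs :: "real list"
    proof (induction xs)
      case (Cons x xs)
      have "(\<Prod>a\<leftarrow>xs. [:- a, 1:]) \<noteq> 0" by (auto simp: prod_list_zero_iff)
      then have "proots ([:- x, 1:] * (\<Prod>a\<leftarrow>xs. [:- a, 1:])) = proots [:- x, 1:] + proots (\<Prod>a\<leftarrow>xs. [:- a, 1:])"
        by (intro proots_mult) auto
      then show ?case using Cons by simp
    qed simp
    then show ?thesis by (simp add: cp)
  qed
  then have "nuclear_norm X = sum_mset (image_mset sqrt (mset (diag_mat D)))"
    by (simp add: nuclear_norm_def singular_values_def A_def)
  also have "\<dots> = sum_list (map sqrt (diag_mat D))" by (simp add: sum_mset_sum_list flip: mset_map)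
  also have "\<dots> = (\<Sum>a<m2. sqrt (D $$ (a, a)))"
    using D by (simp add: diag_mat_def interv_sum_list_conv_sum_set_nat atLeast0LessThan o_def)
  also have "\<dots> = (\<Sum>a<m2. s a)" using Daa by (intro sum.cong) (auto simp: s_def)
  finally have nuc: "nuclear_norm X = (\<Sum>a<m2. s a)" .
  show ?thesis by (rule that[OF orth _ rows sing nuc]) (auto simp: s_def)
qed

text \<open>Inserts the resolution of the identity given by the orthonormal basis \<open>p\<close>
  between \<open>A\<close> and a unit vector.\<close>

lemma mat_expand_orthonormal:
  assumes "\<And>l l'. l < m2 \<Longrightarrow> l' < m2 \<Longrightarrow> (\<Sum>a<m2. p a l * p a l') = (if l = l' then 1 else 0::real)" "l < m2"
  shows "A k l = (\<Sum>a<m2. mv m2 A (p a) k * p a l)"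
proof -
  have "(\<Sum>a<m2. mv m2 A (p a) k * p a l) = (\<Sum>a<m2. \<Sum>l'<m2. A k l' * (p a l' * p a l))"
    by (simp only: mv_def sum_distrib_right mult.assoc)
  also have "\<dots> = (\<Sum>l'<m2. \<Sum>a<m2. A k l' * (p a l' * p a l))" by (rule sum.swap)
  also have "\<dots> = (\<Sum>l'<m2. A k l' * (if l' = l then 1 else 0))"
    using assms by (intro sum.cong) (auto simp flip: sum_distrib_left)
  finally show ?thesis using assms(2) by (simp add: if_distrib cong: if_cong)
qed

text \<open>The easy half of duality. In the basis \<open>p\<close> the pairing is a sum of terms
  that Cauchy-Schwarz bounds by \<open>s a * 1\<close>, as \<open>Z\<close> does not lengthen the
  unit vector \<open>p a\<close>.\<close>

lemma minner_le_nuclear_norm: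
  assumes X: "X \<in> carrier_mat m1 m2" and Z: "contraction m1 m2 Z"
  shows "minner m1 m2 (entries X) Z \<le> nuclear_norm X"
proof -
  obtain p s where orth: "orthonormal m2 {..<m2} p" and s: "\<And>a. s a \<ge> 0"
    and rows: "\<And>l l'. l < m2 \<Longrightarrow> l' < m2 \<Longrightarrow> (\<Sum>a<m2. p a l * p a l') = (if l = l' then 1 else 0)"
    and sing: "\<And>a b. a < m2 \<Longrightarrow> b < m2 \<Longrightarrow>
       ip m1 (mv m2 (entries X) (p a)) (mv m2 (entries X) (p b)) = (if a = b then (s a)\<^sup>2 else 0)"
    and nuc: "nuclear_norm X = (\<Sum>a<m2. s a)"
    by (rule right_singular_vectors[OF X]) (rule that)
  have "minner m1 m2 (entries X) Z = minner m1 m2 (\<lambda>k l. \<Sum>a<m2. mv m2 (entries X) (p a) k * p a l) Z"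
    by (rule minner_cong, rule mat_expand_orthonormal[OF rows]) auto
  also have "\<dots> = (\<Sum>a<m2. ip m1 (mv m2 (entries X) (p a)) (mv m2 Z (p a)))" by (rule minner_sum_left)
  also have "\<dots> \<le> (\<Sum>a<m2. s a)"
  proof (rule sum_mono)
    fix a assume a: "a \<in> {..<m2}"
    have "ip m1 (mv m2 (entries X) (p a)) (mv m2 Z (p a)) \<le>
        sqrt (ip m1 (mv m2 (entries X) (p a)) (mv m2 (entries X) (p a))) * sqrt (ip m1 (mv m2 Z (p a)) (mv m2 Z (p a)))"
      by (rule ip_Cauchy_Schwarz)
    also have "\<dots> \<le> s a * 1"
    proof (intro mult_mono)
      show "sqrt (ip m1 (mv m2 (entries X) (p a)) (mv m2 (entries X) (p a))) \<le> s a"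
        using sing[of a a] a s[of a] by simp
      have "ip m2 (p a) (p a) = 1" using orth a by (simp add: orthonormal_def)
      then have "ip m1 (mv m2 Z (p a)) (mv m2 Z (p a)) \<le> 1" using Z unfolding contraction_def by metis
      then show "sqrt (ip m1 (mv m2 Z (p a)) (mv m2 Z (p a))) \<le> 1" by simp
    qed (use s in \<open>auto simp: ip_self_nonneg\<close>)
    finally show "ip m1 (mv m2 (entries X) (p a)) (mv m2 Z (p a)) \<le> s a" by simp
  qed
  finally show ?thesis by (simp add: nuc)
qed

text \<open>Nonzero pairwise orthogonal vectors in the column space are independent. The hypothesis
  \<open>orth\<close> contains both properties: its case a = b says that the image is
  nonzero.\<close>

lemma rank_ge_orthogonal_images:
  assumes X: "X \<in> carrier_mat m1 m2" and I: "finite I"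
    and orth: "\<And>a b. a \<in> I \<Longrightarrow> b \<in> I \<Longrightarrow>
       (ip m1 (mv m2 (entries X) (p a)) (mv m2 (entries X) (p b)) = 0) = (a \<noteq> b)"
  shows "card I \<le> vec_space.rank m1 X"
proof -
  interpret vec_space "TYPE(real)" m1 .
  define w where "w a = X *\<^sub>v vec m2 (p a)" for a
  have wc: "w a \<in> carrier_vec m1" for a using X by (simp add: w_def)
  have wk: "w a $ k = mv m2 (entries X) (p a) k" if "k < m1" for a k
    using X that by (simp add: w_def mv_def scalar_prod_def atLeast0LessThan)
  have orth': "(\<Sum>k<m1. w a $ k * w b $ k) = 0 \<longleftrightarrow> a \<noteq> b" if "a \<in> I" "b \<in> I" for a b
    using orth[OF that] by (simp add: ip_def wk)
  have inj: "inj_on w I"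
  proof (rule inj_onI, rule ccontr)
    fix a b assume ab: "a \<in> I" "b \<in> I" "w a = w b" "a \<noteq> b"
    then have "(\<Sum>k<m1. w a $ k * w b $ k) = 0" using orth'[of a b] by simp
    then show False using orth'[of a a] ab by simp
  qed
  define U where "U = w ` I"
  have cols: "set (cols X) \<subseteq> carrier_vec m1" using cols_dim X by blast
  have Usp: "U \<subseteq> span (set (cols X))"
  proof -
    have "w a \<in> col_space X" for a
      using X unfolding col_space_eq[OF X] by (auto simp: w_def)
    then show ?thesis by (auto simp: U_def col_space_def)
  qed
  have Uc: "U \<subseteq> carrier_vec m1" using wc by (auto simp: U_def)
  have li: "lin_indpt U"
  proof
    assume "lin_dep U"
    then obtain A c v where A: "finite A" "A \<subseteq> U" and zero: "lincomb c A = 0\<^sub>v m1" and v: "v \<in> A" "c v \<noteq> 0"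
      unfolding lin_dep_def by (auto simp: module_vec_simps class_field_def)
    \<comment> \<open>Pairing the linear relation with \<open>v\<close> isolates the coefficient of
      \<open>v\<close>.\<close>
    have "(\<Sum>x\<in>A. c x * (\<Sum>k<m1. x $ k * v $ k)) = (\<Sum>k<m1. (\<Sum>x\<in>A. c x * x $ k) * v $ k)"
      unfolding sum_distrib_left sum_distrib_right by (subst sum.swap) (simp add: mult_ac)
    also have "\<dots> = (\<Sum>k<m1. (lincomb c A $ k) * v $ k)"
      using A Uc by (intro sum.cong) (auto simp: lincomb_index)
    also have "\<dots> = 0" by (simp add: zero)
    also have "(\<Sum>x\<in>A. c x * (\<Sum>k<m1. x $ k * v $ k)) = (\<Sum>x\<in>A. if x = v then c v * (\<Sum>k<m1. v $ k * v $ k) else 0)"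
    proof (intro sum.cong refl)
      fix x assume "x \<in> A"
      then have "x \<in> w ` I" "v \<in> w ` I" using A v unfolding U_def by blast+
      then obtain a b where "x = w a" "v = w b" "a \<in> I" "b \<in> I" by blast
      then show "c x * (\<Sum>k<m1. x $ k * v $ k) = (if x = v then c v * (\<Sum>k<m1. v $ k * v $ k) else 0)"
        using orth'[of a b] by auto
    qed
    also have "\<dots> = c v * (\<Sum>k<m1. v $ k * v $ k)" using A v by simp
    finally have "(\<Sum>k<m1. v $ k * v $ k) = 0" using v by simp
    moreover obtain b where "b \<in> I" "v = w b" using A v unfolding U_def by blast
    ultimately show False using orth'[of b b] by auto
  qed
  have sub: "submodule class_ring (span (set (cols X))) V"
    using span_is_submodule cols by simp
  have vs: "vectorspace class_ring (span_vs (set (cols X)))"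
    using cols span_is_subspace subspace_def subspace_is_vs by simp
  have "card U \<le> vectorspace.dim class_ring (span_vs (set (cols X)))"
  proof (rule vectorspace.li_le_dim(2)[OF vs])
    show "vectorspace.fin_dim class_ring (span_vs (set (cols X)))" by (rule fin_dim_span_cols[OF X])
    show "U \<subseteq> carrier (span_vs (set (cols X)))" using Usp by simp
    show "\<not> LinearCombinations.module.lin_dep class_ring (span_vs (set (cols X))) U"
      using span_li_not_depend(2)[OF Usp sub] li by simp
  qed
  then show ?thesis by (simp add: rank_def U_def card_image[OF inj])
qed

text \<open>Discards the directions that \<open>X\<close> annihilates; for the others the left
  singular vector is the normalised image of the right one.\<close>

lemma compact_singular_value_decomposition:
  assumes X: "X \<in> carrier_mat m1 m2"
  obtains I :: "nat set" and u v s where "finite I" "card I \<le> vec_space.rank m1 X"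
    "orthonormal m1 I u" "orthonormal m2 I v"
    "\<And>k l. k < m1 \<Longrightarrow> l < m2 \<Longrightarrow> X $$ (k, l) = (\<Sum>a\<in>I. s a * u a k * v a l)"
    "nuclear_norm X = (\<Sum>a\<in>I. s a)"
proof -
  obtain p s where orth: "orthonormal m2 {..<m2} p" and s: "\<And>a. s a \<ge> 0"
    and rows: "\<And>l l'. l < m2 \<Longrightarrow> l' < m2 \<Longrightarrow> (\<Sum>a<m2. p a l * p a l') = (if l = l' then 1 else 0)"
    and sing: "\<And>a b. a < m2 \<Longrightarrow> b < m2 \<Longrightarrow>
       ip m1 (mv m2 (entries X) (p a)) (mv m2 (entries X) (p b)) = (if a = b then (s a)\<^sup>2 else 0)"
    and nuc: "nuclear_norm X = (\<Sum>a<m2. s a)"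
    by (rule right_singular_vectors[OF X]) (rule that)
  define I where "I = {a. a < m2 \<and> s a \<noteq> 0}"
  define u where "u a = (\<lambda>k. mv m2 (entries X) (p a) k / s a)" for a
  have I: "finite I" "I \<subseteq> {..<m2}" by (auto simp: I_def)
  have card: "card I \<le> vec_space.rank m1 X"
    by (rule rank_ge_orthogonal_images[OF X I(1), of p]) (auto simp: I_def sing)
  have ou: "orthonormal m1 I u"
  proof -
    have "ip m1 (u a) (u b) = ip m1 (mv m2 (entries X) (p a)) (mv m2 (entries X) (p b)) / (s a * s b)" for a b
      by (simp add: u_def ip_def sum_divide_distrib)
    then show ?thesis by (auto simp: orthonormal_def I_def sing power2_eq_square)
  qed
  have ov: "orthonormal m2 I p" using orth I(2) unfolding orthonormal_def by blast
  have expand: "X $$ (k, l) = (\<Sum>a\<in>I. s a * u a k * p a l)" if "k < m1" "l < m2" for k l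
  proof -
    have "X $$ (k, l) = (\<Sum>a<m2. mv m2 (entries X) (p a) k * p a l)"
      using mat_expand_orthonormal[OF rows that(2), of "entries X" k] by simp
    also have "\<dots> = (\<Sum>a\<in>I. mv m2 (entries X) (p a) k * p a l)"
    proof (intro sum.mono_neutral_right ballI)
      fix a assume "a \<in> {..<m2} - I"
      then have "ip m1 (mv m2 (entries X) (p a)) (mv m2 (entries X) (p a)) = 0" by (auto simp: I_def sing)
      then have "mv m2 (entries X) (p a) k = 0"
        using that(1) unfolding ip_def by (subst (asm) sum_nonneg_eq_0_iff) auto
      then show "mv m2 (entries X) (p a) k * p a l = 0" by simp
    qed (use I in auto)
    also have "\<dots> = (\<Sum>a\<in>I. s a * u a k * p a l)" by (intro sum.cong) (auto simp: u_def I_def)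
    finally show ?thesis .
  qed
  have "nuclear_norm X = (\<Sum>a\<in>I. s a)"
    unfolding nuc by (intro sum.mono_neutral_right) (auto simp: I_def)
  then show ?thesis using that[OF I(1) card ou ov expand] by blast
qed

section \<open>Dual certificates and norm properties of the nuclear norm\<close>

lemma mv_sum_outer: "mv n (\<lambda>k l. \<Sum>a\<in>I. u a k * v a l) x = (\<lambda>k. \<Sum>a\<in>I. ip n (v a) x * u a k)"
  unfolding mv_def ip_def sum_distrib_right
  by (subst sum.swap) (simp add: mult_ac)

text \<open>A contraction \<open>Y\<close>, compressed to the orthogonal complements of \<open>u\<close> and \<open>v\<close>, can be added to
  \<open>\<Sum>\<^sub>a u\<^sub>a v\<^sub>a\<^sup>T\<close> without leaving the unit ball of the operator norm. The compression changes the Frobenius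
  norm by at most \<open>2 sqrt (card I)\<close>, and the added sum has Frobenius norm \<open>sqrt (card I)\<close>.\<close>
lemma contraction_sum_compression:
  fixes u v :: "'a \<Rightarrow> nat \<Rightarrow> real"
  assumes I: "finite I" and u: "orthonormal m1 I u" and v: "orthonormal m2 I v"
    and Y: "contraction m1 m2 Y"
  obtains Z where "contraction m1 m2 Z"
    "\<And>a. a \<in> I \<Longrightarrow> ip m1 (u a) (mv m2 Z (v a)) = 1"
    "\<And>D. minner m1 m2 D Z \<ge> minner m1 m2 D Y - 3 * sqrt (real (card I)) * sqrt (minner m1 m2 D D)"
proof -
  define Yt where "Yt = (\<lambda>l k. Y k l)"
  define C where "C = (\<lambda>k l. \<Sum>a\<in>I. u a k * v a l)"
  \<comment> \<open>With P and Q the projections onto the spans of \<open>u\<close> and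
    \<open>v\<close>, \<open>A\<close> is P Y and \<open>B\<close> is (1 - P) Y Q, so
    \<open>Y - A - B\<close> is the compression (1 - P) Y (1 - Q). This splitting makes
    \<open>A\<close> and \<open>B\<close> sums of outer products with one orthonormal factor, of
    Frobenius norm at most \<open>sqrt (card I)\<close> each.\<close>
  define A where "A = (\<lambda>k l. \<Sum>a\<in>I. u a k * mv m1 Yt (u a) l)"
  define B where "B = (\<lambda>k l. \<Sum>a\<in>I. resid m1 I u (mv m2 Y (v a)) k * v a l)"
  define Z where "Z = (\<lambda>k l. C k l + (Y k l - A k l - B k l))"
  have adj: "ip m2 (mv m1 Yt y) x = ip m1 y (mv m2 Y x)" for x y
  proof -
    have "ip m2 (mv m1 Yt y) x = (\<Sum>l<m2. \<Sum>k<m1. Y k l * y k * x l)"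
      by (simp add: ip_def Yt_def mv_def sum_distrib_right)
    also have "\<dots> = (\<Sum>k<m1. \<Sum>l<m2. Y k l * y k * x l)" by (rule sum.swap)
    finally show ?thesis by (simp add: ip_def mv_def sum_distrib_left mult_ac)
  qed
  have Yt: "contraction m2 m1 Yt" unfolding Yt_def by (rule contraction_transpose[OF Y])
  have uu: "ip m1 (u a) (u a) = 1" and vv: "ip m2 (v a) (v a) = 1" if "a \<in> I" for a
    using u v that by (auto simp: orthonormal_def)
  have resid_lin: "resid m1 I u (\<lambda>k. x k - (\<Sum>a\<in>I. c a * y a k)) k = 
      resid m1 I u x k - (\<Sum>a\<in>I. c a * resid m1 I u (y a) k)" for x y k and c :: "'a \<Rightarrow> real"
  proof -
    have "(\<Sum>b\<in>I. (\<Sum>a\<in>I. c a * ip m1 (u b) (y a)) * u b k) = (\<Sum>a\<in>I. \<Sum>b\<in>I. c a * (ip m1 (u b) (y a) * u b k))"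
      unfolding sum_distrib_right by (subst sum.swap) (simp add: mult_ac)
    then show ?thesis
      by (simp add: resid_def ip_diff_right ip_sum_right left_diff_distrib right_diff_distrib
          sum_subtractf sum_distrib_left)
  qed
  have mvZ: "mv m2 Z x = (\<lambda>k. (\<Sum>a\<in>I. ip m2 (v a) x * u a k) + resid m1 I u (mv m2 Y (resid m2 I v x)) k)" for x
  proof
    fix k
    have "mv m2 Z x k = mv m2 C x k + (mv m2 Y x k - mv m2 A x k - mv m2 B x k)"
      by (simp add: Z_def mv_def distrib_right left_diff_distrib sum.distrib sum_subtractf)
    also have "mv m2 C x k = (\<Sum>a\<in>I. ip m2 (v a) x * u a k)" by (simp add: C_def mv_sum_outer)
    also have "mv m2 A x k = (\<Sum>a\<in>I. ip m1 (u a) (mv m2 Y x) * u a k)"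
      unfolding A_def by (simp add: mv_sum_outer adj)
    also have "mv m2 Y x k - (\<Sum>a\<in>I. ip m1 (u a) (mv m2 Y x) * u a k) = resid m1 I u (mv m2 Y x) k"
      by (simp add: resid_def)
    also have "mv m2 B x k = (\<Sum>a\<in>I. ip m2 (v a) x * resid m1 I u (mv m2 Y (v a)) k)"
      unfolding B_def by (simp add: mv_sum_outer)
    also have "resid m1 I u (mv m2 Y x) k - \<dots> = resid m1 I u (\<lambda>k. mv m2 Y x k - (\<Sum>a\<in>I. ip m2 (v a) x * mv m2 Y (v a) k)) k"
      by (simp add: resid_lin)
    also have "(\<lambda>k. mv m2 Y x k - (\<Sum>a\<in>I. ip m2 (v a) x * mv m2 Y (v a) k)) = mv m2 Y (resid m2 I v x)"
    proof
      fix k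
      have "(\<Sum>l<m2. Y k l * (\<Sum>a\<in>I. ip m2 (v a) x * v a l)) = (\<Sum>a\<in>I. ip m2 (v a) x * (\<Sum>l<m2. Y k l * v a l))"
        unfolding sum_distrib_left by (subst sum.swap) (simp add: mult_ac)
      then show "mv m2 Y x k - (\<Sum>a\<in>I. ip m2 (v a) x * mv m2 Y (v a) k) = mv m2 Y (resid m2 I v x) k"
        by (simp add: mv_def resid_def right_diff_distrib sum_subtractf)
    qed
    finally show "mv m2 Z x k = (\<Sum>a\<in>I. ip m2 (v a) x * u a k) + resid m1 I u (mv m2 Y (resid m2 I v x)) k" .
  qed
  \<comment> \<open>The image of x splits into two orthogonal parts. The first is as long as the
    projection of x onto the span of \<open>v\<close>, the second at most as long as its
    residual.\<close>
  have con: "contraction m1 m2 Z"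
    unfolding contraction_def
  proof
    fix x
    define w where "w = resid m1 I u (mv m2 Y (resid m2 I v x))"
    define g where "g = (\<lambda>k. \<Sum>a\<in>I. ip m2 (v a) x * u a k)"
    have gg: "ip m1 g g = (\<Sum>a\<in>I. (ip m2 (v a) x)\<^sup>2)"
    proof -
      have "ip m1 g g = (\<Sum>a\<in>I. ip m2 (v a) x * (\<Sum>b\<in>I. ip m2 (v b) x * ip m1 (u a) (u b)))"
        by (simp add: g_def ip_sum_left ip_sum_right)
      also have "\<dots> = (\<Sum>a\<in>I. ip m2 (v a) x * (\<Sum>b\<in>I. if a = b then ip m2 (v b) x else 0))"
        using u by (intro sum.cong refl arg_cong2[where f = "(*)"]) (auto simp: orthonormal_def)
      finally show ?thesis using I by (simp add: power2_eq_square)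
    qed
    have gw: "ip m1 g w = 0" by (simp add: g_def ip_sum_left w_def ip_resid[OF I u])
    have "ip m1 (mv m2 Z x) (mv m2 Z x) = ip m1 g g + ip m1 w w"
      unfolding mvZ using gw by (simp add: g_def[symmetric] w_def[symmetric] ip_add_left ip_add_right ip_commute[of m1 w g])
    also have "ip m1 w w \<le> ip m1 (mv m2 Y (resid m2 I v x)) (mv m2 Y (resid m2 I v x))"
      unfolding w_def by (rule ip_resid_self_le[OF I u])
    also have "\<dots> \<le> ip m2 (resid m2 I v x) (resid m2 I v x)" using Y by (simp add: contraction_def)
    also have "\<dots> = ip m2 x x - (\<Sum>a\<in>I. (ip m2 (v a) x)\<^sup>2)" by (rule ip_resid_self[OF I v])
    finally show "ip m1 (mv m2 Z x) (mv m2 Z x) \<le> ip m2 x x" by (simp add: gg)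
  qed
  have cert: "ip m1 (u a) (mv m2 Z (v a)) = 1" if a: "a \<in> I" for a
  proof -
    have "(\<Sum>b\<in>I. ip m2 (v b) (v a) * ip m1 (u a) (u b)) = (\<Sum>b\<in>I. if a = b then 1 else 0)"
      using u v a by (intro sum.cong) (auto simp: orthonormal_def)
    then show ?thesis
      using I a by (simp add: mvZ ip_add_right ip_sum_right ip_resid[OF I u a])
  qed
  have CC: "minner m1 m2 C C \<le> real (card I)"
    unfolding C_def minner_sum_orthonormal_left[OF I u] by (simp add: vv)
  have AA: "minner m1 m2 A A \<le> real (card I)"
  proof -
    have "minner m1 m2 A A = (\<Sum>a\<in>I. ip m2 (mv m1 Yt (u a)) (mv m1 Yt (u a)))"
      unfolding A_def by (rule minner_sum_orthonormal_left[OF I u])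
    also have "\<dots> \<le> (\<Sum>a\<in>I. ip m1 (u a) (u a))" using Yt by (intro sum_mono) (simp add: contraction_def)
    finally show ?thesis by (simp add: uu)
  qed
  have BB: "minner m1 m2 B B \<le> real (card I)"
  proof -
    have "minner m1 m2 B B = (\<Sum>a\<in>I. ip m1 (resid m1 I u (mv m2 Y (v a))) (resid m1 I u (mv m2 Y (v a))))"
      unfolding B_def by (rule minner_sum_orthonormal_right[OF I v])
    also have "\<dots> \<le> (\<Sum>a\<in>I. ip m2 (v a) (v a))"
    proof (rule sum_mono)
      fix a
      have "ip m1 (resid m1 I u (mv m2 Y (v a))) (resid m1 I u (mv m2 Y (v a))) \<le> ip m1 (mv m2 Y (v a)) (mv m2 Y (v a))"
        by (rule ip_resid_self_le[OF I u])
      also have "\<dots> \<le> ip m2 (v a) (v a)" using Y by (simp add: contraction_def)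
      finally show "ip m1 (resid m1 I u (mv m2 Y (v a))) (resid m1 I u (mv m2 Y (v a))) \<le> ip m2 (v a) (v a)" .
    qed
    finally show ?thesis by (simp add: vv)
  qed
  have bound: "\<bar>minner m1 m2 D E\<bar> \<le> sqrt (real (card I)) * sqrt (minner m1 m2 D D)"
    if "minner m1 m2 E E \<le> real (card I)" for D E
  proof -
    have le: "sqrt (minner m1 m2 D D) * sqrt (minner m1 m2 E E) \<le> sqrt (minner m1 m2 D D) * sqrt (real (card I))"
      using that by (intro mult_left_mono) (auto simp: minner_self_nonneg)
    have "minner m1 m2 D E \<le> sqrt (minner m1 m2 D D) * sqrt (real (card I))"
      using minner_Cauchy_Schwarz[of m1 m2 D E] le by linarith
    moreover have "- minner m1 m2 D E \<le> sqrt (minner m1 m2 D D) * sqrt (real (card I))"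
      using minner_Cauchy_Schwarz[of m1 m2 "\<lambda>k l. - D k l" E] le
        minner_scale_left[of m1 m2 "-1" D E] minner_scale_left[of m1 m2 "-1" D] minner_scale_right[of m1 m2 _ "-1" D]
      by simp
    ultimately show ?thesis by (simp add: mult.commute)
  qed
  have "minner m1 m2 D Z \<ge> minner m1 m2 D Y - 3 * sqrt (real (card I)) * sqrt (minner m1 m2 D D)" for D
  proof -
    have "minner m1 m2 D Z = minner m1 m2 D C + (minner m1 m2 D Y - minner m1 m2 D A - minner m1 m2 D B)"
      by (simp add: Z_def minner_add_right minner_diff_right)
    then show ?thesis using bound[OF CC, of D] bound[OF AA, of D] bound[OF BB, of D] by (simp add: abs_le_iff)
  qed
  then show ?thesis using that con cert by blast
qed

text \<open>Compressing the zero contraction yields a certificate that pairs to 1 with every pair of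
  singular vectors, so the supremum is attained.\<close>

lemma nuclear_norm_dual:
  assumes X: "X \<in> carrier_mat m1 m2"
  obtains Z where "contraction m1 m2 Z" "minner m1 m2 (entries X) Z = nuclear_norm X"
proof -
  obtain I :: "nat set" and u v s where I: "finite I" and card: "card I \<le> vec_space.rank m1 X"
    and u: "orthonormal m1 I u" and v: "orthonormal m2 I v"
    and expand: "\<And>k l. k < m1 \<Longrightarrow> l < m2 \<Longrightarrow> X $$ (k, l) = (\<Sum>a\<in>I. s a * u a k * v a l)"
    and nuc: "nuclear_norm X = (\<Sum>a\<in>I. s a)"
    by (rule compact_singular_value_decomposition[OF X]) (rule that)
  have "contraction m1 m2 (\<lambda>_ _. 0)" by (simp add: contraction_def mv_def ip_self_nonneg)
  then obtain Z where Z: "contraction m1 m2 Z" "\<And>a. a \<in> I \<Longrightarrow> ip m1 (u a) (mv m2 Z (v a)) = 1"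
    by (rule contraction_sum_compression[OF I u v]) blast
  have "minner m1 m2 (entries X) Z = minner m1 m2 (\<lambda>k l. \<Sum>a\<in>I. (s a * u a k) * v a l) Z"
    by (rule minner_cong) (simp add: expand)
  also have "\<dots> = (\<Sum>a\<in>I. s a * ip m1 (u a) (mv m2 Z (v a)))"
    unfolding minner_sum_left by (simp add: ip_def sum_distrib_left mult_ac)
  also have "\<dots> = nuclear_norm X" by (simp add: Z nuc)
  finally show ?thesis using that Z by blast
qed

text \<open>Test \<open>X\<close> against a single certificate that is exact for \<open>B\<close>
  and, up to the cost of compressing it, also exact for \<open>X - B\<close>. That cost is the
  Frobenius term.\<close>

lemma nuclear_norm_perturbation:
  assumes X: "X \<in> carrier_mat m1 m2" and B: "B \<in> carrier_mat m1 m2"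
  shows "nuclear_norm X \<ge> nuclear_norm B + nuclear_norm (X - B)
    - 3 * sqrt (real (vec_space.rank m1 B)) * frobenius_norm (X - B)"
proof -
  obtain I :: "nat set" and u v s where I: "finite I" and card: "card I \<le> vec_space.rank m1 B"
    and u: "orthonormal m1 I u" and v: "orthonormal m2 I v"
    and expand: "\<And>k l. k < m1 \<Longrightarrow> l < m2 \<Longrightarrow> B $$ (k, l) = (\<Sum>a\<in>I. s a * u a k * v a l)"
    and nuc: "nuclear_norm B = (\<Sum>a\<in>I. s a)"
    by (rule compact_singular_value_decomposition[OF B]) (rule that)
  have D: "X - B \<in> carrier_mat m1 m2" by (rule minus_carrier_mat[OF B])
  obtain Y where Y: "contraction m1 m2 Y" "minner m1 m2 (entries (X - B)) Y = nuclear_norm (X - B)"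
    using nuclear_norm_dual[OF D] by blast
  obtain Z where Z: "contraction m1 m2 Z" "\<And>a. a \<in> I \<Longrightarrow> ip m1 (u a) (mv m2 Z (v a)) = 1"
    "\<And>D. minner m1 m2 D Z \<ge> minner m1 m2 D Y - 3 * sqrt (real (card I)) * sqrt (minner m1 m2 D D)"
    by (rule contraction_sum_compression[OF I u v Y(1)]) (rule that)
  have "minner m1 m2 (entries B) Z = minner m1 m2 (\<lambda>k l. \<Sum>a\<in>I. (s a * u a k) * v a l) Z"
    by (rule minner_cong) (simp add: expand)
  also have "\<dots> = (\<Sum>a\<in>I. s a * ip m1 (u a) (mv m2 Z (v a)))"
    unfolding minner_sum_left by (simp add: ip_def sum_distrib_left mult_ac)
  also have "\<dots> = nuclear_norm B" by (simp add: Z nuc)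
  finally have 1: "minner m1 m2 (entries B) Z = nuclear_norm B" .
  have frob: "sqrt (minner m1 m2 (entries (X - B)) (entries (X - B))) = frobenius_norm (X - B)"
    using X B unfolding frobenius_norm_def minner_def by (auto simp: power2_eq_square intro!: sum.cong)
  have "3 * sqrt (real (card I)) * frobenius_norm (X - B) \<le> 3 * sqrt (real (vec_space.rank m1 B)) * frobenius_norm (X - B)"
    using card by (intro mult_right_mono) (auto simp: frobenius_norm_def intro!: sum_nonneg)
  then have 2: "minner m1 m2 (entries (X - B)) Z \<ge> nuclear_norm (X - B) - 3 * sqrt (real (vec_space.rank m1 B)) * frobenius_norm (X - B)"
    using Z(3)[of "entries (X - B)"] unfolding Y(2) frob by linarith
  have "minner m1 m2 (entries X) Z = minner m1 m2 (\<lambda>k l. entries B k l + entries (X - B) k l) Z"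
    using X B by (intro minner_cong) auto
  also have "\<dots> = minner m1 m2 (entries B) Z + minner m1 m2 (entries (X - B)) Z"
    by (rule minner_add_left)
  finally show ?thesis
    using 1 2 minner_le_nuclear_norm[OF X Z(1)] by linarith
qed

lemma nuclear_norm_triangle:
  assumes "A \<in> carrier_mat m1 m2" "B \<in> carrier_mat m1 m2" "C \<in> carrier_mat m1 m2" "0 \<le> a" "0 \<le> b"
    and "\<And>k l. k < m1 \<Longrightarrow> l < m2 \<Longrightarrow> C $$ (k, l) = a * A $$ (k, l) + b * B $$ (k, l)"
  shows "nuclear_norm C \<le> a * nuclear_norm A + b * nuclear_norm B"
proof -
  obtain Z where Z: "contraction m1 m2 Z" "minner m1 m2 (entries C) Z = nuclear_norm C"
    using nuclear_norm_dual[OF assms(3)] by blast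
  have "minner m1 m2 (entries C) Z = minner m1 m2 (\<lambda>k l. a * A $$ (k, l) + b * B $$ (k, l)) Z"
    by (rule minner_cong) (simp add: assms)
  also have "\<dots> = a * minner m1 m2 (entries A) Z + b * minner m1 m2 (entries B) Z"
    by (simp add: minner_add_left minner_scale_left)
  also have "\<dots> \<le> a * nuclear_norm A + b * nuclear_norm B"
    using assms minner_le_nuclear_norm[OF _ Z(1)] by (intro add_mono mult_left_mono) auto
  finally show ?thesis by (simp add: Z)
qed

text \<open>The triangle inequality with weight \<open>t\<close> gives one direction and with weight
  \<open>1 / t\<close> the other.\<close>

lemma nuclear_norm_scale:
  assumes A: "A \<in> carrier_mat m1 m2" "C \<in> carrier_mat m1 m2" and t: "0 \<le> t"
    and C: "\<And>k l. k < m1 \<Longrightarrow> l < m2 \<Longrightarrow> C $$ (k, l) = t * A $$ (k, l)"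
  shows "nuclear_norm C = t * nuclear_norm A"
proof -
  have le: "nuclear_norm C \<le> t * nuclear_norm A"
    using nuclear_norm_triangle[OF A(1) A(1) A(2) t order_refl] C by simp
  show ?thesis
  proof (cases "t = 0")
    case False
    then have "nuclear_norm A \<le> (1 / t) * nuclear_norm C"
      using nuclear_norm_triangle[OF A(2) A(2) A(1), of "1 / t" 0] t C by simp
    then show ?thesis using le t False by (simp add: field_simps)
  next
    case True
    obtain Z where Z: "contraction m1 m2 Z" "minner m1 m2 (entries C) Z = nuclear_norm C"
      using nuclear_norm_dual[OF A(2)] by blast
    have "minner m1 m2 (entries C) Z = minner m1 m2 (\<lambda>_ _. 0) Z"
      by (rule minner_cong) (simp add: C True)
    then show ?thesis using Z True by (simp add: minner_def)
  qed
qed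

lemma nuclear_norm_nonneg:
  assumes A: "A \<in> carrier_mat m1 m2"
  shows "nuclear_norm A \<ge> 0"
  using minner_le_nuclear_norm[OF A, of "\<lambda>_ _. 0"]
  by (simp add: contraction_def mv_def ip_self_nonneg minner_def)

lemma minner_le_nuclear_norm_times:
  assumes X: "X \<in> carrier_mat m1 m2" and B: "B \<ge> 0"
    and W: "\<And>x. ip m1 (mv m2 W x) (mv m2 W x) \<le> B\<^sup>2 * ip m2 x x"
  shows "minner m1 m2 (entries X) W \<le> B * nuclear_norm X"
proof (cases "B = 0")
  case False
  then have B: "B > 0" using B by simp
  have "minner m1 m2 (entries X) (\<lambda>k l. W k l / B) \<le> nuclear_norm X"
    by (rule minner_le_nuclear_norm[OF X contraction_scale[OF W B]])
  moreover have "minner m1 m2 (entries X) (\<lambda>k l. W k l / B) = minner m1 m2 (entries X) W / B"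
    using minner_scale_right[of m1 m2 "entries X" "1 / B" W] by simp
  ultimately show ?thesis using B by (simp add: divide_le_eq mult.commute)
next
  \<comment> \<open>Here one cannot divide by the bound; testing \<open>W\<close> on unit vectors
    shows that its entries vanish.\<close>
  case True
  have "W k l = 0" if "k < m1" "l < m2" for k l
  proof -
    define x where "x = (\<lambda>i. if i = l then 1 else 0::real)"
    have "mv m2 W x = (\<lambda>k. W k l)" using that by (simp add: mv_def x_def if_distrib cong: if_cong)
    then have "(\<Sum>k<m1. W k l * W k l) \<le> 0" using W[of x] True by (simp add: ip_def)
    then have "(\<Sum>k<m1. W k l * W k l) = 0" by (intro antisym sum_nonneg) auto
    then show ?thesis using that by (subst (asm) sum_nonneg_eq_0_iff) auto
  qed
  then have "minner m1 m2 (entries X) W = 0" by (simp add: minner_def)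
  then show ?thesis using True by simp
qed


section \<open>Traces of powers of signed adjacency matrices\<close>

text \<open>Matrix powers over an arbitrary finite index set: the vertices used later are a disjoint
  union of rows and columns.\<close>

primrec fpow :: "'v set \<Rightarrow> ('v \<Rightarrow> 'v \<Rightarrow> real) \<Rightarrow> nat \<Rightarrow> 'v \<Rightarrow> 'v \<Rightarrow> real" where
  "fpow V Z 0 x y = of_bool (x = y)"
| "fpow V Z (Suc q) x y = (\<Sum>z\<in>V. Z x z * fpow V Z q z y)"

lemma fpow_add:
  assumes "finite V" "x \<in> V"
  shows "fpow V Z (p + q) x y = (\<Sum>z\<in>V. fpow V Z p x z * fpow V Z q z y)"
  using assms(2)
proof (induction p arbitrary: x)
  case 0
  have "(\<Sum>z\<in>V. fpow V Z 0 x z * fpow V Z q z y) = (\<Sum>z\<in>V. if x = z then fpow V Z q z y else 0)"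
    by (intro sum.cong) auto
  then show ?case using assms(1) 0 by simp
next
  case (Suc p)
  have "fpow V Z (Suc p + q) x y = (\<Sum>w\<in>V. \<Sum>z\<in>V. Z x w * (fpow V Z p w z * fpow V Z q z y))"
    using Suc by (simp add: sum_distrib_left)
  also have "\<dots> = (\<Sum>z\<in>V. \<Sum>w\<in>V. Z x w * (fpow V Z p w z * fpow V Z q z y))" by (rule sum.swap)
  finally show ?case by (simp add: sum_distrib_right mult.assoc)
qed

lemma fpow_1: "finite V \<Longrightarrow> y \<in> V \<Longrightarrow> fpow V Z (Suc 0) x y = Z x y"
  by (simp add: if_distrib cong: if_cong)

lemma fpow_symmetric:
  assumes "finite V" and sym: "\<And>x y. Z x y = Z y x" and "x \<in> V" "y \<in> V"
  shows "fpow V Z q x y = fpow V Z q y x"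
  using assms(3,4)
proof (induction q arbitrary: x y)
  case (Suc q)
  have "fpow V Z (Suc q) x y = (\<Sum>z\<in>V. fpow V Z q z y * Z x z)" by (simp add: mult.commute)
  also have "\<dots> = (\<Sum>z\<in>V. fpow V Z q y z * fpow V Z (Suc 0) z x)"
    using Suc assms(1) by (intro sum.cong refl arg_cong2[where f = "(*)"]) (simp_all add: fpow_1 sym[of x] del: fpow.simps(2))
  also have "\<dots> = fpow V Z (q + Suc 0) y x" using fpow_add[OF assms(1) Suc.prems(2)] by metis
  finally show ?case by simp
qed auto

text \<open>The norms of the iterates \<open>Z\<^sup>q z\<close> are log-convex in \<open>q\<close>, so \<open>\<parallel>Z z\<parallel>\<^sup>p \<le> \<parallel>Z\<^sup>p z\<parallel>\<close> for a
  unit vector \<open>z\<close>.\<close>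
lemma norm_pow_le_trace_pow:
  fixes Z :: "'v \<Rightarrow> 'v \<Rightarrow> real"
  assumes fin: "finite V" and sym: "\<And>x y. Z x y = Z y x"
  shows "(\<Sum>x\<in>V. (\<Sum>y\<in>V. Z x y * z y)\<^sup>2) ^ Suc p \<le>
    (\<Sum>x\<in>V. fpow V Z (2 * Suc p) x x) * (\<Sum>x\<in>V. (z x)\<^sup>2) ^ Suc p"
proof -
  define v where "v q x = (\<Sum>y\<in>V. fpow V Z q x y * z y)" for q x
  define a where "a q = L2_set (v q) V" for q
  have v0: "v 0 x = z x" if "x \<in> V" for x
    using that fin by (simp add: v_def if_distrib[of "\<lambda>c. c * _"] of_bool_def cong: if_cong)
  have vSuc: "v (Suc q) x = (\<Sum>y\<in>V. Z x y * v q y)" for q x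
    unfolding v_def fpow.simps sum_distrib_left sum_distrib_right
    by (subst sum.swap) (simp add: mult.assoc)
  have a_nonneg: "a q \<ge> 0" for q by (simp add: a_def)
  have a_sq: "(a q)\<^sup>2 = (\<Sum>x\<in>V. (v q x)\<^sup>2)" for q by (simp add: a_def L2_set_def sum_nonneg)
  have CS: "(\<Sum>x\<in>V. f x * g x) \<le> L2_set f V * L2_set g V" for f g
  proof -
    have "(\<Sum>x\<in>V. f x * g x) \<le> (\<Sum>x\<in>V. \<bar>f x\<bar> * \<bar>g x\<bar>)"
      by (intro sum_mono) (simp flip: abs_mult)
    then show ?thesis using L2_set_mult_ineq[of f g V] by linarith
  qed
  \<comment> \<open>By symmetry of \<open>Z\<close> the squared norm of iterate q + 1 is the inner
    product of iterates q and q + 2.\<close>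
  have logconvex: "(a (Suc q))\<^sup>2 \<le> a q * a (Suc (Suc q))" for q
  proof -
    have "(a (Suc q))\<^sup>2 = (\<Sum>x\<in>V. \<Sum>y\<in>V. Z x y * v q y * v (Suc q) x)"
    proof -
      have "(v (Suc q) x)\<^sup>2 = (\<Sum>y\<in>V. Z x y * v q y) * v (Suc q) x" for x
        unfolding vSuc[of q, symmetric] by (simp add: power2_eq_square)
      then show ?thesis by (simp add: a_sq sum_distrib_right)
    qed
    also have "\<dots> = (\<Sum>y\<in>V. \<Sum>x\<in>V. Z x y * v q y * v (Suc q) x)" by (rule sum.swap)
    also have "\<dots> = (\<Sum>y\<in>V. v q y * v (Suc (Suc q)) y)"
      by (simp add: vSuc[of "Suc q"] sum_distrib_left mult_ac sym)
    also have "\<dots> \<le> a q * a (Suc (Suc q))" unfolding a_def by (rule CS)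
    finally show ?thesis .
  qed
  \<comment> \<open>Log-convexity means that successive ratios increase. The product form also
    covers vanishing iterates.\<close>
  have ratio: "a 1 * a q \<le> a 0 * a (Suc q)" for q
  proof (induction q)
    case (Suc q)
    show ?case
    proof (cases "a (Suc q) = 0")
      case False
      then have pos: "a (Suc q) > 0" using a_nonneg[of "Suc q"] by simp
      have "a 1 * (a (Suc q))\<^sup>2 \<le> a 1 * (a q * a (Suc (Suc q)))"
        by (intro mult_left_mono logconvex a_nonneg)
      also have "\<dots> \<le> (a 0 * a (Suc q)) * a (Suc (Suc q))"
        using mult_right_mono[OF Suc a_nonneg[of "Suc (Suc q)"]] by (simp add: mult.assoc)
      finally have "a (Suc q) * (a 1 * a (Suc q)) \<le> a (Suc q) * (a 0 * a (Suc (Suc q)))"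
        by (simp add: power2_eq_square mult_ac)
      then show ?thesis using pos by simp
    qed (simp add: a_nonneg)
  qed (simp add: mult.commute)
  have power: "a 1 ^ Suc q \<le> a (Suc q) * a 0 ^ q" for q
  proof (induction q)
    case (Suc q)
    have "a 1 ^ Suc (Suc q) \<le> a 1 * (a (Suc q) * a 0 ^ q)"
      using mult_left_mono[OF Suc a_nonneg[of 1]] by simp
    also have "\<dots> \<le> (a 0 * a (Suc (Suc q))) * a 0 ^ q"
      using mult_right_mono[OF ratio[of "Suc q"], of "a 0 ^ q"] a_nonneg by (simp add: mult.assoc)
    finally show ?case by (simp add: mult_ac)
  qed simp
  \<comment> \<open>Cauchy-Schwarz row by row leaves the squared Frobenius norm of the q-th power,
    which is the trace of the 2q-th power by symmetry.\<close>
  have trace: "(a q)\<^sup>2 \<le> (\<Sum>x\<in>V. fpow V Z (2 * q) x x) * (a 0)\<^sup>2" for q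
  proof -
    have "(a q)\<^sup>2 \<le> (\<Sum>x\<in>V. (\<Sum>y\<in>V. (fpow V Z q x y)\<^sup>2) * (\<Sum>y\<in>V. (z y)\<^sup>2))"
      unfolding a_sq v_def by (intro sum_mono Cauchy_Schwarz_ineq_sum)
    also have "\<dots> = (\<Sum>x\<in>V. \<Sum>y\<in>V. fpow V Z q x y * fpow V Z q y x) * (a 0)\<^sup>2"
    proof -
      have "(fpow V Z q x y)\<^sup>2 = fpow V Z q x y * fpow V Z q y x" if "x \<in> V" "y \<in> V" for x y
        using fpow_symmetric[where Z = Z, OF fin sym that, of q] by (simp add: power2_eq_square)
      moreover have "(\<Sum>y\<in>V. (z y)\<^sup>2) = (a 0)\<^sup>2" by (simp add: a_sq v0)
      ultimately show ?thesis by (simp add: sum_distrib_right[symmetric])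
    qed
    also have "(\<Sum>x\<in>V. \<Sum>y\<in>V. fpow V Z q x y * fpow V Z q y x) = (\<Sum>x\<in>V. fpow V Z (2 * q) x x)"
      using fpow_add[OF fin, of _ Z q q] by (simp add: mult_2)
    finally show ?thesis .
  qed
  have "((a 1)\<^sup>2) ^ Suc p = (a 1 ^ Suc p)\<^sup>2" by (simp only: power_mult[symmetric] mult.commute)
  also have "\<dots> \<le> (a (Suc p) * a 0 ^ p)\<^sup>2" by (intro power_mono power) (simp add: a_nonneg)
  also have "\<dots> = (a (Suc p))\<^sup>2 * ((a 0)\<^sup>2) ^ p" by (simp only: power_mult_distrib power_mult[symmetric] mult.commute)
  also have "\<dots> \<le> (\<Sum>x\<in>V. fpow V Z (2 * Suc p) x x) * (a 0)\<^sup>2 * ((a 0)\<^sup>2) ^ p"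
    by (intro mult_right_mono trace) simp
  finally have "((a 1)\<^sup>2) ^ Suc p \<le> (\<Sum>x\<in>V. fpow V Z (2 * Suc p) x x) * ((a 0)\<^sup>2) ^ Suc p"
    by (simp add: mult.assoc)
  moreover have "(a 1)\<^sup>2 = (\<Sum>x\<in>V. (\<Sum>y\<in>V. Z x y * z y)\<^sup>2)"
    unfolding a_sq One_nat_def vSuc by (simp add: v0)
  moreover have "(a 0)\<^sup>2 = (\<Sum>x\<in>V. (z x)\<^sup>2)" by (simp add: a_sq v0)
  ultimately show ?thesis by simp
qed

text \<open>\<open>B\<close> is the set of indices that carry a minus sign, so an average over
  independent fair signs is a finite sum over \<open>Pow I\<close> divided by
  \<open>2 ^ card I\<close>.\<close>

definition sgn_of :: "'i set \<Rightarrow> 'i \<Rightarrow> real" where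
  "sgn_of B i = (if i \<in> B then - 1 else 1)"

text \<open>Toggling the membership of one fixed j of \<open>S\<close> in \<open>B\<close> is an
  involution that reverses the sign of the product.\<close>

lemma sum_prod_signs:
  assumes "finite I" "S \<subseteq> I" "S \<noteq> {}"
  shows "(\<Sum>B\<in>Pow I. \<Prod>i\<in>S. sgn_of B i) = 0"
proof -
  have fS: "finite S" using assms finite_subset by blast
  obtain j where j: "j \<in> S" using assms by auto
  define flip where "flip B = (if j \<in> B then B - {j} else insert j B)" for B
  have neg: "(\<Prod>i\<in>S. sgn_of (flip B) i) = - (\<Prod>i\<in>S. sgn_of B i)" for B
  proof -
    have "(\<Prod>i\<in>S. sgn_of C i) = sgn_of C j * (\<Prod>i\<in>S - {j}. sgn_of C i)" for C :: "'a set"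
      using fS j by (simp add: prod.remove)
    moreover have "(\<Prod>i\<in>S - {j}. sgn_of (flip B) i) = (\<Prod>i\<in>S - {j}. sgn_of B i)"
      by (intro prod.cong) (auto simp: flip_def sgn_of_def)
    moreover have "sgn_of (flip B) j = - sgn_of B j" by (auto simp: flip_def sgn_of_def)
    ultimately show ?thesis by simp
  qed
  have "(\<Sum>B\<in>Pow I. \<Prod>i\<in>S. sgn_of B i) = (\<Sum>B\<in>Pow I. \<Prod>i\<in>S. sgn_of (flip B) i)"
    by (rule sum.reindex_bij_witness[where i = flip and j = flip])
      (use j assms(2) in \<open>auto simp: flip_def insert_absorb\<close>)
  then show ?thesis by (simp add: neg sum_negf)
qed

text \<open>Expanding the power and averaging over the signs leaves the walks that use every edge an
  even number of times. Reading a walk step by step, \<open>k\<close> is the number of edges used an odd number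
  of times so far: a step either reuses one of them or opens one of at most \<open>N\<close> other edges.\<close>
fun walk_bound :: "real \<Rightarrow> nat \<Rightarrow> nat \<Rightarrow> real" where
  "walk_bound N 0 k = of_bool (k = 0)"
| "walk_bound N (Suc q) k = real k * walk_bound N q (k - 1) + N * walk_bound N q (k + 1)"

lemma walk_bound_nonneg: "N \<ge> 0 \<Longrightarrow> walk_bound N q k \<ge> 0"
  by (induction q arbitrary: k) auto

lemma walk_bound_eq_0: "q < k \<Longrightarrow> walk_bound N q k = 0"
  by (induction q arbitrary: k) auto

text \<open>Assign the k open edges to distinct steps, pair up the remaining 2j steps, and choose
  one of N edges for each pair. For k = 0 this is the moment of order 2j of a centred Gaussian of
  variance N.\<close>

lemma walk_bound_closed_form:
  "walk_bound N (2 * j + k) k = fact (2 * j + k) / (2 ^ j * fact j) * N ^ j"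
proof (induction "2 * j + k" arbitrary: j k rule: less_induct)
  case less
  show ?case
  proof (cases j)
    case 0
    show ?thesis
    proof (cases k)
      case (Suc k')
      have "walk_bound N k' k' = fact k'" using less[of 0 k'] 0 Suc by simp
      then show ?thesis using 0 Suc by (simp add: walk_bound_eq_0)
    qed (simp add: 0)
  next
    case (Suc i)
    have up: "walk_bound N (2 * i + Suc k) (Suc k) = fact (2 * i + Suc k) / (2 ^ i * fact i) * N ^ i"
      using less[of i "Suc k"] Suc by simp
    have down: "real k * walk_bound N (2 * i + Suc k) (k - 1) = real k * (fact (2 * i + Suc k) / (2 ^ j * fact j) * N ^ j)"
    proof (cases k)
      case (Suc k')
      then show ?thesis using less[of j k'] \<open>j = Suc i\<close> by simp
    qed simp
    have "walk_bound N (2 * j + k) k = real k * walk_bound N (2 * i + Suc k) (k - 1) + N * walk_bound N (2 * i + Suc k) (Suc k)"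
      using Suc by simp
    also have "\<dots> = fact (2 * i + Suc k) * N ^ j / (2 ^ j * fact j) * (real k + 2 * real j)"
    proof -
      have "N * (fact (2 * i + Suc k) / (2 ^ i * fact i) * N ^ i) =
          fact (2 * i + Suc k) * N ^ j / (2 ^ j * fact j) * (2 * real j)"
        unfolding Suc by (simp add: divide_simps)
      moreover have "real k * (fact (2 * i + Suc k) / (2 ^ j * fact j) * N ^ j) =
          fact (2 * i + Suc k) * N ^ j / (2 ^ j * fact j) * real k"
        by simp
      ultimately show ?thesis unfolding up down by (simp only: distrib_left)
    qed
    also have "\<dots> = fact (2 * j + k) / (2 ^ j * fact j) * N ^ j"
      using Suc by (simp add: field_simps)
    finally show ?thesis .
  qed
qed

section \<open>Averages of matrix powers and exponentials over random signs\<close>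

context
  fixes I :: "'i set" and V :: "'v set" and A :: "'i \<Rightarrow> 'v \<Rightarrow> 'v \<Rightarrow> real" and N :: real
  assumes fin: "finite I" "finite V"
    and A_nonneg: "\<And>i x y. A i x y \<ge> 0"
    and A_deg1: "\<And>i x. i \<in> I \<Longrightarrow> x \<in> V \<Longrightarrow> (\<Sum>y\<in>V. A i x y) \<le> 1"
    and A_deg: "\<And>x. x \<in> V \<Longrightarrow> (\<Sum>i\<in>I. \<Sum>y\<in>V. A i x y) \<le> N"
    and N_nonneg: "N \<ge> 0"
begin

text \<open>\<open>e q S x y\<close> is the total weight of the walks of length q from x to y whose
  edges of odd multiplicity are exactly \<open>S\<close>: all other sign products average to 0.
  Nonnegativity is recorded so that a diagonal entry can later be bounded by a row sum.\<close>

lemma signed_walks_bound: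
  assumes "S \<subseteq> I" "x \<in> V"
  defines "Z \<equiv> \<lambda>B x y. \<Sum>i\<in>I. sgn_of B i * A i x y"
  defines "e \<equiv> \<lambda>q S x y. (\<Sum>B\<in>Pow I. (\<Prod>i\<in>S. sgn_of B i) * fpow V (Z B) q x y) / 2 ^ card I"
  shows "(\<forall>y\<in>V. e q S x y \<ge> 0) \<and> (\<Sum>y\<in>V. e q S x y) \<le> walk_bound N q (card S)"
  using assms(1,2)
proof (induction q arbitrary: S x)
  case 0
  have "e 0 S x y = of_bool (x = y) * of_bool (S = {})" for y
    using sum_prod_signs[OF fin(1) 0(1)] fin by (auto simp: e_def card_Pow)
  moreover have "finite S" using 0 fin finite_subset by blast
  ultimately show ?case using fin 0 by simp
next
  case (Suc q)
  have fS: "finite S" using Suc fin finite_subset by blast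
  \<comment> \<open>Traversing edge i toggles its membership in the odd set, because the square of a
    sign is 1.\<close>
  define sd where "sd i = (if i \<in> S then S - {i} else insert i S)" for i
  have sd: "sd i \<subseteq> I" if "i \<in> I" for i using that Suc by (auto simp: sd_def)
  have prod_sd: "(\<Prod>j\<in>S. sgn_of B j) * sgn_of B i = (\<Prod>j\<in>sd i. sgn_of B j)" for B i
  proof (cases "i \<in> S")
    case True
    have "(\<Prod>j\<in>S. sgn_of B j) = sgn_of B i * (\<Prod>j\<in>S - {i}. sgn_of B j)"
      using fS True by (simp add: prod.remove)
    moreover have "sgn_of B i * sgn_of B i = 1" by (simp add: sgn_of_def)
    ultimately show ?thesis using True by (simp add: sd_def mult_ac)
  qed (simp add: sd_def fS mult.commute)
  have rec: "e (Suc q) S x y = (\<Sum>i\<in>I. \<Sum>z\<in>V. A i x z * e q (sd i) z y)" for y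
  proof -
    have "(\<Sum>B\<in>Pow I. (\<Prod>j\<in>S. sgn_of B j) * fpow V (Z B) (Suc q) x y) =
      (\<Sum>B\<in>Pow I. \<Sum>z\<in>V. \<Sum>i\<in>I. A i x z * ((\<Prod>j\<in>sd i. sgn_of B j) * fpow V (Z B) q z y))"
      by (simp add: Z_def sum_distrib_left sum_distrib_right prod_sd[symmetric] mult_ac)
    also have "\<dots> = (\<Sum>B\<in>Pow I. \<Sum>i\<in>I. \<Sum>z\<in>V. A i x z * ((\<Prod>j\<in>sd i. sgn_of B j) * fpow V (Z B) q z y))"
      by (intro sum.cong refl sum.swap)
    also have "\<dots> = (\<Sum>i\<in>I. \<Sum>B\<in>Pow I. \<Sum>z\<in>V. A i x z * ((\<Prod>j\<in>sd i. sgn_of B j) * fpow V (Z B) q z y))"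
      by (rule sum.swap)
    also have "\<dots> = (\<Sum>i\<in>I. \<Sum>z\<in>V. \<Sum>B\<in>Pow I. A i x z * ((\<Prod>j\<in>sd i. sgn_of B j) * fpow V (Z B) q z y))"
      by (intro sum.cong refl sum.swap)
    finally show ?thesis unfolding e_def by (simp add: sum_divide_distrib sum_distrib_left)
  qed
  have "e (Suc q) S x y \<ge> 0" if "y \<in> V" for y
    unfolding rec using Suc.IH[OF sd] that by (intro sum_nonneg mult_nonneg_nonneg A_nonneg) auto
  moreover have "(\<Sum>y\<in>V. e (Suc q) S x y) \<le> walk_bound N (Suc q) (card S)"
  proof -
    let ?d = "\<lambda>i. \<Sum>z\<in>V. A i x z" and ?h = "walk_bound N q"
    have d_nonneg: "?d i \<ge> 0" for i by (intro sum_nonneg A_nonneg)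
    have "(\<Sum>y\<in>V. e (Suc q) S x y) = (\<Sum>i\<in>I. \<Sum>y\<in>V. \<Sum>z\<in>V. A i x z * e q (sd i) z y)"
      unfolding rec by (rule sum.swap)
    also have "\<dots> = (\<Sum>i\<in>I. \<Sum>z\<in>V. \<Sum>y\<in>V. A i x z * e q (sd i) z y)"
      by (intro sum.cong refl sum.swap)
    also have "\<dots> \<le> (\<Sum>i\<in>I. \<Sum>z\<in>V. A i x z * ?h (card (sd i)))"
      unfolding sum_distrib_left[symmetric]
      using Suc.IH[OF sd] by (intro sum_mono mult_left_mono A_nonneg) auto
    also have "\<dots> = (\<Sum>i\<in>I. ?d i * ?h (card (sd i)))" by (simp add: sum_distrib_right)
    \<comment> \<open>The first step either closes one of the \<open>card S\<close> edges of
      \<open>S\<close>, each of weight at most 1 at x, or opens another edge, of total weight at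
      most \<open>N\<close>.\<close>
    also have "\<dots> = (\<Sum>i\<in>S. ?d i * ?h (card (sd i))) + (\<Sum>i\<in>I - S. ?d i * ?h (card (sd i)))"
      using fin(1) Suc.prems(1) by (simp add: sum.subset_diff)
    also have "(\<Sum>i\<in>S. ?d i * ?h (card (sd i))) \<le> (\<Sum>i\<in>S. 1 * ?h (card S - 1))"
    proof (rule sum_mono)
      fix i assume i: "i \<in> S"
      then have "card (sd i) = card S - 1" using fS by (simp add: sd_def)
      then show "?d i * ?h (card (sd i)) \<le> 1 * ?h (card S - 1)"
        using i Suc.prems A_deg1[of i x] walk_bound_nonneg[OF N_nonneg] by (intro mult_mono) auto
    qed
    also have "(\<Sum>i\<in>I - S. ?d i * ?h (card (sd i))) = (\<Sum>i\<in>I - S. ?d i) * ?h (card S + 1)"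
      unfolding sum_distrib_right using fS by (intro sum.cong) (auto simp: sd_def)
    also have "\<dots> \<le> N * ?h (card S + 1)"
    proof (intro mult_right_mono walk_bound_nonneg N_nonneg)
      have "(\<Sum>i\<in>I - S. ?d i) \<le> (\<Sum>i\<in>I. ?d i)" using fin d_nonneg by (intro sum_mono2) auto
      then show "(\<Sum>i\<in>I - S. ?d i) \<le> N" using A_deg[OF Suc.prems(2)] by linarith
    qed
    finally show ?thesis by simp
  qed
  ultimately show ?case by blast
qed

lemma average_trace_pow_le:
  "(\<Sum>B\<in>Pow I. \<Sum>x\<in>V. fpow V (\<lambda>x y. \<Sum>i\<in>I. sgn_of B i * A i x y) (2 * p) x x) / 2 ^ card I
    \<le> real (card V) * (fact (2 * p) / (2 ^ p * fact p) * N ^ p)"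
proof -
  let ?Z = "\<lambda>B x y. \<Sum>i\<in>I. sgn_of B i * A i x y"
  have "(\<Sum>B\<in>Pow I. fpow V (?Z B) (2 * p) x x) / 2 ^ card I \<le> fact (2 * p) / (2 ^ p * fact p) * N ^ p"
    if x: "x \<in> V" for x
  proof -
    let ?e = "\<lambda>y. (\<Sum>B\<in>Pow I. (\<Prod>i\<in>{}. sgn_of B i) * fpow V (?Z B) (2 * p) x y) / 2 ^ card I"
    have *: "(\<forall>y\<in>V. ?e y \<ge> 0) \<and> (\<Sum>y\<in>V. ?e y) \<le> walk_bound N (2 * p) (card ({} :: 'i set))"
      by (rule signed_walks_bound[OF _ x]) simp
    then have "?e x \<le> (\<Sum>y\<in>V. ?e y)" using x fin by (intro member_le_sum) auto
    then show ?thesis using * walk_bound_closed_form[of N p 0] by simp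
  qed
  then have "(\<Sum>x\<in>V. (\<Sum>B\<in>Pow I. fpow V (?Z B) (2 * p) x x) / 2 ^ card I) \<le>
      (\<Sum>x\<in>V. fact (2 * p) / (2 ^ p * fact p) * N ^ p)"
    by (rule sum_mono)
  moreover have "(\<Sum>x\<in>V. (\<Sum>B\<in>Pow I. fpow V (?Z B) (2 * p) x x) / 2 ^ card I) =
      (\<Sum>B\<in>Pow I. \<Sum>x\<in>V. fpow V (?Z B) (2 * p) x x) / 2 ^ card I"
    by (subst sum.swap) (simp add: sum_divide_distrib)
  ultimately show ?thesis by simp
qed

text \<open>The even moments of \<beta> are bounded by \<open>card V\<close> times Gaussian moments,
  so the series of cosh sums to a Gaussian moment generating function. The factor 2 comes from exp x
  <= 2 cosh x, which removes the odd powers.\<close>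

lemma average_exp_le:
  assumes \<beta>: "\<And>B. B \<in> Pow I \<Longrightarrow> \<beta> B \<ge> 0"
    and le: "\<And>B p. B \<in> Pow I \<Longrightarrow>
      \<beta> B ^ (2 * p) \<le> (\<Sum>x\<in>V. fpow V (\<lambda>x y. \<Sum>i\<in>I. sgn_of B i * A i x y) (2 * p) x x)"
  shows "(\<Sum>B\<in>Pow I. exp (\<eta> * \<beta> B)) / 2 ^ card I \<le> 2 * real (card V) * exp (\<eta>\<^sup>2 * N / 2)"
proof -
  have cosh_lim: "(\<lambda>P. \<Sum>p<P. x ^ (2 * p) / fact (2 * p)) \<longlonglongrightarrow> cosh x" for x :: real
  proof -
    have "(\<lambda>n. if even n then x ^ n /\<^sub>R fact n else 0) sums cosh x"
      using cosh_converges[of x] .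
    moreover have "strict_mono (\<lambda>p::nat. 2 * p)" by (simp add: strict_mono_def)
    ultimately have "(\<lambda>p. if even (2 * p) then x ^ (2 * p) /\<^sub>R fact (2 * p) else 0) sums cosh x"
      by (subst sums_mono_reindex[of "\<lambda>p. 2 * p"]) (auto elim!: evenE)
    then show ?thesis by (simp add: sums_def divide_inverse mult.commute)
  qed
  have partial: "(\<Sum>B\<in>Pow I. 2 * (\<Sum>p<P. (\<eta> * \<beta> B) ^ (2 * p) / fact (2 * p))) / 2 ^ card I \<le>
      2 * real (card V) * exp (\<eta>\<^sup>2 * N / 2)" for P
  proof -
    have "(\<Sum>B\<in>Pow I. 2 * (\<Sum>p<P. (\<eta> * \<beta> B) ^ (2 * p) / fact (2 * p))) / 2 ^ card I =
        2 * (\<Sum>p<P. \<eta> ^ (2 * p) / fact (2 * p) * ((\<Sum>B\<in>Pow I. \<beta> B ^ (2 * p)) / 2 ^ card I))"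
      unfolding sum_distrib_left[symmetric] 
      by (subst sum.swap) (simp add: sum_divide_distrib sum_distrib_left power_mult_distrib field_simps)
    also have "\<dots> \<le> 2 * (\<Sum>p<P. \<eta> ^ (2 * p) / fact (2 * p) * (real (card V) * (fact (2 * p) / (2 ^ p * fact p) * N ^ p)))"
    proof (intro mult_left_mono sum_mono)
      fix p
      have "(\<Sum>B\<in>Pow I. \<beta> B ^ (2 * p)) / 2 ^ card I \<le>
          (\<Sum>B\<in>Pow I. \<Sum>x\<in>V. fpow V (\<lambda>x y. \<Sum>i\<in>I. sgn_of B i * A i x y) (2 * p) x x) / 2 ^ card I"
        by (intro divide_right_mono sum_mono le) auto
      also note average_trace_pow_le
      finally show "(\<Sum>B\<in>Pow I. \<beta> B ^ (2 * p)) / 2 ^ card I \<le> real (card V) * (fact (2 * p) / (2 ^ p * fact p) * N ^ p)" .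
    qed (auto simp: power_mult)
    also have "\<dots> = 2 * real (card V) * (\<Sum>p<P. (\<eta>\<^sup>2 * N / 2) ^ p /\<^sub>R fact p)"
      by (simp add: sum_distrib_left power_mult_distrib power_divide field_simps flip: power_mult)
    also have "\<dots> \<le> 2 * real (card V) * exp (\<eta>\<^sup>2 * N / 2)"
    proof (intro mult_left_mono)
      have s: "(\<lambda>p. (\<eta>\<^sup>2 * N / 2) ^ p /\<^sub>R fact p) sums exp (\<eta>\<^sup>2 * N / 2)" by (rule exp_converges)
      show "(\<Sum>p<P. (\<eta>\<^sup>2 * N / 2) ^ p /\<^sub>R fact p) \<le> exp (\<eta>\<^sup>2 * N / 2)"
        unfolding sums_unique[OF s] using N_nonneg by (intro sum_le_suminf sums_summable[OF s]) auto
    qed auto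
    finally show ?thesis .
  qed
  have "(\<lambda>P. (\<Sum>B\<in>Pow I. 2 * (\<Sum>p<P. (\<eta> * \<beta> B) ^ (2 * p) / fact (2 * p))) / 2 ^ card I)
      \<longlonglongrightarrow> (\<Sum>B\<in>Pow I. 2 * cosh (\<eta> * \<beta> B)) / 2 ^ card I"
    by (intro tendsto_intros cosh_lim) auto
  then have "(\<Sum>B\<in>Pow I. 2 * cosh (\<eta> * \<beta> B)) / 2 ^ card I \<le> 2 * real (card V) * exp (\<eta>\<^sup>2 * N / 2)"
    by (rule LIMSEQ_le_const2) (use partial in blast)
  moreover have "(\<Sum>B\<in>Pow I. exp (\<eta> * \<beta> B)) / 2 ^ card I \<le> (\<Sum>B\<in>Pow I. 2 * cosh (\<eta> * \<beta> B)) / 2 ^ card I"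
    by (intro divide_right_mono sum_mono) (auto simp: cosh_def)
  ultimately show ?thesis by linarith
qed

end


section \<open>Comparison of exponential moments\<close>

lemma expectation_finite_sum:
  fixes F :: "'a \<Rightarrow> real"
  assumes "finite (set_pmf p)"
  shows "measure_pmf.expectation p F = (\<Sum>x\<in>set_pmf p. pmf p x * F x)"
  by (subst integral_measure_pmf[OF assms]) (auto simp: set_pmf_iff)

lemma expectation_mono_finite:
  fixes F G :: "'a \<Rightarrow> real"
  assumes "finite (set_pmf p)" "\<And>x. x \<in> set_pmf p \<Longrightarrow> F x \<le> G x"
  shows "measure_pmf.expectation p F \<le> measure_pmf.expectation p G"
  unfolding expectation_finite_sum[OF assms(1)] using assms(2) by (intro sum_mono mult_left_mono) auto

lemma expectation_cong_finite:
  fixes F G :: "'a \<Rightarrow> real"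
  assumes "\<And>x. x \<in> set_pmf p \<Longrightarrow> F x = G x"
  shows "measure_pmf.expectation p F = measure_pmf.expectation p G"
  using assms by (intro integral_cong_AE) (auto simp: AE_measure_pmf_iff)

text \<open>Jensen's inequality, from the tangent of exp at the mean.\<close>

lemma exp_expectation_le:
  fixes F :: "'a \<Rightarrow> real"
  assumes fin: "finite (set_pmf p)"
  shows "exp (measure_pmf.expectation p F) \<le> measure_pmf.expectation p (\<lambda>x. exp (F x))"
proof -
  define m where "m = measure_pmf.expectation p F"
  note int = integrable_measure_pmf_finite[OF fin]
  have "measure_pmf.expectation p (\<lambda>x. exp m * (1 - m) + exp m * F x) = exp m * (1 - m) + exp m * m"
    by (simp add: m_def int)
  then have "exp m = measure_pmf.expectation p (\<lambda>x. exp m * (1 - m) + exp m * F x)"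
    by (simp add: algebra_simps)
  also have "\<dots> \<le> measure_pmf.expectation p (\<lambda>x. exp (F x))"
  proof (rule expectation_mono_finite[OF fin])
    fix x
    have "exp m * (1 + (F x - m)) \<le> exp m * exp (F x - m)"
      by (intro mult_left_mono exp_ge_add_one_self) auto
    also have "\<dots> = exp (F x)" by (simp flip: exp_add)
    finally show "exp m * (1 - m) + exp m * F x \<le> exp (F x)" by (simp add: algebra_simps)
  qed
  finally show ?thesis by (simp add: m_def)
qed

lemma prob_exceeds_le:
  fixes F :: "'a \<Rightarrow> real"
  assumes fin: "finite (set_pmf p)"
  shows "measure_pmf.prob p {x. F x > b} \<le> measure_pmf.expectation p (\<lambda>x. exp (F x)) / exp b"
proof -
  have "measure_pmf.prob p {x. F x > b} = measure_pmf.expectation p (indicator {x. F x > b})" by simp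
  also have "\<dots> \<le> measure_pmf.expectation p (\<lambda>x. exp (F x) / exp b)"
    by (rule expectation_mono_finite[OF fin]) (auto simp: indicator_def)
  finally show ?thesis by simp
qed

lemma finite_set_Pi_pmf:
  assumes "finite I" "finite (set_pmf p)"
  shows "finite (set_pmf (Pi_pmf I d (\<lambda>_. p)))"
  unfolding set_Pi_pmf[OF assms(1)] using assms by (intro finite_PiE_dflt) auto

text \<open>Both orders of integration: the comparison below opens one product with the new
  coordinate innermost and closes the other with it outermost.\<close>

lemma expectation_Pi_pmf_insert:
  fixes F :: "('i \<Rightarrow> 'a) \<Rightarrow> real"
  assumes I: "finite I" "j \<notin> I" and p: "finite (set_pmf p)"
  shows "measure_pmf.expectation (Pi_pmf (insert j I) d (\<lambda>_. p)) F =
      measure_pmf.expectation (Pi_pmf I d (\<lambda>_. p)) (\<lambda>f. measure_pmf.expectation p (\<lambda>y. F (f(j := y))))"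
    and "measure_pmf.expectation (Pi_pmf (insert j I) d (\<lambda>_. p)) F =
      measure_pmf.expectation p (\<lambda>y. measure_pmf.expectation (Pi_pmf I d (\<lambda>_. p)) (\<lambda>f. F (f(j := y))))"
proof -
  let ?P = "Pi_pmf I d (\<lambda>_. p)"
  have fP: "finite (set_pmf ?P)" by (rule finite_set_Pi_pmf[OF I(1) p])
  have "measure_pmf.expectation (Pi_pmf (insert j I) d (\<lambda>_. p)) F =
      measure_pmf.expectation (pair_pmf p ?P) (\<lambda>(y, f). F (f(j := y)))"
    by (simp add: Pi_pmf_insert[OF I] split_def)
  also have "\<dots> = (\<Sum>(y, f)\<in>set_pmf p \<times> set_pmf ?P. pmf p y * pmf ?P f * F (f(j := y)))"
    using p fP by (subst expectation_finite_sum) (auto simp: split_def pmf_pair intro!: sum.cong)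
  finally have *: "measure_pmf.expectation (Pi_pmf (insert j I) d (\<lambda>_. p)) F =
      (\<Sum>y\<in>set_pmf p. \<Sum>f\<in>set_pmf ?P. pmf p y * pmf ?P f * F (f(j := y)))"
    by (simp add: sum.cartesian_product)
  show "measure_pmf.expectation (Pi_pmf (insert j I) d (\<lambda>_. p)) F =
      measure_pmf.expectation p (\<lambda>y. measure_pmf.expectation ?P (\<lambda>f. F (f(j := y))))"
    unfolding * by (simp add: expectation_finite_sum[OF p] expectation_finite_sum[OF fP] sum_distrib_left mult.assoc)
  show "measure_pmf.expectation (Pi_pmf (insert j I) d (\<lambda>_. p)) F =
      measure_pmf.expectation ?P (\<lambda>f. measure_pmf.expectation p (\<lambda>y. F (f(j := y))))"
    unfolding * by (subst sum.swap)
      (simp add: expectation_finite_sum[OF p] expectation_finite_sum[OF fP] sum_distrib_left mult_ac)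
qed

section \<open>Replacing independent observations by random signs\<close>

lemma sum_Pow_insert:
  fixes G :: "'i set \<Rightarrow> real"
  assumes "finite I" "j \<notin> I"
  shows "(\<Sum>B\<in>Pow (insert j I). G B) = (\<Sum>B\<in>Pow I. G B) + (\<Sum>B\<in>Pow I. G (insert j B))"
proof -
  have "inj_on (insert j) (Pow I)" using assms by (auto intro!: inj_onI)
  moreover have "Pow I \<inter> insert j ` Pow I = {}" using assms by auto
  ultimately show ?thesis
    using assms by (simp add: Pow_insert sum.union_disjoint sum.reindex)
qed

text \<open>The hypothesis \<open>step\<close> holds for every offset, so the contributions of the
  other observations can be moved into \<open>h\<close> and the sums exchanged one summand at a
  time. The number of elements of \<open>T\<close> does not enter.\<close>

lemma exp_max_comparison:
  fixes g :: "'t \<Rightarrow> 'a \<Rightarrow> real" and c :: "'t \<Rightarrow> 'b \<Rightarrow> real"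
  assumes I: "finite I" and Q: "finite (set_pmf Q)" and P: "finite (set_pmf P)"
    and step: "\<And>h. measure_pmf.expectation Q (\<lambda>s. exp (MAX \<tau>\<in>T. h \<tau> + g \<tau> s)) \<le>
      measure_pmf.expectation P (\<lambda>w. (exp (MAX \<tau>\<in>T. h \<tau> + c \<tau> w) + exp (MAX \<tau>\<in>T. h \<tau> - c \<tau> w)) / 2)"
  shows "measure_pmf.expectation (Pi_pmf I d (\<lambda>_. Q)) (\<lambda>s. exp (MAX \<tau>\<in>T. h \<tau> + (\<Sum>i\<in>I. g \<tau> (s i)))) \<le>
    measure_pmf.expectation (Pi_pmf I d' (\<lambda>_. P))
      (\<lambda>w. (\<Sum>B\<in>Pow I. exp (MAX \<tau>\<in>T. h \<tau> + (\<Sum>i\<in>I. sgn_of B i * c \<tau> (w i)))) / 2 ^ card I)"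
  using I
proof (induction I arbitrary: h rule: finite_induct)
  case empty
  then show ?case by simp
next
  case (insert j J)
  let ?Q = "Pi_pmf J d (\<lambda>_. Q)" and ?P = "Pi_pmf J d' (\<lambda>_. P)"
  have fQ: "finite (set_pmf ?Q)" and fP: "finite (set_pmf ?P)"
    by (simp_all add: finite_set_Pi_pmf[OF insert(1)] Q P)
  let ?S = "\<lambda>h f. exp (MAX \<tau>\<in>T. h \<tau> + (\<Sum>i\<in>J. g \<tau> (f i)))"
  let ?R = "\<lambda>h f. (\<Sum>B\<in>Pow J. exp (MAX \<tau>\<in>T. h \<tau> + (\<Sum>i\<in>J. sgn_of B i * c \<tau> (f i)))) / 2 ^ card J"
  have upd: "(\<Sum>i\<in>J. g \<tau> (if i = j then y else f i)) = (\<Sum>i\<in>J. g \<tau> (f i))" for \<tau> f y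
    using insert by (intro sum.cong) auto
  have "measure_pmf.expectation (Pi_pmf (insert j J) d (\<lambda>_. Q)) (\<lambda>s. exp (MAX \<tau>\<in>T. h \<tau> + (\<Sum>i\<in>insert j J. g \<tau> (s i)))) =
    measure_pmf.expectation ?Q (\<lambda>f. measure_pmf.expectation Q (\<lambda>y. exp (MAX \<tau>\<in>T. (h \<tau> + (\<Sum>i\<in>J. g \<tau> (f i))) + g \<tau> y)))"
    unfolding expectation_Pi_pmf_insert(1)[OF insert(1,2) Q] using insert
    by (simp add: upd add_ac)
  also have "\<dots> \<le> measure_pmf.expectation ?Q (\<lambda>f. measure_pmf.expectation P (\<lambda>w.
      (?S (\<lambda>\<tau>. h \<tau> + c \<tau> w) f + ?S (\<lambda>\<tau>. h \<tau> - c \<tau> w) f) / 2))"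
  proof (rule expectation_mono_finite[OF fQ])
    fix f
    have *: "(h \<tau> + (\<Sum>i\<in>J. g \<tau> (f i))) + c \<tau> w = h \<tau> + c \<tau> w + (\<Sum>i\<in>J. g \<tau> (f i))"
      "(h \<tau> + (\<Sum>i\<in>J. g \<tau> (f i))) - c \<tau> w = h \<tau> - c \<tau> w + (\<Sum>i\<in>J. g \<tau> (f i))" for \<tau> w
      by simp_all
    show "measure_pmf.expectation Q (\<lambda>y. exp (MAX \<tau>\<in>T. (h \<tau> + (\<Sum>i\<in>J. g \<tau> (f i))) + g \<tau> y)) \<le>
        measure_pmf.expectation P (\<lambda>w. (?S (\<lambda>\<tau>. h \<tau> + c \<tau> w) f + ?S (\<lambda>\<tau>. h \<tau> - c \<tau> w) f) / 2)"
      using step[of "\<lambda>\<tau>. h \<tau> + (\<Sum>i\<in>J. g \<tau> (f i))"] unfolding * .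
  qed
  \<comment> \<open>Exchanging the two expectations puts the remaining observations innermost, where
    the induction hypothesis applies twice, with offset \<open>h\<close> plus and minus the new
    term.\<close>
  also have "\<dots> = measure_pmf.expectation P (\<lambda>w. 
      (measure_pmf.expectation ?Q (?S (\<lambda>\<tau>. h \<tau> + c \<tau> w)) + measure_pmf.expectation ?Q (?S (\<lambda>\<tau>. h \<tau> - c \<tau> w))) / 2)"
  proof -
    have *: "(\<Sum>f\<in>A. p f * (\<Sum>w\<in>B. q w * ((G f w + G' f w) / 2))) =
      (\<Sum>w\<in>B. q w * (((\<Sum>f\<in>A. p f * G f w) + (\<Sum>f\<in>A. p f * G' f w)) / 2))"
      for A :: "('x \<Rightarrow> 'a) set" and B :: "'b set" and p q and G G' :: "_ \<Rightarrow> _ \<Rightarrow> real"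
    proof -
      have "(\<Sum>f\<in>A. p f * (\<Sum>w\<in>B. q w * ((G f w + G' f w) / 2))) = (\<Sum>w\<in>B. \<Sum>f\<in>A. p f * (q w * ((G f w + G' f w) / 2)))"
        unfolding sum_distrib_left by (rule sum.swap)
      also have "\<dots> = (\<Sum>w\<in>B. \<Sum>f\<in>A. q w / 2 * (p f * G f w + p f * G' f w))"
        by (intro sum.cong refl) (simp add: field_simps)
      also have "\<dots> = (\<Sum>w\<in>B. q w / 2 * ((\<Sum>f\<in>A. p f * G f w) + (\<Sum>f\<in>A. p f * G' f w)))"
        by (simp only: sum_distrib_left[symmetric] sum.distrib)
      finally show ?thesis by simp
    qed
    show ?thesis
      unfolding expectation_finite_sum[OF fQ] expectation_finite_sum[OF P] by (rule *)
  qed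
  also have "\<dots> \<le> measure_pmf.expectation P (\<lambda>w. 
      (measure_pmf.expectation ?P (?R (\<lambda>\<tau>. h \<tau> + c \<tau> w)) + measure_pmf.expectation ?P (?R (\<lambda>\<tau>. h \<tau> - c \<tau> w))) / 2)"
    by (intro expectation_mono_finite[OF P] divide_right_mono add_mono insert.IH) auto
  also have "\<dots> = measure_pmf.expectation P (\<lambda>w. measure_pmf.expectation ?P (\<lambda>f. (?R (\<lambda>\<tau>. h \<tau> + c \<tau> w) f + ?R (\<lambda>\<tau>. h \<tau> - c \<tau> w) f) / 2))"
    by (simp add: integrable_measure_pmf_finite[OF fP])
  also have "\<dots> = measure_pmf.expectation P (\<lambda>w. measure_pmf.expectation ?P (\<lambda>f.
      (\<Sum>B\<in>Pow (insert j J). exp (MAX \<tau>\<in>T. h \<tau> + (\<Sum>i\<in>insert j J. sgn_of B i * c \<tau> ((f(j := w)) i)))) / 2 ^ card (insert j J)))"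
  proof -
    have 1: "(\<Sum>i\<in>J. sgn_of B i * c \<tau> (if i = j then w else f i)) = (\<Sum>i\<in>J. sgn_of B i * c \<tau> (f i))" for B \<tau> f w
      using insert by (intro sum.cong) auto
    have 2: "(\<Sum>i\<in>J. sgn_of (insert j B) i * c \<tau> (f i)) = (\<Sum>i\<in>J. sgn_of B i * c \<tau> (f i))" for B \<tau> f
      using insert by (intro sum.cong) (auto simp: sgn_of_def)
    have plus: "h \<tau> + (\<Sum>i\<in>insert j J. sgn_of B i * c \<tau> ((f(j := w)) i)) = h \<tau> + c \<tau> w + (\<Sum>i\<in>J. sgn_of B i * c \<tau> (f i))"
      if "B \<in> Pow J" for B \<tau> f w
    proof -
      have "sgn_of B j = 1" using that insert by (auto simp: sgn_of_def)
      then show ?thesis using insert by (simp add: 1)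
    qed
    have minus: "h \<tau> + (\<Sum>i\<in>insert j J. sgn_of (insert j B) i * c \<tau> ((f(j := w)) i)) = h \<tau> - c \<tau> w + (\<Sum>i\<in>J. sgn_of B i * c \<tau> (f i))" for B \<tau> f w
    proof -
      have "sgn_of (insert j B) j = -1" by (simp add: sgn_of_def)
      then show ?thesis using insert by (simp add: 1 2)
    qed
    have "(\<Sum>B\<in>Pow J. exp (MAX \<tau>\<in>T. h \<tau> + (\<Sum>i\<in>insert j J. sgn_of B i * c \<tau> ((f(j := w)) i)))) =
        (\<Sum>B\<in>Pow J. exp (MAX \<tau>\<in>T. h \<tau> + c \<tau> w + (\<Sum>i\<in>J. sgn_of B i * c \<tau> (f i))))" for f w
      by (intro sum.cong refl) (simp only: plus)
    moreover have card_insert: "card (insert j J) = Suc (card J)" using insert by simp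
    ultimately show ?thesis
      unfolding sum_Pow_insert[OF insert(1,2)] minus
      by (simp only: card_insert add_divide_distrib[symmetric] power_Suc2 divide_divide_eq_left)
  qed
  also have "\<dots> = measure_pmf.expectation (Pi_pmf (insert j J) d' (\<lambda>_. P))
      (\<lambda>w. (\<Sum>B\<in>Pow (insert j J). exp (MAX \<tau>\<in>T. h \<tau> + (\<Sum>i\<in>insert j J. sgn_of B i * c \<tau> (w i)))) / 2 ^ card (insert j J))"
    by (rule expectation_Pi_pmf_insert(2)[OF insert(1,2) P, symmetric])
  finally show ?case .
qed

text \<open>At a maximiser the exponential is convex in \<xi>, hence lies below its chord between -L
  and L. The weights are affine in \<xi>, so averaging over a centred \<xi> makes both equal to one
  half.\<close>

lemma exp_max_chord:
  fixes h t :: "'t \<Rightarrow> real"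
  assumes T: "finite T" "T \<noteq> {}" and \<xi>: "\<bar>\<xi>\<bar> \<le> L" "L > 0"
  shows "exp (MAX \<tau>\<in>T. h \<tau> + \<xi> * t \<tau>) \<le>
    (1 + \<xi> / L) / 2 * exp (MAX \<tau>\<in>T. h \<tau> + L * t \<tau>) + (1 - \<xi> / L) / 2 * exp (MAX \<tau>\<in>T. h \<tau> - L * t \<tau>)"
proof -
  define a where "a = (1 + \<xi> / L) / 2"
  have a: "0 \<le> a" "0 \<le> 1 - a" "1 - a = (1 - \<xi> / L) / 2" 
    using \<xi> by (auto simp: a_def field_simps abs_le_iff)
  have "(MAX \<tau>\<in>T. h \<tau> + \<xi> * t \<tau>) \<in> (\<lambda>\<tau>. h \<tau> + \<xi> * t \<tau>) ` T" using T by (intro Max_in) auto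
  then obtain \<tau> where \<tau>: "\<tau> \<in> T" "(MAX \<tau>\<in>T. h \<tau> + \<xi> * t \<tau>) = h \<tau> + \<xi> * t \<tau>" by auto
  have "h \<tau> + \<xi> * t \<tau> = a * (h \<tau> + L * t \<tau>) + (1 - a) * (h \<tau> - L * t \<tau>)"
    using \<xi>(2) by (simp add: a_def field_simps)
  then have "exp (h \<tau> + \<xi> * t \<tau>) \<le> a * exp (h \<tau> + L * t \<tau>) + (1 - a) * exp (h \<tau> - L * t \<tau>)"
    using convex_onD[OF exp_convex, of "1 - a" "h \<tau> + L * t \<tau>" "h \<tau> - L * t \<tau>"] a(1,2) by simp
  also have "\<dots> \<le> a * exp (MAX \<tau>\<in>T. h \<tau> + L * t \<tau>) + (1 - a) * exp (MAX \<tau>\<in>T. h \<tau> - L * t \<tau>)"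
    using \<tau>(1) T a by (intro add_mono mult_left_mono) auto
  finally show ?thesis unfolding \<tau>(2) a(3) by (simp add: a_def)
qed

text \<open>Weak majorization for the increasing convex function exp: a larger sum and a larger
  maximum increase the sum of the exponentials.\<close>

lemma exp_sum_le_of_majorized:
  fixes a b a' b' :: real
  assumes "a \<le> max a' b'" "b \<le> max a' b'" "a + b \<le> a' + b'"
  shows "exp a + exp b \<le> exp a' + exp b'"
proof -
  have main: "exp a + exp b \<le> exp a' + exp b'" if "a \<le> a'" "b \<le> a'" "a + b \<le> a' + b'" for a b a' b' :: real
  proof (cases "b \<le> b'")
    case True
    then show ?thesis using that by (intro add_mono) auto
  next
    \<comment> \<open>The pair of b and a' + b' - b has the same sum as a' and b' but is less spread
      out; the gain from spreading factors as a product of two nonnegative terms.\<close>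
    case False
    have "exp (a' + b' - b) = exp a' * exp (b' - b)" "exp b' = exp b * exp (b' - b)"
      by (simp_all flip: exp_add)
    then have "exp a' + exp b' - exp b - exp (a' + b' - b) = (exp a' - exp b) * (1 - exp (b' - b))"
      by (simp add: algebra_simps)
    also have "\<dots> \<ge> 0" using False that by (intro mult_nonneg_nonneg) auto
    finally have "exp (a' + b' - b) + exp b \<le> exp a' + exp b'" by linarith
    moreover have "exp a \<le> exp (a' + b' - b)" using that by simp
    ultimately show ?thesis by linarith
  qed
  show ?thesis
  proof (cases "b' \<le> a'")
    case True
    then show ?thesis using main[of a a' b b'] assms by (simp add: max_def)
  next
    case False
    then show ?thesis using main[of a b' b a'] assms by (simp add: max_def add.commute)
  qed
qed

text \<open>One-coordinate form of the Ledoux-Talagrand contraction principle. For the maximisers of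
  the two left-hand terms, \<open>zero\<close> bounds each exponent by the larger maximum on the
  right and \<open>lip\<close> bounds their sum, which is what majorization requires.\<close>

lemma exp_max_contraction:
  fixes h t \<psi> :: "'t \<Rightarrow> real"
  assumes T: "finite T" "T \<noteq> {}"
    and zero: "\<And>\<tau>. \<tau> \<in> T \<Longrightarrow> \<bar>\<psi> \<tau>\<bar> \<le> L * \<bar>t \<tau>\<bar>"
    and lip: "\<And>\<tau> \<sigma>. \<tau> \<in> T \<Longrightarrow> \<sigma> \<in> T \<Longrightarrow> \<bar>\<psi> \<tau> - \<psi> \<sigma>\<bar> \<le> L * \<bar>t \<tau> - t \<sigma>\<bar>"
  shows "exp (MAX \<tau>\<in>T. h \<tau> + \<psi> \<tau>) + exp (MAX \<tau>\<in>T. h \<tau> - \<psi> \<tau>) \<le>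
    exp (MAX \<tau>\<in>T. h \<tau> + L * t \<tau>) + exp (MAX \<tau>\<in>T. h \<tau> - L * t \<tau>)"
proof -
  let ?A = "MAX \<tau>\<in>T. h \<tau> + L * t \<tau>" and ?B = "MAX \<tau>\<in>T. h \<tau> - L * t \<tau>"
  have A: "h \<tau> + L * t \<tau> \<le> ?A" and B: "h \<tau> - L * t \<tau> \<le> ?B" if "\<tau> \<in> T" for \<tau>
    using that T by auto
  have AB: "h \<tau> + L * \<bar>t \<tau>\<bar> \<le> max ?A ?B" if "\<tau> \<in> T" for \<tau>
    using A[OF that] B[OF that] by (cases "t \<tau> \<ge> 0") auto
  have "(MAX \<tau>\<in>T. h \<tau> + \<psi> \<tau>) \<in> (\<lambda>\<tau>. h \<tau> + \<psi> \<tau>) ` T" using T by (intro Max_in) auto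
  then obtain \<tau> where \<tau>: "\<tau> \<in> T" "(MAX \<tau>\<in>T. h \<tau> + \<psi> \<tau>) = h \<tau> + \<psi> \<tau>" by auto
  have "(MAX \<tau>\<in>T. h \<tau> - \<psi> \<tau>) \<in> (\<lambda>\<tau>. h \<tau> - \<psi> \<tau>) ` T" using T by (intro Max_in) auto
  then obtain \<sigma> where \<sigma>: "\<sigma> \<in> T" "(MAX \<tau>\<in>T. h \<tau> - \<psi> \<tau>) = h \<sigma> - \<psi> \<sigma>" by auto
  show ?thesis unfolding \<tau>(2) \<sigma>(2)
  proof (rule exp_sum_le_of_majorized)
    show "h \<tau> + \<psi> \<tau> \<le> max ?A ?B" using AB[OF \<tau>(1)] zero[OF \<tau>(1)] by linarith
    show "h \<sigma> - \<psi> \<sigma> \<le> max ?A ?B" using AB[OF \<sigma>(1)] zero[OF \<sigma>(1)] by linarith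
    have "h \<tau> + h \<sigma> + L * \<bar>t \<tau> - t \<sigma>\<bar> \<le> ?A + ?B"
    proof (cases "t \<tau> \<ge> t \<sigma>")
      case True
      then show ?thesis using A[OF \<tau>(1)] B[OF \<sigma>(1)] by (simp add: algebra_simps)
    next
      case False
      then show ?thesis using A[OF \<sigma>(1)] B[OF \<tau>(1)] by (simp add: algebra_simps)
    qed
    then show "h \<tau> + \<psi> \<tau> + (h \<sigma> - \<psi> \<sigma>) \<le> ?A + ?B" using lip[OF \<tau>(1) \<sigma>(1)] by linarith
  qed
qed

text \<open>No independent copy is introduced: the centred term is the midpoint of twice the mean
  and minus twice the value, so convexity separates them and Jensen removes the inner mean. This is
  the origin of the factor 2.\<close>

lemma exp_max_symmetrization:
  fixes h :: "'t \<Rightarrow> real" and \<psi> :: "'t \<Rightarrow> 'a \<Rightarrow> real"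
  assumes T: "finite T" "T \<noteq> {}" and Q: "finite (set_pmf Q)"
  shows "measure_pmf.expectation Q (\<lambda>s. exp (MAX \<tau>\<in>T. h \<tau> + (measure_pmf.expectation Q (\<psi> \<tau>) - \<psi> \<tau> s))) \<le>
    measure_pmf.expectation Q (\<lambda>s. (exp (MAX \<tau>\<in>T. h \<tau> + 2 * \<psi> \<tau> s) + exp (MAX \<tau>\<in>T. h \<tau> - 2 * \<psi> \<tau> s)) / 2)"
proof -
  note int = integrable_measure_pmf_finite[OF Q]
  let ?E = "measure_pmf.expectation Q"
  let ?A = "?E (\<lambda>s. exp (MAX \<tau>\<in>T. h \<tau> + 2 * \<psi> \<tau> s))"
  have "exp (MAX \<tau>\<in>T. h \<tau> + (?E (\<psi> \<tau>) - \<psi> \<tau> s)) \<le> (?A + exp (MAX \<tau>\<in>T. h \<tau> - 2 * \<psi> \<tau> s)) / 2" for s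
  proof -
    have "(MAX \<tau>\<in>T. h \<tau> + (?E (\<psi> \<tau>) - \<psi> \<tau> s)) \<in> (\<lambda>\<tau>. h \<tau> + (?E (\<psi> \<tau>) - \<psi> \<tau> s)) ` T"
      using T by (intro Max_in) auto
    then obtain \<tau> where \<tau>: "\<tau> \<in> T" "(MAX \<tau>\<in>T. h \<tau> + (?E (\<psi> \<tau>) - \<psi> \<tau> s)) = h \<tau> + (?E (\<psi> \<tau>) - \<psi> \<tau> s)" by auto
    have "exp (h \<tau> + (?E (\<psi> \<tau>) - \<psi> \<tau> s)) \<le> (exp (h \<tau> + 2 * ?E (\<psi> \<tau>)) + exp (h \<tau> - 2 * \<psi> \<tau> s)) / 2"
      using convex_onD[OF exp_convex, of "1 / 2" "h \<tau> + 2 * ?E (\<psi> \<tau>)" "h \<tau> - 2 * \<psi> \<tau> s"]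
      by (simp add: algebra_simps add_divide_distrib diff_divide_distrib)
    also have "exp (h \<tau> + 2 * ?E (\<psi> \<tau>)) \<le> ?A"
    proof -
      have "h \<tau> + 2 * ?E (\<psi> \<tau>) = ?E (\<lambda>s. h \<tau> + 2 * \<psi> \<tau> s)" by (simp add: int)
      then have "exp (h \<tau> + 2 * ?E (\<psi> \<tau>)) \<le> ?E (\<lambda>s. exp (h \<tau> + 2 * \<psi> \<tau> s))"
        using exp_expectation_le[OF Q] by metis
      also have "\<dots> \<le> ?A" using T \<tau> by (intro expectation_mono_finite[OF Q]) auto
      finally show ?thesis .
    qed
    also have "exp (h \<tau> - 2 * \<psi> \<tau> s) \<le> exp (MAX \<tau>\<in>T. h \<tau> - 2 * \<psi> \<tau> s)" using T \<tau> by auto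
    finally show ?thesis unfolding \<tau>(2) by simp
  qed
  then have "?E (\<lambda>s. exp (MAX \<tau>\<in>T. h \<tau> + (?E (\<psi> \<tau>) - \<psi> \<tau> s))) \<le> ?E (\<lambda>s. (?A + exp (MAX \<tau>\<in>T. h \<tau> - 2 * \<psi> \<tau> s)) / 2)"
    by (rule expectation_mono_finite[OF Q])
  also have "\<dots> = ?E (\<lambda>s. (exp (MAX \<tau>\<in>T. h \<tau> + 2 * \<psi> \<tau> s) + exp (MAX \<tau>\<in>T. h \<tau> - 2 * \<psi> \<tau> s)) / 2)"
    by (simp add: int)
  finally show ?thesis .
qed

section \<open>One-step inequalities for a single labelled observation\<close>

lemma set_pmf_label_pmf: "set_pmf (label_pmf f x) \<subseteq> {1, 2}"
  by (auto simp: label_pmf_def)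

lemma set_pmf_observation_pmf:
  "set_pmf (observation_pmf P f X) \<subseteq> set_pmf P \<times> {1, 2}"
  using set_pmf_label_pmf by (fastforce simp: observation_pmf_def)

lemma finite_set_observation_pmf:
  "finite (set_pmf P) \<Longrightarrow> finite (set_pmf (observation_pmf P f X))"
  by (rule finite_subset[OF set_pmf_observation_pmf]) auto

lemma expectation_observation_pmf:
  fixes F :: "observation \<Rightarrow> real"
  assumes P: "finite (set_pmf P)" and f: "two_link_function f"
  shows "measure_pmf.expectation (observation_pmf P f X) F =
    measure_pmf.expectation P (\<lambda>w. f 1 (X $$ w) * F (w, 1) + f 2 (X $$ w) * F (w, 2))"
proof -
  have "measure_pmf.expectation (observation_pmf P f X) F =
      (\<Sum>s\<in>set_pmf P \<times> {1, 2}. pmf (observation_pmf P f X) s * F s)"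
    using P set_pmf_observation_pmf[of P f X]
    by (subst integral_measure_pmf[of "set_pmf P \<times> {1, 2}"]) auto
  also have "\<dots> = (\<Sum>w\<in>set_pmf P. \<Sum>y\<in>{1, 2}. pmf P w * f y (X $$ w) * F (w, y))"
    unfolding sum.cartesian_product
    by (intro sum.cong) (auto simp: pmf_observation_pmf pmf_label_pmf[OF f])
  also have "\<dots> = (\<Sum>w\<in>set_pmf P. pmf P w * (f 1 (X $$ w) * F (w, 1) + f 2 (X $$ w) * F (w, 2)))"
    by (simp add: algebra_simps)
  finally show ?thesis by (simp add: expectation_finite_sum[OF P])
qed

lemma sum_link_eq_1: "two_link_function f \<Longrightarrow> f 1 x + f 2 x = 1"
  by (auto simp: two_link_function_def)

lemma link_nonneg: "two_link_function f \<Longrightarrow> y \<in> {1, 2} \<Longrightarrow> f y x \<ge> 0"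
  by (auto simp: two_link_function_def)

text \<open>Given the position, \<xi> is bounded and centred, so averaging the chord bound over the
  label leaves a fair sign in place of the label.\<close>

lemma exp_max_score_step:
  fixes h :: "'t \<Rightarrow> real"
  assumes T: "finite T" "T \<noteq> {}" and P: "finite (set_pmf P)" and f: "two_link_function f" and L: "L > 0"
    and bound: "\<And>w y. w \<in> set_pmf P \<Longrightarrow> y \<in> {1, 2} \<Longrightarrow> \<bar>\<xi> (w, y)\<bar> \<le> L"
    and mean: "\<And>w. w \<in> set_pmf P \<Longrightarrow> f 1 (X $$ w) * \<xi> (w, 1) + f 2 (X $$ w) * \<xi> (w, 2) = 0"
  shows "measure_pmf.expectation (observation_pmf P f X) (\<lambda>s. exp (MAX \<tau>\<in>T. h \<tau> + \<xi> s * t \<tau> (fst s))) \<le>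
    measure_pmf.expectation P (\<lambda>w. (exp (MAX \<tau>\<in>T. h \<tau> + L * t \<tau> w) + exp (MAX \<tau>\<in>T. h \<tau> - L * t \<tau> w)) / 2)"
  unfolding expectation_observation_pmf[OF P f]
proof (rule expectation_mono_finite[OF P])
  fix w assume w: "w \<in> set_pmf P"
  let ?U = "exp (MAX \<tau>\<in>T. h \<tau> + L * t \<tau> w)" and ?D = "exp (MAX \<tau>\<in>T. h \<tau> - L * t \<tau> w)"
  let ?f1 = "f 1 (X $$ w)" and ?f2 = "f 2 (X $$ w)" 
  have "?f1 * exp (MAX \<tau>\<in>T. h \<tau> + \<xi> (w, 1) * t \<tau> w) + ?f2 * exp (MAX \<tau>\<in>T. h \<tau> + \<xi> (w, 2) * t \<tau> w) \<le>
      ?f1 * ((1 + \<xi> (w, 1) / L) / 2 * ?U + (1 - \<xi> (w, 1) / L) / 2 * ?D) +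
      ?f2 * ((1 + \<xi> (w, 2) / L) / 2 * ?U + (1 - \<xi> (w, 2) / L) / 2 * ?D)"
    using bound[OF w] link_nonneg[OF f]
    by (intro add_mono mult_left_mono exp_max_chord T L) auto
  also have "\<dots> = ((?f1 + ?f2) * (?U + ?D) + (?f1 * \<xi> (w, 1) + ?f2 * \<xi> (w, 2)) / L * (?U - ?D)) / 2"
    using L by (simp add: field_simps)
  also have "\<dots> = (?U + ?D) / 2" using mean[OF w] sum_link_eq_1[OF f, of "X $$ w"] by simp
  finally show "?f1 * exp (MAX \<tau>\<in>T. h \<tau> + \<xi> (w, 1) * t \<tau> (fst (w, 1 :: nat))) +
      ?f2 * exp (MAX \<tau>\<in>T. h \<tau> + \<xi> (w, 2) * t \<tau> (fst (w, 2 :: nat))) \<le> (?U + ?D) / 2"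
    by simp
qed

text \<open>Symmetrization, then contraction for each fixed label. The resulting bound depends on
  the position only, so the label probabilities add up to 1.\<close>

lemma exp_max_lipschitz_step:
  fixes h :: "'t \<Rightarrow> real" and \<psi> :: "'t \<Rightarrow> observation \<Rightarrow> real" and X :: "real mat"
  assumes T: "finite T" "T \<noteq> {}" and P: "finite (set_pmf P)" and f: "two_link_function f"
    and zero: "\<And>\<tau> w y. \<tau> \<in> T \<Longrightarrow> w \<in> set_pmf P \<Longrightarrow> y \<in> {1, 2} \<Longrightarrow> \<bar>\<psi> \<tau> (w, y)\<bar> \<le> L * \<bar>t \<tau> w\<bar>"
    and lip: "\<And>\<tau> \<sigma> w y. \<tau> \<in> T \<Longrightarrow> \<sigma> \<in> T \<Longrightarrow> w \<in> set_pmf P \<Longrightarrow> y \<in> {1, 2} \<Longrightarrow>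
      \<bar>\<psi> \<tau> (w, y) - \<psi> \<sigma> (w, y)\<bar> \<le> L * \<bar>t \<tau> w - t \<sigma> w\<bar>"
  defines "Q \<equiv> observation_pmf P f X"
  shows "measure_pmf.expectation Q (\<lambda>s. exp (MAX \<tau>\<in>T. h \<tau> + (measure_pmf.expectation Q (\<psi> \<tau>) - \<psi> \<tau> s))) \<le>
    measure_pmf.expectation P (\<lambda>w. (exp (MAX \<tau>\<in>T. h \<tau> + 2 * L * t \<tau> w) + exp (MAX \<tau>\<in>T. h \<tau> - 2 * L * t \<tau> w)) / 2)"
proof -
  have Q: "finite (set_pmf Q)" unfolding Q_def by (rule finite_set_observation_pmf[OF P])
  let ?G = "\<lambda>w. (exp (MAX \<tau>\<in>T. h \<tau> + 2 * L * t \<tau> w) + exp (MAX \<tau>\<in>T. h \<tau> - 2 * L * t \<tau> w)) / 2"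
  note exp_max_symmetrization[OF T Q, of h \<psi>]
  also have "measure_pmf.expectation Q (\<lambda>s. (exp (MAX \<tau>\<in>T. h \<tau> + 2 * \<psi> \<tau> s) + exp (MAX \<tau>\<in>T. h \<tau> - 2 * \<psi> \<tau> s)) / 2) \<le>
      measure_pmf.expectation Q (\<lambda>s. ?G (fst s))"
  proof (rule expectation_mono_finite[OF Q])
    fix s assume "s \<in> set_pmf Q"
    then obtain w y where s: "s = (w, y)" "w \<in> set_pmf P" "y \<in> {1, 2}"
      using set_pmf_observation_pmf[of P f X] by (auto simp: Q_def)
    have "exp (MAX \<tau>\<in>T. h \<tau> + 2 * \<psi> \<tau> s) + exp (MAX \<tau>\<in>T. h \<tau> - 2 * \<psi> \<tau> s) \<le>
      exp (MAX \<tau>\<in>T. h \<tau> + (2 * L) * t \<tau> w) + exp (MAX \<tau>\<in>T. h \<tau> - (2 * L) * t \<tau> w)"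
      using zero s lip[OF _ _ s(2,3)]
      by (intro exp_max_contraction T) (auto simp: abs_mult right_diff_distrib[symmetric] simp del: right_diff_distrib_numeral)
    then show "(exp (MAX \<tau>\<in>T. h \<tau> + 2 * \<psi> \<tau> s) + exp (MAX \<tau>\<in>T. h \<tau> - 2 * \<psi> \<tau> s)) / 2 \<le> ?G (fst s)"
      by (simp add: s)
  qed
  also have "\<dots> = measure_pmf.expectation P (\<lambda>w. (f 1 (X $$ w) + f 2 (X $$ w)) * ?G w)"
    unfolding Q_def expectation_observation_pmf[OF P f] by (simp only: fst_conv distrib_right)
  also have "\<dots> = measure_pmf.expectation P ?G" by (simp only: sum_link_eq_1[OF f] mult_1)
  finally show ?thesis .
qed


section \<open>Random sign sums of matrix units\<close>

lemma fpow_even_diag_nonneg: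
  assumes "finite V" and "\<And>x y. Z x y = Z y x" and "x \<in> V"
  shows "fpow V Z (2 * q) x x \<ge> 0"
proof -
  have "fpow V Z (2 * q) x x = (\<Sum>z\<in>V. fpow V Z q x z * fpow V Z q z x)"
    using fpow_add[OF assms(1,3), of Z q q] by (simp add: mult_2)
  also have "\<dots> = (\<Sum>z\<in>V. fpow V Z q x z * fpow V Z q x z)"
    using fpow_symmetric[where Z = Z, OF assms(1,2) _ assms(3)]
    by (intro sum.cong refl) simp
  finally show ?thesis by (simp add: sum_nonneg)
qed

text \<open>Rows and columns are the vertices of a bipartite graph whose edges are matrix positions.\<close>
definition incident :: "nat + nat \<Rightarrow> nat \<times> nat \<Rightarrow> bool" where
  "incident x e = (case x of Inl k \<Rightarrow> fst e = k | Inr l \<Rightarrow> snd e = l)"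

text \<open>The symmetric dilation of the matrix unit at \<open>e\<close>; symmetry makes the trace
  bound applicable.\<close>

definition edge_mat :: "nat \<times> nat \<Rightarrow> nat + nat \<Rightarrow> nat + nat \<Rightarrow> real" where
  "edge_mat e x y = of_bool (x = Inl (fst e) \<and> y = Inr (snd e) \<or> x = Inr (snd e) \<and> y = Inl (fst e))"

lemma edge_mat_row_sum:
  assumes "e \<in> {..<m1} \<times> {..<m2}" "x \<in> {..<m1} <+> {..<m2}"
  shows "(\<Sum>y\<in>{..<m1} <+> {..<m2}. edge_mat e x y) = of_bool (incident x e)"
proof (cases x)
  case (Inl k)
  have "(\<Sum>y\<in>{..<m1} <+> {..<m2}. edge_mat e x y) = (\<Sum>l<m2. if l = snd e then of_bool (fst e = k) else 0)"
    by (subst sum.Plus) (auto simp: Inl edge_mat_def intro!: sum.cong)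
  then show ?thesis using assms Inl by (auto simp: incident_def)
next
  case (Inr l)
  have "(\<Sum>y\<in>{..<m1} <+> {..<m2}. edge_mat e x y) = (\<Sum>k<m1. if k = fst e then of_bool (snd e = l) else 0)"
    by (subst sum.Plus) (auto simp: Inr edge_mat_def intro!: sum.cong)
  then show ?thesis using assms Inr by (auto simp: incident_def)
qed

text \<open>\<beta> is the infimum of the 2p-th roots of the traces over p >= 1. As a lower bound of
  the roots it satisfies all moment inequalities, and it still dominates the operator norm because
  every root does.\<close>

lemma op_norm_le_root_trace:
  fixes Z :: "nat + nat \<Rightarrow> nat + nat \<Rightarrow> real" and m1 m2 :: nat
  defines "V \<equiv> {..<m1} <+> {..<m2}"
  assumes m1: "m1 \<ge> 1" and sym: "\<And>x y. Z x y = Z y x" and zero: "\<And>l l'. Z (Inr l) (Inr l') = 0"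
  obtains \<beta> where "\<beta> \<ge> 0" "\<And>p. \<beta> ^ (2 * p) \<le> (\<Sum>x\<in>V. fpow V Z (2 * p) x x)"
    "\<And>x. ip m1 (mv m2 (\<lambda>k l. Z (Inl k) (Inr l)) x) (mv m2 (\<lambda>k l. Z (Inl k) (Inr l)) x) \<le> \<beta>\<^sup>2 * ip m2 x x"
proof -
  have fV: "finite V" by (simp add: V_def)
  define W where "W = (\<lambda>k l. Z (Inl k) (Inr l))"
  define t where "t p = (\<Sum>x\<in>V. fpow V Z (2 * Suc p) x x)" for p
  have t: "t p \<ge> 0" for p
    unfolding t_def by (intro sum_nonneg fpow_even_diag_nonneg fV sym)
  define r where "r p = root (2 * Suc p) (t p)" for p
  have r: "r p \<ge> 0" "r p ^ (2 * Suc p) = t p" for p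
    unfolding r_def using t by (auto simp del: mult_Suc_right)
  define \<beta> where "\<beta> = (INF p. r p)"
  have bdd: "bdd_below (range r)" using r by (intro bdd_belowI2[of _ 0]) auto
  have \<beta>0: "\<beta> \<ge> 0" unfolding \<beta>_def using r by (intro cINF_greatest) auto
  have \<beta>r: "\<beta> \<le> r p" for p unfolding \<beta>_def by (rule cINF_lower[OF bdd]) simp
  have pow: "\<beta> ^ (2 * p) \<le> (\<Sum>x\<in>V. fpow V Z (2 * p) x x)" for p
  proof (cases p)
    \<comment> \<open>For p = 0 the trace is the number of vertices, which is at least 1.\<close>
    case 0
    have "card V \<ge> 1" using m1 by (simp add: V_def card_Plus)
    then show ?thesis using 0 by simp
  next
    case (Suc q)
    have "\<beta> ^ (2 * Suc q) \<le> r q ^ (2 * Suc q)" by (intro power_mono \<beta>r \<beta>0)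
    then show ?thesis unfolding r(2) t_def Suc .
  qed
  have "ip m1 (mv m2 W x) (mv m2 W x) \<le> \<beta>\<^sup>2 * ip m2 x x" for x
  proof -
    \<comment> \<open>Padding \<open>x\<close> by zeros on the rows turns the dilation into the
      off-diagonal block.\<close>
    define z where "z = case_sum (\<lambda>_::nat. 0) x"
    let ?a = "ip m1 (mv m2 W x) (mv m2 W x)" and ?b = "ip m2 x x"
    have "(\<Sum>v\<in>V. (\<Sum>y\<in>V. Z v y * z y)\<^sup>2) = ?a"
    proof -
      have "(\<Sum>y\<in>V. Z v y * z y) = (\<Sum>l<m2. Z v (Inr l) * x l)" for v
        unfolding V_def by (subst sum.Plus) (auto simp: z_def)
      then have "(\<Sum>v\<in>V. (\<Sum>y\<in>V. Z v y * z y)\<^sup>2) = (\<Sum>v\<in>V. (\<Sum>l<m2. Z v (Inr l) * x l)\<^sup>2)" by simp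
      also have "\<dots> = (\<Sum>k<m1. (mv m2 W x k)\<^sup>2)"
        unfolding V_def by (subst sum.Plus) (auto simp: zero mv_def W_def)
      finally show ?thesis by (simp add: ip_def power2_eq_square)
    qed
    moreover have "(\<Sum>v\<in>V. (z v)\<^sup>2) = ?b"
      unfolding V_def by (subst sum.Plus) (auto simp: z_def ip_def power2_eq_square)
    ultimately have le: "?a ^ Suc p \<le> t p * ?b ^ Suc p" for p
      using norm_pow_le_trace_pow[where Z = Z, OF fV sym, of z p] by (simp add: t_def)
    have a: "?a \<ge> 0" and b: "?b \<ge> 0" by (rule ip_self_nonneg)+
    have "sqrt ?a \<le> r p * sqrt ?b" for p
    proof -
      have "(sqrt ?a) ^ (2 * Suc p) = ?a ^ Suc p" using a by (simp only: power_mult real_sqrt_pow2)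
      also have "\<dots> \<le> r p ^ (2 * Suc p) * ?b ^ Suc p" unfolding r(2) by (rule le)
      also have "?b ^ Suc p = (sqrt ?b) ^ (2 * Suc p)" using b by (simp only: power_mult real_sqrt_pow2)
      finally have "(sqrt ?a) ^ (2 * Suc p) \<le> (r p * sqrt ?b) ^ (2 * Suc p)" by (simp only: power_mult_distrib)
      then show ?thesis using r(1) b by (subst (asm) power_mono_iff) (auto simp: a)
    qed
    note all = this
    have "sqrt ?a \<le> \<beta> * sqrt ?b"
    proof (cases "?b = 0")
      case True
      then show ?thesis using all[of 0] by simp
    next
      case False
      then have pos: "sqrt ?b > 0" using b by simp
      have "sqrt ?a / sqrt ?b \<le> \<beta>"
        unfolding \<beta>_def using all pos by (intro cINF_greatest) (auto simp: divide_le_eq)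
      then show ?thesis using pos by (simp add: divide_le_eq)
    qed
    then have "(sqrt ?a)\<^sup>2 \<le> (\<beta> * sqrt ?b)\<^sup>2" using a by (intro power_mono) auto
    then show ?thesis using a b by (simp only: power_mult_distrib real_sqrt_pow2)
  qed
  then show ?thesis using that[OF \<beta>0 pow] by (simp add: W_def)
qed

text \<open>For each sign pattern duality bounds all candidates at once by the same \<beta>, because
  their nuclear norms are at most 1. Only then are the signs averaged.\<close>

lemma average_exp_max_signs_le:
  fixes w :: "'i \<Rightarrow> nat \<times> nat" and U :: "'t \<Rightarrow> real mat"
  assumes m1: "m1 \<ge> 1" and T: "finite T" "T \<noteq> {}" and I: "finite I"
    and w: "\<And>i. i \<in> I \<Longrightarrow> w i \<in> {..<m1} \<times> {..<m2}"
    and U: "\<And>\<tau>. \<tau> \<in> T \<Longrightarrow> U \<tau> \<in> carrier_mat m1 m2" "\<And>\<tau>. \<tau> \<in> T \<Longrightarrow> nuclear_norm (U \<tau>) \<le> 1"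
    and \<eta>: "\<eta> \<ge> 0" and N: "N \<ge> 0"
      "\<And>x. x \<in> {..<m1} <+> {..<m2} \<Longrightarrow> (\<Sum>i\<in>I. of_bool (incident x (w i))) \<le> N"
  shows "(\<Sum>B\<in>Pow I. exp (MAX \<tau>\<in>T. \<Sum>i\<in>I. sgn_of B i * (\<eta> * U \<tau> $$ w i))) / 2 ^ card I \<le>
    2 * real (m1 + m2) * exp (\<eta>\<^sup>2 * N / 2)"
proof -
  define V where "V = {..<m1} <+> {..<m2}"
  define A where "A i x y = (if i \<in> I then edge_mat (w i) x y else 0)" for i x y
  define Z where "Z B x y = (\<Sum>i\<in>I. sgn_of B i * A i x y)" for B x y
  have sym: "Z B x y = Z B y x" for B x y
    by (auto simp: Z_def A_def edge_mat_def intro!: sum.cong)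
  have zero: "Z B (Inr l) (Inr l') = 0" for B l l' by (simp add: Z_def A_def edge_mat_def)
  define good where "good B b \<longleftrightarrow> b \<ge> 0 \<and> (\<forall>p. b ^ (2 * p) \<le> (\<Sum>x\<in>V. fpow V (Z B) (2 * p) x x)) \<and>
    (\<forall>x. ip m1 (mv m2 (\<lambda>k l. Z B (Inl k) (Inr l)) x) (mv m2 (\<lambda>k l. Z B (Inl k) (Inr l)) x) \<le> b\<^sup>2 * ip m2 x x)"
    for B b
  have "\<exists>b. good B b" for B
    unfolding good_def V_def by (rule op_norm_le_root_trace[where Z = "Z B", OF m1 sym zero, of m2]) blast
  then have "good B (SOME b. good B b)" for B by (rule someI_ex)
  then obtain \<beta> where "\<And>B. good B (\<beta> B)" by (rule that)
  then have \<beta>: "\<And>B. \<beta> B \<ge> 0" "\<And>B p. \<beta> B ^ (2 * p) \<le> (\<Sum>x\<in>V. fpow V (Z B) (2 * p) x x)"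
    "\<And>B x. ip m1 (mv m2 (\<lambda>k l. Z B (Inl k) (Inr l)) x) (mv m2 (\<lambda>k l. Z B (Inl k) (Inr l)) x) \<le> (\<beta> B)\<^sup>2 * ip m2 x x"
    unfolding good_def by blast+
  have MAX_le: "(MAX \<tau>\<in>T. \<Sum>i\<in>I. sgn_of B i * (\<eta> * U \<tau> $$ w i)) \<le> \<eta> * \<beta> B" for B
  proof -
    have "(\<Sum>i\<in>I. sgn_of B i * (\<eta> * U \<tau> $$ w i)) \<le> \<eta> * \<beta> B" if \<tau>: "\<tau> \<in> T" for \<tau>
    proof -
      have "minner m1 m2 (entries (U \<tau>)) (\<lambda>k l. Z B (Inl k) (Inr l)) =
          (\<Sum>k<m1. \<Sum>l<m2. \<Sum>i\<in>I. sgn_of B i * (of_bool (w i = (k, l)) * U \<tau> $$ (k, l)))"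
        by (auto simp: minner_def Z_def A_def edge_mat_def sum_distrib_left mult_ac prod_eq_iff intro!: sum.cong)
      also have "\<dots> = (\<Sum>p\<in>{..<m1} \<times> {..<m2}. \<Sum>i\<in>I. sgn_of B i * (of_bool (w i = p) * U \<tau> $$ p))"
        by (subst sum.cartesian_product) (intro sum.cong, auto)
      also have "\<dots> = (\<Sum>i\<in>I. \<Sum>p\<in>{..<m1} \<times> {..<m2}. sgn_of B i * (of_bool (w i = p) * U \<tau> $$ p))"
        by (rule sum.swap)
      also have "\<dots> = (\<Sum>i\<in>I. sgn_of B i * U \<tau> $$ w i)"
      proof (intro sum.cong refl)
        fix i assume i: "i \<in> I"
        have "(\<Sum>p\<in>{..<m1} \<times> {..<m2}. of_bool (w i = p) * U \<tau> $$ p) =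
            (\<Sum>p\<in>{..<m1} \<times> {..<m2}. if w i = p then U \<tau> $$ p else 0)"
          by (intro sum.cong) auto
        then show "(\<Sum>p\<in>{..<m1} \<times> {..<m2}. sgn_of B i * (of_bool (w i = p) * U \<tau> $$ p)) = sgn_of B i * U \<tau> $$ w i"
          using w[OF i] by (simp add: sum_distrib_left[symmetric])
      qed
      finally have "(\<Sum>i\<in>I. sgn_of B i * U \<tau> $$ w i) = minner m1 m2 (entries (U \<tau>)) (\<lambda>k l. Z B (Inl k) (Inr l))" ..
      also have "\<dots> \<le> \<beta> B * nuclear_norm (U \<tau>)"
        by (rule minner_le_nuclear_norm_times[OF U(1)[OF \<tau>] \<beta>(1,3)])
      also have "\<dots> \<le> \<beta> B" using mult_left_mono[OF U(2)[OF \<tau>] \<beta>(1)[of B]] by simp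
      finally have "\<eta> * (\<Sum>i\<in>I. sgn_of B i * U \<tau> $$ w i) \<le> \<eta> * \<beta> B" by (rule mult_left_mono[OF _ \<eta>])
      then show ?thesis by (simp add: sum_distrib_left mult_ac)
    qed
    then show ?thesis using T by simp
  qed
  have "(\<Sum>B\<in>Pow I. exp (MAX \<tau>\<in>T. \<Sum>i\<in>I. sgn_of B i * (\<eta> * U \<tau> $$ w i))) / 2 ^ card I \<le>
      (\<Sum>B\<in>Pow I. exp (\<eta> * \<beta> B)) / 2 ^ card I"
    using MAX_le by (intro divide_right_mono sum_mono) auto
  also have "\<dots> \<le> 2 * real (card V) * exp (\<eta>\<^sup>2 * N / 2)"
  proof (rule average_exp_le[where A = A])
    show "finite I" "finite V" by (use I in \<open>auto simp: V_def\<close>)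
    show "A i x y \<ge> 0" for i x y by (simp add: A_def edge_mat_def)
    show "(\<Sum>y\<in>V. A i x y) \<le> 1" if "i \<in> I" "x \<in> V" for i x
      using edge_mat_row_sum[OF w[OF that(1)]] that by (simp add: A_def V_def)
    show "(\<Sum>i\<in>I. \<Sum>y\<in>V. A i x y) \<le> N" if "x \<in> V" for x
    proof -
      have "(\<Sum>i\<in>I. \<Sum>y\<in>V. A i x y) = (\<Sum>i\<in>I. of_bool (incident x (w i)))"
        using edge_mat_row_sum[OF w] that by (intro sum.cong) (simp_all add: A_def V_def)
      then show ?thesis using N(2) that by (simp add: V_def)
    qed
    show "\<beta> B ^ (2 * p) \<le> (\<Sum>x\<in>V. fpow V (\<lambda>x y. \<Sum>i\<in>I. sgn_of B i * A i x y) (2 * p) x x)" for B p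
      using \<beta>(2)[of B p] by (simp add: Z_def[abs_def])
  qed (use N \<beta> in auto)
  also have "card V = m1 + m2" by (simp add: V_def card_Plus)
  finally show ?thesis .
qed

text \<open>The expectation is a row or a column weight. As \<open>weights\<close> bounds the
  maximum of a row and a column weight, an index of the other kind must exist.\<close>

lemma expectation_incident_le:
  assumes P: "set_pmf P \<subseteq> {..<m1} \<times> {..<m2}" and x: "x \<in> {..<m1} <+> {..<m2}"
    and weights: "\<forall>k<m1. \<forall>l<m2. max (row_weight P m2 k) (col_weight P m1 l) \<le> b"
    and m: "m1 \<ge> 1" "m2 \<ge> 1"
  shows "measure_pmf.expectation P (\<lambda>e. of_bool (incident x e)) \<le> b"
proof -
  have "measure_pmf.expectation P (\<lambda>e. of_bool (incident x e)) =
      (\<Sum>e\<in>{..<m1} \<times> {..<m2}. pmf P e * of_bool (incident x e))"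
    using P by (subst integral_measure_pmf[of "{..<m1} \<times> {..<m2}"]) auto
  also have "\<dots> = (\<Sum>k<m1. \<Sum>l<m2. pmf P (k, l) * of_bool (incident x (k, l)))"
    unfolding sum.cartesian_product by (intro sum.cong) auto
  also have "\<dots> \<le> b"
  proof (cases x)
    case (Inl k)
    then have k: "k < m1" using x by auto
    have "(\<Sum>k'<m1. \<Sum>l<m2. pmf P (k', l) * of_bool (incident x (k', l))) =
        (\<Sum>k'<m1. if k' = k then \<Sum>l<m2. pmf P (k', l) else 0)"
      by (intro sum.cong) (auto simp: Inl incident_def)
    also have "\<dots> = row_weight P m2 k" using k by (simp add: row_weight_def)
    also have "\<dots> \<le> b" using weights k m by (force simp: Suc_le_eq)
    finally show ?thesis .
  next
    case (Inr l)
    then have l: "l < m2" using x by auto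
    have "(\<Sum>k<m1. \<Sum>l'<m2. pmf P (k, l') * of_bool (incident x (k, l'))) =
        (\<Sum>k<m1. \<Sum>l'<m2. if l' = l then pmf P (k, l') else 0)"
      by (intro sum.cong) (auto simp: Inr incident_def)
    also have "\<dots> = col_weight P m1 l" using l by (simp add: col_weight_def)
    also have "\<dots> \<le> b" using weights l m by (force simp: Suc_le_eq)
    finally show ?thesis .
  qed
  finally show ?thesis .
qed

text \<open>Given the positions, the largest vertex degree controls the sign average. Its
  exponential is at most the sum over all vertices, which costs the second factor
  \<open>m1 + m2\<close>. Each degree is a sum of independent indicators of mean at most
  \<open>b\<close>, with moment generating function of Poisson type.\<close>

lemma expectation_exp_max_signs_le:
  fixes U :: "'t \<Rightarrow> real mat"
  assumes m: "m1 \<ge> 1" "m2 \<ge> 1" and T: "finite T" "T \<noteq> {}" and I: "finite I"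
    and P: "set_pmf P \<subseteq> {..<m1} \<times> {..<m2}"
    and weights: "\<forall>k<m1. \<forall>l<m2. max (row_weight P m2 k) (col_weight P m1 l) \<le> b"
    and U: "\<And>\<tau>. \<tau> \<in> T \<Longrightarrow> U \<tau> \<in> carrier_mat m1 m2" "\<And>\<tau>. \<tau> \<in> T \<Longrightarrow> nuclear_norm (U \<tau>) \<le> 1"
    and \<eta>: "\<eta> \<ge> 0"
  shows "measure_pmf.expectation (Pi_pmf I d (\<lambda>_. P))
      (\<lambda>w. (\<Sum>B\<in>Pow I. exp (MAX \<tau>\<in>T. \<Sum>i\<in>I. sgn_of B i * (\<eta> * U \<tau> $$ w i))) / 2 ^ card I)
    \<le> 2 * (real (m1 + m2))\<^sup>2 * exp (real (card I) * b * (exp (\<eta>\<^sup>2 / 2) - 1))"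
proof -
  define V where "V = {..<m1} <+> {..<m2}"
  define s where "s = \<eta>\<^sup>2 / 2"
  define cnt :: "nat + nat \<Rightarrow> ('a \<Rightarrow> nat \<times> nat) \<Rightarrow> real" where
    "cnt x w = (\<Sum>i\<in>I. of_bool (incident x (w i)))" for x w
  have fP: "finite (set_pmf P)" using P finite_subset by blast
  let ?W = "Pi_pmf I d (\<lambda>_. P)"
  have fW: "finite (set_pmf ?W)" by (rule finite_set_Pi_pmf[OF I fP])
  have V: "finite V" "V \<noteq> {}" using m by (auto simp: V_def Plus_def lessThan_empty_iff)
  have cardV: "card V = m1 + m2" by (simp add: V_def card_Plus)
  have pointwise: "(\<Sum>B\<in>Pow I. exp (MAX \<tau>\<in>T. \<Sum>i\<in>I. sgn_of B i * (\<eta> * U \<tau> $$ w i))) / 2 ^ card I \<le>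
      2 * real (m1 + m2) * (\<Sum>x\<in>V. exp (s * cnt x w))" if w: "w \<in> set_pmf ?W" for w
  proof -
    have wI: "w i \<in> {..<m1} \<times> {..<m2}" if "i \<in> I" for i
      using w that P unfolding set_Pi_pmf[OF I] by (auto simp: PiE_dflt_def)
    define N where "N = (MAX x\<in>V. cnt x w)"
    have "N \<in> (\<lambda>x. cnt x w) ` V" unfolding N_def using V by (intro Max_in) auto
    then obtain x where x: "x \<in> V" "N = cnt x w" by auto
    have le: "cnt y w \<le> N" if "y \<in> V" for y unfolding N_def using V that by auto
    have "N \<ge> 0" using x by (simp add: cnt_def sum_nonneg)
    then have "(\<Sum>B\<in>Pow I. exp (MAX \<tau>\<in>T. \<Sum>i\<in>I. sgn_of B i * (\<eta> * U \<tau> $$ w i))) / 2 ^ card I \<le>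
        2 * real (m1 + m2) * exp (\<eta>\<^sup>2 * N / 2)"
      using le by (intro average_exp_max_signs_le m T I wI U \<eta>) (auto simp: V_def cnt_def)
    also have "exp (\<eta>\<^sup>2 * N / 2) = exp (s * cnt x w)" by (simp add: s_def x(2))
    also have "\<dots> \<le> (\<Sum>x\<in>V. exp (s * cnt x w))" using V x by (intro member_le_sum) auto
    finally show ?thesis by (simp add: mult_left_mono)
  qed
  have one: "measure_pmf.expectation ?W (\<lambda>w. exp (s * cnt x w)) \<le> exp (real (card I) * b * (exp s - 1))" if x: "x \<in> V" for x
  proof -
    have "measure_pmf.expectation ?W (\<lambda>w. exp (s * cnt x w)) =
        measure_pmf.expectation ?W (\<lambda>w. \<Prod>i\<in>I. exp (s * of_bool (incident x (w i))))"
      by (simp add: cnt_def sum_distrib_left exp_sum[OF I])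
    also have "\<dots> = (\<Prod>i\<in>I. measure_pmf.expectation P (\<lambda>e. exp (s * of_bool (incident x e))))"
      by (intro expectation_prod_Pi_pmf I integrable_measure_pmf_finite fP) auto
    also have "\<dots> \<le> exp (b * (exp s - 1)) ^ card I"
    proof -
      have "measure_pmf.expectation P (\<lambda>e. exp (s * of_bool (incident x e))) =
          measure_pmf.expectation P (\<lambda>e. 1 + (exp s - 1) * of_bool (incident x e))"
        by (intro Bochner_Integration.integral_cong) auto
      also have "\<dots> = 1 + (exp s - 1) * measure_pmf.expectation P (\<lambda>e. of_bool (incident x e))"
        by (simp add: integrable_measure_pmf_finite[OF fP])
      also have "\<dots> \<le> 1 + (exp s - 1) * b"
        using expectation_incident_le[OF P _ weights m, of x] x
        by (intro add_left_mono mult_left_mono) (auto simp: s_def V_def)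
      also have "\<dots> \<le> exp (b * (exp s - 1))" using exp_ge_add_one_self[of "b * (exp s - 1)"] by (simp add: mult.commute)
      finally have le: "measure_pmf.expectation P (\<lambda>e. exp (s * of_bool (incident x e))) \<le> exp (b * (exp s - 1))" .
      have "measure_pmf.expectation P (\<lambda>e. exp (s * of_bool (incident x e))) \<ge> 0"
        by (intro Bochner_Integration.integral_nonneg) auto
      then show ?thesis using power_mono[OF le] by simp
    qed
    also have "\<dots> = exp (real (card I) * b * (exp s - 1))" by (simp add: exp_of_nat_mult[symmetric] mult.assoc)
    finally show ?thesis .
  qed
  have "measure_pmf.expectation ?W
      (\<lambda>w. (\<Sum>B\<in>Pow I. exp (MAX \<tau>\<in>T. \<Sum>i\<in>I. sgn_of B i * (\<eta> * U \<tau> $$ w i))) / 2 ^ card I) \<le>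
      measure_pmf.expectation ?W (\<lambda>w. 2 * real (m1 + m2) * (\<Sum>x\<in>V. exp (s * cnt x w)))"
    by (rule expectation_mono_finite[OF fW], rule pointwise)
  also have "\<dots> = 2 * real (m1 + m2) * (\<Sum>x\<in>V. measure_pmf.expectation ?W (\<lambda>w. exp (s * cnt x w)))"
    by (simp add: integrable_measure_pmf_finite[OF fW] Bochner_Integration.integral_sum)
  also have "\<dots> \<le> 2 * real (m1 + m2) * (\<Sum>x\<in>V. exp (real (card I) * b * (exp s - 1)))"
    by (intro mult_left_mono sum_mono one) auto
  also have "\<dots> = 2 * (real (m1 + m2))\<^sup>2 * exp (real (card I) * b * (exp s - 1))"
    by (simp only: sum_constant cardV power2_eq_square mult.assoc)
  finally show ?thesis by (simp only: s_def)
qed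


section \<open>Link functions\<close>

lemma link_derivs_add_0:
  assumes f: "two_link_function f" and s: "smooth_log_concave_link f"
  shows "deriv (f 1) x + deriv (f 2) x = 0"
proof -
  have "(f 1 has_real_derivative deriv (f 1) x) (at x)" "(f 2 has_real_derivative deriv (f 2) x) (at x)"
    using smooth_linkD(1)[OF s, of 1] smooth_linkD(1)[OF s, of 2] by (simp_all add: field_differentiable_derivI)
  then have "((\<lambda>x. f 1 x + f 2 x) has_real_derivative deriv (f 1) x + deriv (f 2) x) (at x)"
    by (rule DERIV_add)
  moreover have "(\<lambda>x. f 1 x + f 2 x) = (\<lambda>_. 1)" using f by (auto simp: two_link_function_def)
  ultimately show ?thesis using DERIV_unique DERIV_const by metis
qed

lemma score_le:
  assumes la: "link_assumption f \<gamma> H L K" and x: "\<bar>x\<bar> \<le> \<gamma>" and j: "j \<in> {1, 2}"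
  shows "\<bar>deriv (f j) x / f j x\<bar> \<le> L"
proof -
  have s: "smooth_log_concave_link f" using la by (simp add: link_assumption_def)
  have "x \<in> {-\<gamma>..\<gamma>}" using x by auto
  then have "\<bar>deriv (f j) x\<bar> / f j x \<le> (SUP x\<in>{-\<gamma>..\<gamma>}. \<bar>deriv (f j) x\<bar> / f j x)"
    by (rule cSUP_upper[OF _ bdd_above_score_link[OF s j]])
  also have "\<dots> \<le> L" using la j by (auto simp: link_assumption_def)
  finally show ?thesis using smooth_linkD(2)[OF s j, of x] by (simp add: abs_divide)
qed

lemma ln_link_lipschitz:
  assumes la: "link_assumption f \<gamma> H L K" and x: "\<bar>x\<bar> \<le> \<gamma>" and y: "\<bar>y\<bar> \<le> \<gamma>" and j: "j \<in> {1, 2}"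
  shows "\<bar>ln (f j x) - ln (f j y)\<bar> \<le> L * \<bar>x - y\<bar>"
proof -
  have s: "smooth_log_concave_link f" using la by (simp add: link_assumption_def)
  have "norm (- ln (f j x) - - ln (f j y)) \<le> L * norm (x - y)"
  proof (rule field_differentiable_bound[of "{-\<gamma>..\<gamma>}"])
    fix z assume "z \<in> {-\<gamma>..\<gamma>}"
    then have "\<bar>z\<bar> \<le> \<gamma>" by auto
    then show "norm (- (deriv (f j) z / f j z)) \<le> L" using score_le[OF la _ j, of z] by simp
    show "((\<lambda>x. - ln (f j x)) has_real_derivative - (deriv (f j) z / f j z)) (at z within {-\<gamma>..\<gamma>})"
      by (rule has_field_derivative_at_within[OF smooth_linkD(4)[OF s j]])
  qed (use x y in auto)
  then show ?thesis by simp
qed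

lemma neg_ln_link_above_tangent:
  assumes s: "smooth_log_concave_link f" and j: "j \<in> {1, 2}"
  shows "- ln (f j y) \<ge> - ln (f j x) - deriv (f j) x / f j x * (y - x)"
proof -
  have "- ln (f j y) - - ln (f j x) \<ge> - (deriv (f j) x / f j x) * (y - x)"
    by (rule convex_on_imp_above_tangent[OF smooth_linkD(3)[OF s j]])
      (use smooth_linkD(4)[OF s j] in auto)
  then show ?thesis by (simp add: algebra_simps)
qed

section \<open>Quadratic lower bound for the Kullback-Leibler divergence\<close>

definition kl_link :: "(nat \<Rightarrow> real \<Rightarrow> real) \<Rightarrow> real \<Rightarrow> real \<Rightarrow> real" where
  "kl_link f x y = f 1 x * (ln (f 1 x) - ln (f 1 y)) + f 2 x * (ln (f 2 x) - ln (f 2 y))"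

text \<open>With t = |d| / 2 the right side is 2 sin^2 t, and sin t >= t / sqrt 2 because cos is at
  least 1 / sqrt 2 up to pi / 4.\<close>

lemma one_minus_cos_ge:
  fixes d :: real
  assumes "\<bar>d\<bar> \<le> pi / 2"
  shows "d\<^sup>2 / 4 \<le> 1 - cos d"
proof -
  define t where "t = \<bar>d\<bar> / 2"
  have t: "0 \<le> t" "t \<le> pi / 4" using assms by (auto simp: t_def)
  have "t / sqrt 2 \<le> sin t"
  proof (cases "t = 0")
    case False
    then have "0 < t" using t by simp
    from MVT2[OF this, of sin cos] obtain z where z: "0 < z" "z < t" "sin t - sin 0 = (t - 0) * cos z"
      by auto
    have "cos (pi / 4) \<le> cos z" using z t pi_gt_zero by (intro cos_monotone_0_pi_le) linarith+
    moreover have "cos (pi / 4) = 1 / sqrt 2" using real_div_sqrt[of 2] by (simp add: cos_45)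
    ultimately have "1 / sqrt 2 \<le> cos z" by simp
    then have "t * (1 / sqrt 2) \<le> t * cos z" using t by (intro mult_left_mono)
    then show ?thesis using z by simp
  qed simp
  then have "(t / sqrt 2)\<^sup>2 \<le> (sin t)\<^sup>2" using t by (intro power_mono) auto
  moreover have "cos d = 1 - 2 * (sin t)\<^sup>2"
    using cos_double_sin[of t] by (simp add: t_def)
  ultimately show ?thesis by (simp add: t_def power_divide)
qed

text \<open>Kullback--Leibler dominates the squared Hellinger distance, which is \<open>2 (1 - cos \<delta>)\<close> with
  \<open>\<delta>\<close> the increment of \<open>arcsin \<circ> sqrt \<circ> f\<^sup>1\<close>; the squared derivative of that function is twice the
  curvature.\<close>
lemma kl_link_ge:
  assumes f: "two_link_function f" and la: "link_assumption f \<gamma> H L K" and x: "\<bar>x\<bar> \<le> \<gamma>" and y: "\<bar>y\<bar> \<le> \<gamma>"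
  shows "K * (x - y)\<^sup>2 \<le> kl_link f x y"
proof -
  have s: "smooth_log_concave_link f" and K: "K > 0" "K = (INF x\<in>{-\<gamma>..\<gamma>}. curvature f x)"
    using la by (auto simp: link_assumption_def)
  have pos: "f 1 z > 0" "f 2 z > 0" for z using smooth_linkD(2)[OF s] by auto
  have sum1: "f 1 z + f 2 z = 1" for z using f by (auto simp: two_link_function_def)
  have lt1: "f 1 z < 1" for z using pos(2)[of z] sum1[of z] by linarith
  define S where "S z = arcsin (sqrt (f 1 z))" for z
  define S' where "S' z = deriv (f 1) z / (2 * sqrt (f 1 z) * sqrt (f 2 z))" for z
  have sinS: "sin (S z) = sqrt (f 1 z)" and cosS: "cos (S z) = sqrt (f 2 z)" for z
  proof -
    have b: "-1 \<le> sqrt (f 1 z)" "sqrt (f 1 z) \<le> 1" using pos(1)[of z] lt1[of z] by (auto intro: order.trans[of _ 0])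
    show "sin (S z) = sqrt (f 1 z)" unfolding S_def by (rule sin_arcsin[OF b])
    have "cos (S z) = sqrt (1 - (sqrt (f 1 z))\<^sup>2)" unfolding S_def by (rule cos_arcsin[OF b])
    also have "1 - (sqrt (f 1 z))\<^sup>2 = f 2 z" using pos(1)[of z] sum1[of z] by simp
    finally show "cos (S z) = sqrt (f 2 z)" .
  qed
  have S_range: "0 \<le> S z" "S z \<le> pi / 2" for z
  proof -
    have b: "0 \<le> sqrt (f 1 z)" "sqrt (f 1 z) \<le> 1" using pos(1)[of z] lt1[of z] by auto
    show "0 \<le> S z" using arcsin_le_arcsin[of 0 "sqrt (f 1 z)"] b by (simp add: S_def)
    show "S z \<le> pi / 2" unfolding S_def using b by (intro arcsin_ubound) linarith+
  qed
  have dS: "(S has_real_derivative S' z) (at z)" for z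
  proof -
    have d: "(f 1 has_real_derivative deriv (f 1) z) (at z)"
      using smooth_linkD(1)[OF s, of 1] by (simp add: field_differentiable_derivI)
    have b: "-1 < sqrt (f 1 z)" "sqrt (f 1 z) < 1" using pos(1)[of z] lt1[of z] by (auto intro: less_trans[of _ 0])
    have "((\<lambda>z. sqrt (f 1 z)) has_real_derivative deriv (f 1) z * (inverse (sqrt (f 1 z)) / 2)) (at z)"
      using DERIV_chain2[OF DERIV_real_sqrt[OF pos(1)] d] by (simp add: mult.commute)
    from DERIV_chain2[OF DERIV_arcsin[OF b] this]
    have "(S has_real_derivative inverse (sqrt (1 - (sqrt (f 1 z))\<^sup>2)) * (deriv (f 1) z * (inverse (sqrt (f 1 z)) / 2))) (at z)"
      by (simp add: S_def[abs_def])
    moreover have "1 - (sqrt (f 1 z))\<^sup>2 = f 2 z" using pos(1)[of z] sum1[of z] by simp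
    ultimately have "(S has_real_derivative inverse (sqrt (f 2 z)) * (deriv (f 1) z * (inverse (sqrt (f 1 z)) / 2))) (at z)"
      by (simp only:)
    then show ?thesis by (simp add: S'_def field_simps)
  qed
  have S'_ge: "2 * K \<le> (S' z)\<^sup>2" if z: "z \<in> {-\<gamma>..\<gamma>}" for z
  proof -
    have "K \<le> curvature f z" unfolding K(2) by (rule cINF_lower[OF bdd_below_curvature[OF f] z])
    moreover have "1 - f 1 z = f 2 z" using sum1[of z] by linarith
    moreover have "(S' z)\<^sup>2 = 2 * curvature f z"
      using pos[of z] sum1[of z] \<open>1 - f 1 z = f 2 z\<close>
      by (simp add: S'_def curvature_def power_divide power_mult_distrib)
    ultimately show ?thesis by simp
  qed
  have mvt: "2 * K * (u - v)\<^sup>2 \<le> (S u - S v)\<^sup>2" if uv: "\<bar>u\<bar> \<le> \<gamma>" "\<bar>v\<bar> \<le> \<gamma>" "v < u" for u v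
  proof -
    from MVT2[OF uv(3), of S S'] dS obtain z where z: "v < z" "z < u" "S u - S v = (u - v) * S' z" by auto
    have "z \<in> {-\<gamma>..\<gamma>}" using z uv by auto
    then have "2 * K * (u - v)\<^sup>2 \<le> (S' z)\<^sup>2 * (u - v)\<^sup>2" by (intro mult_right_mono S'_ge) auto
    then show ?thesis by (simp add: z(3) power_mult_distrib mult.commute)
  qed
  have inc: "2 * K * (x - y)\<^sup>2 \<le> (S x - S y)\<^sup>2"
    using mvt[OF x y] mvt[OF y x] by (cases x y rule: linorder_cases) (auto simp: power2_commute)
  \<comment> \<open>The inequality ln r <= r - 1 at r = sqrt (q / p); summed over both labels it
    bounds the divergence by the squared Hellinger distance.\<close>
  have ln_ge: "p * (ln p - ln q) \<ge> 2 * (p - sqrt p * sqrt q)" if "p > 0" "q > 0" for p q :: real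
  proof -
    define r where "r = sqrt (q / p)"
    have "ln r \<le> r - 1" unfolding r_def using that by (intro ln_le_minus_one) auto
    moreover have "ln r = (ln q - ln p) / 2" unfolding r_def using that by (simp add: ln_sqrt ln_div)
    ultimately have "2 * (1 - r) \<le> ln p - ln q" by (simp add: field_simps)
    then have "2 * (1 - sqrt (q / p)) \<le> ln p - ln q" by (simp only: r_def)
    then have "p * (2 * (1 - sqrt (q / p))) \<le> p * (ln p - ln q)" using that by (intro mult_left_mono) auto
    moreover have "p * sqrt (q / p) = sqrt p * sqrt q"
      using that real_sqrt_mult_self[of p] by (simp add: real_sqrt_divide field_simps)
    ultimately show ?thesis by (simp add: algebra_simps)
  qed
  have "kl_link f x y \<ge> 2 * (f 1 x - sqrt (f 1 x) * sqrt (f 1 y)) + 2 * (f 2 x - sqrt (f 2 x) * sqrt (f 2 y))"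
    unfolding kl_link_def by (intro add_mono ln_ge pos)
  also have "2 * (f 1 x - sqrt (f 1 x) * sqrt (f 1 y)) + 2 * (f 2 x - sqrt (f 2 x) * sqrt (f 2 y)) = 2 * (1 - cos (S x - S y))"
    using sum1[of x] by (simp add: cos_diff sinS cosS algebra_simps)
  finally have "kl_link f x y \<ge> 2 * (1 - cos (S x - S y))" .
  \<comment> \<open>For \<delta> = S x - S y the divergence is at least \<delta>^2 / 2, and
    \<delta>^2 >= 2 K (x - y)^2. The angles lie in the first quadrant, so their difference is in the
    range of the cosine bound.\<close>
  moreover have "\<bar>S x - S y\<bar> \<le> pi / 2" using S_range[of x] S_range[of y] by linarith
  then have "(S x - S y)\<^sup>2 / 4 \<le> 1 - cos (S x - S y)" by (rule one_minus_cos_ge)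
  moreover have "2 * (K * (x - y)\<^sup>2) \<le> (S x - S y)\<^sup>2" using inc by (simp only: mult.assoc)
  moreover have "b \<le> k" if "2 * (1 - c) \<le> k" "a / 4 \<le> 1 - c" "2 * b \<le> a" for a b c k :: real
  proof -
    have "a / 2 \<le> 2 * (1 - c)" using mult_left_mono[OF that(2), of 2] by simp
    then show ?thesis using that(1,3) by simp
  qed
  ultimately show ?thesis by blast
qed


section \<open>Estimation error\<close>

lemma abs_entry_le_sup_norm:
  assumes "X \<in> carrier_mat m1 m2" "k < m1" "l < m2"
  shows "\<bar>X $$ (k, l)\<bar> \<le> sup_norm X"
proof -
  have "{\<bar>X $$ (k, l)\<bar> | k l. k < dim_row X \<and> l < dim_col X} =
      (\<lambda>(k, l). \<bar>X $$ (k, l)\<bar>) ` ({..<m1} \<times> {..<m2})"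
    using assms by auto
  then show ?thesis unfolding sup_norm_def using assms by (auto intro!: Max_ge)
qed

lemma frobenius_norm_diff_sq:
  assumes "A \<in> carrier_mat m1 m2" "B \<in> carrier_mat m1 m2"
  shows "(frobenius_norm (A - B))\<^sup>2 = (\<Sum>k<m1. \<Sum>l<m2. (A $$ (k, l) - B $$ (k, l))\<^sup>2)"
  using assms by (auto simp: frobenius_norm_def sum_nonneg intro!: sum.cong)

lemma nuclear_norm_le_add_diff:
  assumes A: "A \<in> carrier_mat m1 m2" and B: "B \<in> carrier_mat m1 m2"
  shows "nuclear_norm A \<le> nuclear_norm B + nuclear_norm (B - A)"
proof -
  have D: "B - A \<in> carrier_mat m1 m2" using A by (rule minus_carrier_mat)
  obtain Z where Z: "contraction m1 m2 Z" "minner m1 m2 (entries A) Z = nuclear_norm A"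
    using nuclear_norm_dual[OF A] by blast
  have "minner m1 m2 (entries A) Z =
      minner m1 m2 (\<lambda>k l. entries B k l + (- 1) * entries (B - A) k l) Z"
    using A B by (intro minner_cong) auto
  also have "\<dots> = minner m1 m2 (entries B) Z + minner m1 m2 (entries (B - A)) (\<lambda>k l. - 1 * Z k l)"
    by (simp only: minner_add_left minner_scale_left minner_scale_right)
  also have "minner m1 m2 (entries (B - A)) (\<lambda>k l. - 1 * Z k l) \<le> nuclear_norm (B - A)"
  proof (rule minner_le_nuclear_norm[OF D])
    have "mv m2 (\<lambda>k l. - 1 * Z k l) x = (\<lambda>k. - mv m2 Z x k)" for x
      by (simp add: mv_def sum_negf)
    then show "contraction m1 m2 (\<lambda>k l. - 1 * Z k l)" using Z(1) by (simp add: contraction_def ip_def)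
  qed
  also have "minner m1 m2 (entries B) Z \<le> nuclear_norm B" by (rule minner_le_nuclear_norm[OF B Z(1)])
  finally show ?thesis by (simp add: Z)
qed

text \<open>With \<open>a = n \<nu> / m\<close>, the choice \<open>\<eta>\<^sup>2 / 2 = 2 ln d / (9 a)\<close> is at most 1 exactly by the lower bound
  assumed on \<open>n\<close>.\<close>
lemma deviation_exponent:
  fixes d n m :: nat and \<nu> :: real
  assumes d: "d \<ge> 2" and m: "m \<ge> 1" and \<nu>: "\<nu> \<ge> 1"
    and n: "real n \<ge> 2 * real m * ln (real d) / (9 * \<nu>)"
  obtains \<eta> where "\<eta> > 0"
    "2 * (real d)\<^sup>2 * exp (real n * (\<nu> / real m) * (exp (\<eta>\<^sup>2 / 2) - 1)) /
      exp (\<eta> * (27 / 5 * real n * sqrt (2 * \<nu> * ln (real d) / (real m * real n)))) \<le> 1 / real d"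
proof -
  define ld where "ld = ln (real d)"
  have ld: "ld > 0" using d by (simp add: ld_def)
  have n0: "real n > 0"
  proof -
    have "2 * real m * ld / (9 * \<nu>) > 0" using m ld \<nu> by simp
    then show ?thesis using n unfolding ld_def by linarith
  qed
  define a where "a = real n * (\<nu> / real m)"
  have a: "a > 0" using n0 \<nu> m by (simp add: a_def)
  have a_ge: "2 * ld / 9 \<le> a"
  proof -
    have "2 * ld / 9 = 2 * real m * ld / (9 * \<nu>) * (\<nu> / real m)" using m \<nu> by simp
    also have "\<dots> \<le> real n * (\<nu> / real m)" using n \<nu> unfolding ld_def by (intro mult_right_mono) auto
    finally show ?thesis by (simp add: a_def)
  qed
  define s where "s = 2 * ld / (9 * a)"
  have s: "0 < s" "s \<le> 1" using a ld a_ge by (auto simp: s_def divide_le_eq)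
  define \<eta> where "\<eta> = sqrt (2 * s)"
  have \<eta>: "\<eta> > 0" "\<eta>\<^sup>2 / 2 = s" using s by (auto simp: \<eta>_def)
  \<comment> \<open>For s <= 1 this gives \<open>exp s - 1 \<le> 2 * s\<close>, and 2 a s = 4/9
    \<open>ld\<close>.\<close>
  have "exp s \<le> 1 + s + s\<^sup>2" using s by (intro exp_bound) auto
  moreover have "s\<^sup>2 \<le> s" using s by (simp add: power2_eq_square mult_left_le)
  ultimately have "exp s - 1 \<le> 2 * s" by simp
  then have "a * (exp s - 1) \<le> a * (2 * s)" using a by (intro mult_left_mono) auto
  also have "\<dots> \<le> ld" using a ld by (simp add: s_def)
  finally have up: "exp (a * (exp s - 1)) \<le> exp ld" by simp
  \<comment> \<open>Here 27/5 = 6 * 9/10 combines the factor in \<open>reg\<close> with the share of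
    the score. Since (27/5)^2 * 8/9 = 25.92 exceeds 25, 27/5 q is at least 5 \<open>ld\<close>, and
    2 d^2 * d / d^5 <= 1/d for d >= 2.\<close>
  define q where "q = \<eta> * (real n * sqrt (2 * \<nu> * ld / (real m * real n)))"
  have q0: "q \<ge> 0" using \<eta> ld \<nu> by (simp add: q_def)
  have "q\<^sup>2 = \<eta>\<^sup>2 * ((real n)\<^sup>2 * (2 * \<nu> * ld / (real m * real n)))"
    using ld \<nu> by (simp add: q_def power_mult_distrib)
  also have "\<eta>\<^sup>2 = 4 * ld * real m / (9 * real n * \<nu>)" using \<eta>(2) m \<nu> n0 by (simp add: s_def a_def field_simps)
  also have "4 * ld * real m / (9 * real n * \<nu>) * ((real n)\<^sup>2 * (2 * \<nu> * ld / (real m * real n))) = 8 / 9 * ld\<^sup>2"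
    using m \<nu> n0 by (simp add: field_simps power2_eq_square)
  finally have q2: "q\<^sup>2 = 8 / 9 * ld\<^sup>2" .
  have "(5 * ld)\<^sup>2 \<le> (27 / 5 * q)\<^sup>2" unfolding power_mult_distrib q2 by (simp add: power2_eq_square)
  then have "5 * ld \<le> 27 / 5 * q" by (rule power2_le_imp_le) (use q0 in simp)
  then have down: "exp (5 * ld) \<le> exp (27 / 5 * q)" by simp
  have d0: "real d > 0" using d by simp
  have exp_ld: "exp ld = real d" using d0 by (simp add: ld_def)
  have exp_5: "exp (5 * ld) = (real d) ^ 5" using exp_of_nat_mult[of 5 ld] by (simp add: exp_ld)
  have "2 * (real d)\<^sup>2 * exp (a * (exp s - 1)) / exp (27 / 5 * q) \<le> 2 * (real d)\<^sup>2 * real d / (real d) ^ 5"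
    using up down d0 unfolding exp_5 exp_ld by (intro frac_le mult_left_mono) auto
  also have "\<dots> = (2 / real d) * (1 / real d)" using d0 by (simp add: field_simps power2_eq_square eval_nat_numeral)
  also have "\<dots> \<le> 1 * (1 / real d)" using d d0 by (intro mult_right_mono) auto
  finally have "2 * (real d)\<^sup>2 * exp (a * (exp s - 1)) / exp (27 / 5 * q) \<le> 1 / real d" by simp
  moreover have "27 / 5 * q = \<eta> * (27 / 5 * real n * sqrt (2 * \<nu> * ld / (real m * real n)))"
    by (simp add: q_def)
  ultimately show ?thesis using that[OF \<eta>(1)] by (simp only: a_def \<eta>(2) ld_def)
qed

lemma set_pmf_sample_pmf:
  assumes "s \<in> set_pmf (sample_pmf n P f X)" "i \<in> {1..n}"
  shows "fst (s i) \<in> set_pmf P" "snd (s i) \<in> {1, 2}"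
proof -
  have "s i \<in> set_pmf (observation_pmf P f X)"
    using assms unfolding sample_pmf_def by (auto simp: set_Pi_pmf PiE_dflt_def)
  then have "s i \<in> set_pmf P \<times> {1, 2}" using set_pmf_observation_pmf by blast
  then show "fst (s i) \<in> set_pmf P" "snd (s i) \<in> {1, 2}" by (auto simp: mem_Times_iff)
qed

lemma neg_log_likelihood_eq:
  assumes "\<And>i. i \<in> {1..n} \<Longrightarrow> snd (s i) \<in> {1, 2}"
  shows "neg_log_likelihood n f s X = (\<Sum>i=1..n. - ln (f (snd (s i)) (X $$ fst (s i)))) / real n"
proof -
  have "(\<Sum>j\<in>{1, 2}. of_bool (snd (s i) = j) * ln (f j (X $$ fst (s i)))) = ln (f (snd (s i)) (X $$ fst (s i)))"
    if "i \<in> {1..n}" for i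
    using assms[OF that] by auto
  then show ?thesis by (simp add: neg_log_likelihood_def sum_negf del: sum.insert)
qed

section \<open>Probability bounds and the estimation error of the model\<close>

locale completion =
  fixes m1 m2 n :: nat and \<gamma> \<mu> \<nu> H L K :: real and f :: "nat \<Rightarrow> real \<Rightarrow> real"
    and P :: "(nat \<times> nat) pmf" and Xbar :: "real mat"
  assumes m: "m1 \<ge> 1" "m2 \<ge> 1"
    and Xbar: "Xbar \<in> carrier_mat m1 m2" "sup_norm Xbar \<le> \<gamma>"
    and link: "two_link_function f" and la: "link_assumption f \<gamma> H L K"
    and P: "set_pmf P \<subseteq> {..<m1} \<times> {..<m2}"
    and \<mu>: "\<mu> > 0" and P_lower: "\<forall>k<m1. \<forall>l<m2. pmf P (k, l) \<ge> 1 / (\<mu> * real m1 * real m2)"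
    and \<nu>: "\<nu> \<ge> 1"
    and weights: "\<forall>k<m1. \<forall>l<m2. max (row_weight P m2 k) (col_weight P m1 l) \<le> \<nu> / real (min m1 m2)"
    and n: "real n \<ge> 2 * real (min m1 m2) * ln (real (m1 + m2)) / (9 * \<nu>)"
begin

abbreviation "sample \<equiv> sample_pmf n P f Xbar"

definition "reg = 6 * L * sqrt (2 * \<nu> * ln (real (m1 + m2)) / (real (min m1 m2) * real n))"

definition "score s = deriv (f (snd s)) (Xbar $$ fst s) / f (snd s) (Xbar $$ fst s)"

text \<open>The loss increment from \<open>Xbar\<close> to \<open>Xbar + D\<close> at one
  observation, whose mean is a Kullback-Leibler divergence.\<close>

definition "loss_diff D s = ln (f (snd s) (Xbar $$ fst s)) - ln (f (snd s) (Xbar $$ fst s + D $$ fst s))"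

lemma smooth: "smooth_log_concave_link f" and L_pos: "L > 0" and K_pos: "K > 0" and H_pos: "H > 0"
  using la by (auto simp: link_assumption_def)

lemma fin_P: "finite (set_pmf P)"
  using P finite_subset by blast

lemma fin_obs: "finite (set_pmf (observation_pmf P f Xbar))"
  by (rule finite_set_observation_pmf[OF fin_P])

lemma fin_sample: "finite (set_pmf sample)"
  unfolding sample_pmf_def by (rule finite_set_Pi_pmf[OF _ fin_obs]) simp

lemma n_pos: "real n > 0"
proof -
  have "ln (real (m1 + m2)) > 0" using m by simp
  then have "2 * real (min m1 m2) * ln (real (m1 + m2)) / (9 * \<nu>) > 0" using m \<nu> by simp
  then show ?thesis using n by linarith
qed

lemma reg_pos: "reg > 0"
proof -
  have "ln (real (m1 + m2)) > 0" using m by simp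
  then show ?thesis using m \<nu> n_pos L_pos by (simp add: reg_def)
qed

lemma entry_in_box: "w \<in> set_pmf P \<Longrightarrow> \<bar>Xbar $$ w\<bar> \<le> \<gamma>"
  using P abs_entry_le_sup_norm[OF Xbar(1), of "fst w" "snd w"] Xbar(2) by (cases w) fastforce

text \<open>The Chernoff bound shared by both events. The family \<open>g\<close> is normalised so
  that its one-step comparison has the candidate \<open>U\<close> itself as coefficient.\<close>

lemma deviation_prob:
  fixes g :: "'t \<Rightarrow> observation \<Rightarrow> real" and U :: "'t \<Rightarrow> real mat"
  assumes T: "finite T" "T \<noteq> {}"
    and U: "\<And>\<tau>. \<tau> \<in> T \<Longrightarrow> U \<tau> \<in> carrier_mat m1 m2" "\<And>\<tau>. \<tau> \<in> T \<Longrightarrow> nuclear_norm (U \<tau>) \<le> 1"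
    and step: "\<And>\<eta> h. \<eta> > 0 \<Longrightarrow>
      measure_pmf.expectation (observation_pmf P f Xbar) (\<lambda>s. exp (MAX \<tau>\<in>T. h \<tau> + \<eta> * g \<tau> s)) \<le>
      measure_pmf.expectation P (\<lambda>w. (exp (MAX \<tau>\<in>T. h \<tau> + \<eta> * U \<tau> $$ w) + exp (MAX \<tau>\<in>T. h \<tau> - \<eta> * U \<tau> $$ w)) / 2)"
  shows "measure_pmf.prob sample {s. \<exists>\<tau>\<in>T. (\<Sum>i=1..n. g \<tau> (s i)) > 9 / 10 * real n * reg / L} \<le> 1 / real (m1 + m2)"
proof -
  let ?d = "m1 + m2" and ?m = "min m1 m2"
  define q where "q = 27 / 5 * real n * sqrt (2 * \<nu> * ln (real ?d) / (real ?m * real n))"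
  have d2: "?d \<ge> 2" and m1: "?m \<ge> 1" using m by auto
  obtain \<eta> where \<eta>: "\<eta> > 0"
    and small: "2 * (real ?d)\<^sup>2 * exp (real n * (\<nu> / real ?m) * (exp (\<eta>\<^sup>2 / 2) - 1)) / exp (\<eta> * q) \<le> 1 / real ?d"
    using deviation_exponent[OF d2 m1 \<nu> n] unfolding q_def by blast
  have q: "9 / 10 * real n * reg / L = q" using L_pos by (simp add: q_def reg_def)
  define F where "F s = (MAX \<tau>\<in>T. 0 + (\<Sum>i\<in>{1..n}. \<eta> * g \<tau> (s i)))" for s
  have "measure_pmf.prob sample {s. \<exists>\<tau>\<in>T. (\<Sum>i=1..n. g \<tau> (s i)) > 9 / 10 * real n * reg / L} \<le>
      measure_pmf.prob sample {s. F s > \<eta> * q}"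
  proof (rule measure_pmf.finite_measure_mono)
    show "{s. \<exists>\<tau>\<in>T. (\<Sum>i=1..n. g \<tau> (s i)) > 9 / 10 * real n * reg / L} \<subseteq> {s. F s > \<eta> * q}"
    proof (intro subsetI CollectI, elim CollectE bexE)
      fix s \<tau> assume \<tau>: "\<tau> \<in> T" and gt: "9 / 10 * real n * reg / L < (\<Sum>i=1..n. g \<tau> (s i))"
      have "\<eta> * q < \<eta> * (\<Sum>i=1..n. g \<tau> (s i))" using gt \<eta> unfolding q by simp
      also have "\<dots> = 0 + (\<Sum>i\<in>{1..n}. \<eta> * g \<tau> (s i))" by (simp add: sum_distrib_left)
      also have "\<dots> \<le> F s" unfolding F_def using T \<tau> by (intro Max_ge) auto
      finally show "\<eta> * q < F s" .
    qed
  qed simp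
  also have "\<dots> \<le> measure_pmf.expectation sample (\<lambda>s. exp (F s)) / exp (\<eta> * q)"
    by (rule prob_exceeds_le[OF fin_sample])
  also have "\<dots> \<le> (2 * (real ?d)\<^sup>2 * exp (real n * (\<nu> / real ?m) * (exp (\<eta>\<^sup>2 / 2) - 1))) / exp (\<eta> * q)"
  proof (rule divide_right_mono)
    have "measure_pmf.expectation sample (\<lambda>s. exp (F s)) \<le>
        measure_pmf.expectation (Pi_pmf {1..n} undefined (\<lambda>_. P))
          (\<lambda>w. (\<Sum>B\<in>Pow {1..n}. exp (MAX \<tau>\<in>T. 0 + (\<Sum>i\<in>{1..n}. sgn_of B i * (\<eta> * U \<tau> $$ w i)))) / 2 ^ card {1..n})"
      unfolding sample_pmf_def F_def
      by (rule exp_max_comparison[where h = "\<lambda>_. 0", OF _ fin_obs fin_P step[OF \<eta>]]) simp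
    also have "\<dots> \<le> 2 * (real ?d)\<^sup>2 * exp (real (card {1..n}) * (\<nu> / real ?m) * (exp (\<eta>\<^sup>2 / 2) - 1))"
      unfolding add_0 using \<eta> by (intro expectation_exp_max_signs_le m T P weights U) auto
    finally show "measure_pmf.expectation sample (\<lambda>s. exp (F s)) \<le>
        2 * (real ?d)\<^sup>2 * exp (real n * (\<nu> / real ?m) * (exp (\<eta>\<^sup>2 / 2) - 1))" by simp
  qed simp
  finally show ?thesis using small by linarith
qed

lemma score_deviation_prob:
  fixes U :: "'t \<Rightarrow> real mat"
  assumes T: "finite T" "T \<noteq> {}"
    and U: "\<And>\<tau>. \<tau> \<in> T \<Longrightarrow> U \<tau> \<in> carrier_mat m1 m2" "\<And>\<tau>. \<tau> \<in> T \<Longrightarrow> nuclear_norm (U \<tau>) \<le> 1"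
  shows "measure_pmf.prob sample {s. \<exists>\<tau>\<in>T. (\<Sum>i=1..n. score (s i) * U \<tau> $$ fst (s i)) > 9 / 10 * real n * reg}
    \<le> 1 / real (m1 + m2)"
proof -
  have "measure_pmf.prob sample {s. \<exists>\<tau>\<in>T. (\<Sum>i=1..n. score (s i) / L * U \<tau> $$ fst (s i)) > 9 / 10 * real n * reg / L}
    \<le> 1 / real (m1 + m2)"
  proof (rule deviation_prob[OF T U])
    fix \<eta> :: real and h :: "'t \<Rightarrow> real" assume \<eta>: "\<eta> > 0"
    have "measure_pmf.expectation (observation_pmf P f Xbar) (\<lambda>s. exp (MAX \<tau>\<in>T. h \<tau> + score s * (\<eta> / L * U \<tau> $$ fst s))) \<le>
      measure_pmf.expectation P (\<lambda>w. (exp (MAX \<tau>\<in>T. h \<tau> + L * (\<eta> / L * U \<tau> $$ w)) + exp (MAX \<tau>\<in>T. h \<tau> - L * (\<eta> / L * U \<tau> $$ w))) / 2)"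
    proof (rule exp_max_score_step[where t = "\<lambda>\<tau> w. \<eta> / L * U \<tau> $$ w", OF T fin_P link L_pos])
      show "\<bar>score (w, y)\<bar> \<le> L" if "w \<in> set_pmf P" "y \<in> {1, 2}" for w y
        using score_le[OF la entry_in_box[OF that(1)] that(2)] by (simp add: score_def)
      show "f 1 (Xbar $$ w) * score (w, 1) + f 2 (Xbar $$ w) * score (w, 2) = 0" for w
        using link_derivs_add_0[OF link smooth, of "Xbar $$ w"] smooth_linkD(2)[OF smooth, of 1 "Xbar $$ w"]
          smooth_linkD(2)[OF smooth, of 2 "Xbar $$ w"]
        by (simp add: score_def)
    qed
    moreover have "score s * (\<eta> / L * U \<tau> $$ fst s) = \<eta> * (score s / L * U \<tau> $$ fst s)" for s \<tau> by simp
    moreover have "L * (\<eta> / L * U \<tau> $$ w) = \<eta> * U \<tau> $$ w" for \<tau> w using L_pos by simp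
    ultimately show "measure_pmf.expectation (observation_pmf P f Xbar) (\<lambda>s. exp (MAX \<tau>\<in>T. h \<tau> + \<eta> * (score s / L * U \<tau> $$ fst s))) \<le>
      measure_pmf.expectation P (\<lambda>w. (exp (MAX \<tau>\<in>T. h \<tau> + \<eta> * U \<tau> $$ w) + exp (MAX \<tau>\<in>T. h \<tau> - \<eta> * U \<tau> $$ w)) / 2)"
      by (simp only:)
  qed
  moreover have "(9 / 10 * real n * reg / L < (\<Sum>i=1..n. score (s i) / L * U \<tau> $$ fst (s i))) =
      (9 / 10 * real n * reg < (\<Sum>i=1..n. score (s i) * U \<tau> $$ fst (s i)))" for s \<tau>
  proof -
    have "(\<Sum>i=1..n. score (s i) / L * U \<tau> $$ fst (s i)) = (\<Sum>i=1..n. score (s i) * U \<tau> $$ fst (s i)) / L"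
      by (simp add: sum_divide_distrib)
    then show ?thesis using L_pos by (simp only: divide_less_cancel) simp
  qed
  ultimately show ?thesis by (simp only:)
qed

lemma expectation_loss_diff:
  "measure_pmf.expectation (observation_pmf P f Xbar) (loss_diff D) =
    measure_pmf.expectation P (\<lambda>w. kl_link f (Xbar $$ w) (Xbar $$ w + D $$ w))"
  unfolding expectation_observation_pmf[OF fin_P link] by (simp add: loss_diff_def kl_link_def)

lemma loss_deviation_prob:
  fixes D :: "'t \<Rightarrow> real mat"
  assumes T: "finite T" "T \<noteq> {}" and \<rho>: "\<rho> > 0"
    and D: "\<And>\<tau>. \<tau> \<in> T \<Longrightarrow> D \<tau> \<in> carrier_mat m1 m2" "\<And>\<tau>. \<tau> \<in> T \<Longrightarrow> nuclear_norm (D \<tau>) \<le> \<rho>"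
    and box: "\<And>\<tau> w. \<tau> \<in> T \<Longrightarrow> w \<in> set_pmf P \<Longrightarrow> \<bar>Xbar $$ w + D \<tau> $$ w\<bar> \<le> \<gamma>"
  shows "measure_pmf.prob sample {s. \<exists>\<tau>\<in>T.
      (\<Sum>i=1..n. measure_pmf.expectation (observation_pmf P f Xbar) (loss_diff (D \<tau>)) - loss_diff (D \<tau>) (s i))
        > 9 / 5 * real n * \<rho> * reg}
    \<le> 1 / real (m1 + m2)"
proof -
  let ?Q = "observation_pmf P f Xbar"
  let ?E = "\<lambda>\<tau>. measure_pmf.expectation ?Q (loss_diff (D \<tau>))"
  \<comment> \<open>Symmetrization and contraction produce the coefficient 2 L \<open>D\<close>;
    multiplying by \<open>c\<close> makes it \<open>D\<close> / \<rho>, of nuclear norm at most 1.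
    Undoing the scaling turns the threshold factor 9/10 into 9/5.\<close>
  define c where "c = 1 / (2 * L * \<rho>)"
  have c: "c > 0" using L_pos \<rho> by (simp add: c_def)
  define U where "U \<tau> = (1 / \<rho>) \<cdot>\<^sub>m D \<tau>" for \<tau>
  have U: "U \<tau> \<in> carrier_mat m1 m2" if "\<tau> \<in> T" for \<tau> using D(1)[OF that] by (simp add: U_def)
  have entry: "U \<tau> $$ w = D \<tau> $$ w / \<rho>" if "\<tau> \<in> T" "w \<in> set_pmf P" for \<tau> w
    using D(1)[OF that(1)] that(2) P by (cases w) (auto simp: U_def)
  have nuc: "nuclear_norm (U \<tau>) \<le> 1" if "\<tau> \<in> T" for \<tau>
  proof -
    have "nuclear_norm (U \<tau>) = 1 / \<rho> * nuclear_norm (D \<tau>)"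
      using D(1)[OF that] \<rho> by (intro nuclear_norm_scale[OF _ U[OF that]]) (auto simp: U_def)
    then show ?thesis using D(2)[OF that] \<rho> by (simp add: divide_le_eq)
  qed
  have "measure_pmf.prob sample {s. \<exists>\<tau>\<in>T. (\<Sum>i=1..n. c * (?E \<tau> - loss_diff (D \<tau>) (s i))) > 9 / 10 * real n * reg / L}
    \<le> 1 / real (m1 + m2)"
  proof (rule deviation_prob[OF T U nuc])
    fix \<eta> :: real and h :: "'t \<Rightarrow> real" assume \<eta>: "\<eta> > 0"
    define \<psi> where "\<psi> \<tau> s = \<eta> * c * loss_diff (D \<tau>) s" for \<tau> s
    have lip: "\<bar>loss_diff (D \<tau>) (w, y) - loss_diff (D \<sigma>) (w, y)\<bar> \<le> L * \<bar>D \<tau> $$ w - D \<sigma> $$ w\<bar>"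
      if "\<tau> \<in> T" "\<sigma> \<in> T" "w \<in> set_pmf P" "y \<in> {1, 2}" for \<tau> \<sigma> w y
      using ln_link_lipschitz[OF la box[OF that(2,3)] box[OF that(1,3)] that(4)]
      by (simp add: loss_diff_def abs_minus_commute)
    have zero: "\<bar>loss_diff (D \<tau>) (w, y)\<bar> \<le> L * \<bar>D \<tau> $$ w\<bar>"
      if "\<tau> \<in> T" "w \<in> set_pmf P" "y \<in> {1, 2}" for \<tau> w y
      using ln_link_lipschitz[OF la entry_in_box[OF that(2)] box[OF that(1,2)] that(3)]
      by (simp add: loss_diff_def)
    have scale: "\<bar>\<eta> * c * x\<bar> \<le> \<eta> * c * L * b" if "\<bar>x\<bar> \<le> L * b" for x b
      using mult_left_mono[OF that, of "\<eta> * c"] \<eta> c by (simp add: abs_mult mult.assoc)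
    have "measure_pmf.expectation ?Q (\<lambda>s. exp (MAX \<tau>\<in>T. h \<tau> + (measure_pmf.expectation ?Q (\<psi> \<tau>) - \<psi> \<tau> s))) \<le>
      measure_pmf.expectation P (\<lambda>w. (exp (MAX \<tau>\<in>T. h \<tau> + 2 * (\<eta> * c * L) * D \<tau> $$ w) + exp (MAX \<tau>\<in>T. h \<tau> - 2 * (\<eta> * c * L) * D \<tau> $$ w)) / 2)"
    proof (rule exp_max_lipschitz_step[where t = "\<lambda>\<tau> w. D \<tau> $$ w", OF T fin_P link])
      show "\<bar>\<psi> \<tau> (w, y)\<bar> \<le> \<eta> * c * L * \<bar>D \<tau> $$ w\<bar>"
        if "\<tau> \<in> T" "w \<in> set_pmf P" "y \<in> {1, 2}" for \<tau> w y
        unfolding \<psi>_def by (rule scale[OF zero[OF that]])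
      show "\<bar>\<psi> \<tau> (w, y) - \<psi> \<sigma> (w, y)\<bar> \<le> \<eta> * c * L * \<bar>D \<tau> $$ w - D \<sigma> $$ w\<bar>"
        if "\<tau> \<in> T" "\<sigma> \<in> T" "w \<in> set_pmf P" "y \<in> {1, 2}" for \<tau> \<sigma> w y
        unfolding \<psi>_def right_diff_distrib[symmetric] by (rule scale[OF lip[OF that]])
    qed
    also have "measure_pmf.expectation ?Q (\<lambda>s. exp (MAX \<tau>\<in>T. h \<tau> + (measure_pmf.expectation ?Q (\<psi> \<tau>) - \<psi> \<tau> s))) =
        measure_pmf.expectation ?Q (\<lambda>s. exp (MAX \<tau>\<in>T. h \<tau> + \<eta> * (c * (?E \<tau> - loss_diff (D \<tau>) s))))"
    proof -
      have "measure_pmf.expectation ?Q (\<psi> \<tau>) - \<psi> \<tau> s = \<eta> * (c * (?E \<tau> - loss_diff (D \<tau>) s))" for \<tau> s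
        by (simp add: \<psi>_def[abs_def] algebra_simps)
      then show ?thesis by (simp only:)
    qed
    also have "measure_pmf.expectation P (\<lambda>w. (exp (MAX \<tau>\<in>T. h \<tau> + 2 * (\<eta> * c * L) * D \<tau> $$ w) + exp (MAX \<tau>\<in>T. h \<tau> - 2 * (\<eta> * c * L) * D \<tau> $$ w)) / 2) =
        measure_pmf.expectation P (\<lambda>w. (exp (MAX \<tau>\<in>T. h \<tau> + \<eta> * U \<tau> $$ w) + exp (MAX \<tau>\<in>T. h \<tau> - \<eta> * U \<tau> $$ w)) / 2)"
    proof (rule expectation_cong_finite)
      fix w assume w: "w \<in> set_pmf P"
      have eq: "2 * (\<eta> * c * L) * D \<tau> $$ w = \<eta> * U \<tau> $$ w" if "\<tau> \<in> T" for \<tau>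
        using entry[OF that w] L_pos \<rho> by (simp add: c_def)
      have "(\<lambda>\<tau>. h \<tau> + 2 * (\<eta> * c * L) * D \<tau> $$ w) ` T = (\<lambda>\<tau>. h \<tau> + \<eta> * U \<tau> $$ w) ` T"
        "(\<lambda>\<tau>. h \<tau> - 2 * (\<eta> * c * L) * D \<tau> $$ w) ` T = (\<lambda>\<tau>. h \<tau> - \<eta> * U \<tau> $$ w) ` T"
        using eq by (auto intro!: image_cong)
      then show "(exp (MAX \<tau>\<in>T. h \<tau> + 2 * (\<eta> * c * L) * D \<tau> $$ w) + exp (MAX \<tau>\<in>T. h \<tau> - 2 * (\<eta> * c * L) * D \<tau> $$ w)) / 2 =
        (exp (MAX \<tau>\<in>T. h \<tau> + \<eta> * U \<tau> $$ w) + exp (MAX \<tau>\<in>T. h \<tau> - \<eta> * U \<tau> $$ w)) / 2" by (simp only:)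
    qed
    finally show "measure_pmf.expectation ?Q (\<lambda>s. exp (MAX \<tau>\<in>T. h \<tau> + \<eta> * (c * (?E \<tau> - loss_diff (D \<tau>) s)))) \<le>
      measure_pmf.expectation P (\<lambda>w. (exp (MAX \<tau>\<in>T. h \<tau> + \<eta> * U \<tau> $$ w) + exp (MAX \<tau>\<in>T. h \<tau> - \<eta> * U \<tau> $$ w)) / 2)" .
  qed
  moreover have "(9 / 10 * real n * reg / L < (\<Sum>i=1..n. c * (?E \<tau> - loss_diff (D \<tau>) (s i)))) =
      (9 / 5 * real n * \<rho> * reg < (\<Sum>i=1..n. ?E \<tau> - loss_diff (D \<tau>) (s i)))" for \<tau> s
  proof -
    have "9 / 10 * real n * reg / L = c * (9 / 5 * real n * \<rho> * reg)" using L_pos \<rho> by (simp add: c_def)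
    then show ?thesis using c by (simp only: sum_distrib_left[symmetric] mult_less_cancel_left_pos)
  qed
  ultimately show ?thesis by (simp only:)
qed

lemma expectation_kl_ge:
  assumes D: "D \<in> carrier_mat m1 m2" and box: "\<And>w. w \<in> {..<m1} \<times> {..<m2} \<Longrightarrow> \<bar>Xbar $$ w + D $$ w\<bar> \<le> \<gamma>"
  shows "K / (\<mu> * real m1 * real m2) * (\<Sum>k<m1. \<Sum>l<m2. (D $$ (k, l))\<^sup>2) \<le>
    measure_pmf.expectation P (\<lambda>w. kl_link f (Xbar $$ w) (Xbar $$ w + D $$ w))"
proof -
  have "measure_pmf.expectation P (\<lambda>w. kl_link f (Xbar $$ w) (Xbar $$ w + D $$ w)) =
      (\<Sum>w\<in>{..<m1} \<times> {..<m2}. pmf P w * kl_link f (Xbar $$ w) (Xbar $$ w + D $$ w))"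
    using P by (subst integral_measure_pmf[of "{..<m1} \<times> {..<m2}"]) auto
  also have "\<dots> \<ge> (\<Sum>w\<in>{..<m1} \<times> {..<m2}. 1 / (\<mu> * real m1 * real m2) * (K * (D $$ w)\<^sup>2))"
  proof (rule sum_mono)
    fix w assume w: "w \<in> {..<m1} \<times> {..<m2}"
    have "\<bar>Xbar $$ w\<bar> \<le> \<gamma>"
      using w abs_entry_le_sup_norm[OF Xbar(1), of "fst w" "snd w"] Xbar(2) by (cases w) fastforce
    then have "K * (Xbar $$ w - (Xbar $$ w + D $$ w))\<^sup>2 \<le> kl_link f (Xbar $$ w) (Xbar $$ w + D $$ w)"
      by (rule kl_link_ge[OF link la _ box[OF w]])
    then have kl: "K * (D $$ w)\<^sup>2 \<le> kl_link f (Xbar $$ w) (Xbar $$ w + D $$ w)" by simp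
    moreover have "1 / (\<mu> * real m1 * real m2) \<le> pmf P w" using w P_lower by (cases w) auto
    ultimately show "1 / (\<mu> * real m1 * real m2) * (K * (D $$ w)\<^sup>2) \<le>
        pmf P w * kl_link f (Xbar $$ w) (Xbar $$ w + D $$ w)"
      using K_pos by (intro mult_mono) auto
  qed
  also have "(\<Sum>w\<in>{..<m1} \<times> {..<m2}. 1 / (\<mu> * real m1 * real m2) * (K * (D $$ w)\<^sup>2)) =
      K / (\<mu> * real m1 * real m2) * (\<Sum>w\<in>{..<m1} \<times> {..<m2}. (D $$ w)\<^sup>2)"
    by (simp add: sum_distrib_left)
  also have "(\<Sum>w\<in>{..<m1} \<times> {..<m2}. (D $$ w)\<^sup>2) = (\<Sum>k<m1. \<Sum>l<m2. (D $$ (k, l))\<^sup>2)"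
    by (simp add: sum.cartesian_product split_def)
  finally show ?thesis .
qed

text \<open>The deterministic part: on the two good events, for one fixed sample, the conclusion
  follows from convexity and optimality alone.\<close>

lemma estimation_error:
  assumes s: "s \<in> set_pmf sample" and est: "is_estimator m1 m2 n f \<gamma> reg s X"
    and \<rho>: "\<rho> > 0"
    and score: "(\<Sum>i=1..n. score (s i) * (X - Xbar) $$ fst (s i)) \<le> 9 / 10 * real n * reg * nuclear_norm (X - Xbar)"
    and t: "t = (if nuclear_norm (X - Xbar) \<le> \<rho> then 1 else \<rho> / nuclear_norm (X - Xbar))"
    and loss: "(\<Sum>i=1..n. measure_pmf.expectation (observation_pmf P f Xbar) (loss_diff (t \<cdot>\<^sub>m (X - Xbar)))
        - loss_diff (t \<cdot>\<^sub>m (X - Xbar)) (s i)) \<le> 9 / 5 * real n * \<rho> * reg"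
    and \<rho>_gt: "\<rho> > 2520 * real (vec_space.rank m1 Xbar) * reg / (K / (\<mu> * real m1 * real m2))"
  shows "(frobenius_norm (Xbar - X))\<^sup>2 \<le> 14 / 5 * reg * \<rho> / (K / (\<mu> * real m1 * real m2))"
proof -
  let ?r = "real (vec_space.rank m1 Xbar)"
  define \<kappa> where "\<kappa> = K / (\<mu> * real m1 * real m2)"
  have \<kappa>: "\<kappa> > 0" using K_pos \<mu> m by (simp add: \<kappa>_def)
  have X: "X \<in> carrier_mat m1 m2" "sup_norm X \<le> \<gamma>"
    and opt: "neg_log_likelihood n f s X + reg * nuclear_norm X \<le> neg_log_likelihood n f s Xbar + reg * nuclear_norm Xbar"
    using est Xbar unfolding is_estimator_def is_arg_min_linorder by auto
  define D where "D = X - Xbar"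
  have D: "D \<in> carrier_mat m1 m2" unfolding D_def by (rule minus_carrier_mat[OF Xbar(1)])
  have D_entry: "D $$ w = X $$ w - Xbar $$ w" if "w \<in> {..<m1} \<times> {..<m2}" for w
    using that X Xbar by (cases w) (auto simp: D_def)
  let ?N = "nuclear_norm D"
  define F where "F = frobenius_norm D"
  have F0: "F \<ge> 0" by (simp add: F_def frobenius_norm_def sum_nonneg)
  have F2: "F\<^sup>2 = (\<Sum>k<m1. \<Sum>l<m2. (D $$ (k, l))\<^sup>2)"
    using D by (auto simp: F_def frobenius_norm_def sum_nonneg)
  have N0: "?N \<ge> 0" by (rule nuclear_norm_nonneg[OF D])
  have t01: "0 \<le> t" "t \<le> 1" using N0 \<rho> unfolding t D_def[symmetric] by (auto simp: divide_le_eq)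
  have tN: "t * ?N \<le> \<rho>" using N0 \<rho> unfolding t D_def[symmetric] by auto
  have pos: "fst (s i) \<in> {..<m1} \<times> {..<m2}" and lab: "snd (s i) \<in> {1, 2}" if "i \<in> {1..n}" for i
    using set_pmf_sample_pmf[OF s that] P by auto
  \<comment> \<open>The argument is a function of the position, so that the shrunk point
    \<open>X'\<close> can be given entrywise.\<close>
  define \<Phi> where "\<Phi> Y = (\<Sum>i=1..n. - ln (f (snd (s i)) (Y (fst (s i))))) / real n" for Y
  have nll: "neg_log_likelihood n f s Y = \<Phi> (($$) Y)" for Y
    unfolding \<Phi>_def by (rule neg_log_likelihood_eq) (rule lab)
  have "\<Phi> (($$) X) - \<Phi> (($$) Xbar) \<ge> - (9 / 10 * reg * ?N)"
  proof -
    have "- (\<Sum>i=1..n. score (s i) * D $$ fst (s i)) \<le>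
        (\<Sum>i=1..n. - ln (f (snd (s i)) (X $$ fst (s i))) - - ln (f (snd (s i)) (Xbar $$ fst (s i))))"
      unfolding sum_negf[symmetric]
    proof (rule sum_mono)
      fix i assume i: "i \<in> {1..n}"
      show "- (score (s i) * D $$ fst (s i)) \<le> - ln (f (snd (s i)) (X $$ fst (s i))) - - ln (f (snd (s i)) (Xbar $$ fst (s i)))"
        using neg_ln_link_above_tangent[OF smooth lab[OF i], of "Xbar $$ fst (s i)" "X $$ fst (s i)"]
        by (simp add: score_def D_entry[OF pos[OF i]])
    qed
    then have "- (9 / 10 * real n * reg * ?N) \<le> real n * (\<Phi> (($$) X) - \<Phi> (($$) Xbar))"
      using score n_pos by (simp add: \<Phi>_def D_def sum_subtractf sum_negf right_diff_distrib)
    then have "real n * (- (9 / 10 * reg * ?N)) \<le> real n * (\<Phi> (($$) X) - \<Phi> (($$) Xbar))" by (simp add: mult_ac)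
    then show ?thesis using n_pos by (simp only: mult_le_cancel_left_pos)
  qed
  moreover have gap: "\<Phi> (($$) X) - \<Phi> (($$) Xbar) \<le> reg * (nuclear_norm Xbar - nuclear_norm X)"
    using opt unfolding nll by (simp add: right_diff_distrib)
  ultimately have "reg * (nuclear_norm X - nuclear_norm Xbar) \<le> reg * (9 / 10 * ?N)"
    by (simp add: algebra_simps)
  then have "nuclear_norm X - nuclear_norm Xbar \<le> 9 / 10 * ?N" using reg_pos by (simp only: mult_le_cancel_left_pos)
  moreover have "nuclear_norm X \<ge> nuclear_norm Xbar + ?N - 3 * sqrt ?r * F"
    using nuclear_norm_perturbation[OF X(1) Xbar(1)] by (simp add: D_def F_def)
  \<comment> \<open>Moving 9/10 of the nuclear norm to the other side leaves one tenth of it below 3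
    sqrt r F.\<close>
  ultimately have cone: "?N \<le> 30 * sqrt ?r * F" by simp
  have "nuclear_norm Xbar \<le> nuclear_norm X + ?N"
    unfolding D_def by (rule nuclear_norm_le_add_diff[OF Xbar(1) X(1)])
  then have "reg * (nuclear_norm Xbar - nuclear_norm X) \<le> reg * ?N" using reg_pos by (intro mult_left_mono) auto
  with gap have gap': "\<Phi> (($$) X) - \<Phi> (($$) Xbar) \<le> reg * ?N" by linarith
  define X' where "X' w = Xbar $$ w + (t \<cdot>\<^sub>m D) $$ w" for w
  have tD_entry: "(t \<cdot>\<^sub>m D) $$ w = t * D $$ w" if "w \<in> {..<m1} \<times> {..<m2}" for w
    using that D by (cases w) auto
  have X'_entry: "X' w = (1 - t) * Xbar $$ w + t * X $$ w" if "w \<in> {..<m1} \<times> {..<m2}" for w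
    using that by (simp add: X'_def tD_entry D_entry algebra_simps)
  have box: "\<bar>Xbar $$ w + (t \<cdot>\<^sub>m D) $$ w\<bar> \<le> \<gamma>" if w: "w \<in> {..<m1} \<times> {..<m2}" for w
  proof -
    have "\<bar>Xbar $$ w\<bar> \<le> \<gamma>" "\<bar>X $$ w\<bar> \<le> \<gamma>"
      using w abs_entry_le_sup_norm[OF Xbar(1), of "fst w" "snd w"] Xbar(2)
        abs_entry_le_sup_norm[OF X(1), of "fst w" "snd w"] X(2) by (cases w; fastforce)+
    then have "(1 - t) * \<bar>Xbar $$ w\<bar> + t * \<bar>X $$ w\<bar> \<le> (1 - t) * \<gamma> + t * \<gamma>"
      using t01 by (intro add_mono mult_left_mono) auto
    moreover have "\<bar>X' w\<bar> \<le> (1 - t) * \<bar>Xbar $$ w\<bar> + t * \<bar>X $$ w\<bar>"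
      unfolding X'_entry[OF w] using abs_triangle_ineq[of "(1 - t) * Xbar $$ w" "t * X $$ w"] t01
      by (simp add: abs_mult)
    ultimately show ?thesis unfolding X'_def by (simp add: algebra_simps)
  qed
  have conv: "\<Phi> X' - \<Phi> (($$) Xbar) \<le> t * (\<Phi> (($$) X) - \<Phi> (($$) Xbar))"
  proof -
    have "(\<Sum>i=1..n. - ln (f (snd (s i)) (X' (fst (s i))))) \<le>
        (\<Sum>i=1..n. (1 - t) * (- ln (f (snd (s i)) (Xbar $$ fst (s i)))) + t * (- ln (f (snd (s i)) (X $$ fst (s i)))))"
    proof (rule sum_mono)
      fix i assume i: "i \<in> {1..n}"
      show "- ln (f (snd (s i)) (X' (fst (s i)))) \<le>
        (1 - t) * (- ln (f (snd (s i)) (Xbar $$ fst (s i)))) + t * (- ln (f (snd (s i)) (X $$ fst (s i))))"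
        using convex_onD[OF smooth_linkD(3)[OF smooth lab[OF i]] t01, of "Xbar $$ fst (s i)" "X $$ fst (s i)"]
        unfolding X'_entry[OF pos[OF i]] by simp
    qed
    also have "\<dots> = (1 - t) * (real n * \<Phi> (($$) Xbar)) + t * (real n * \<Phi> (($$) X))"
    proof -
      have "real n * \<Phi> Y = (\<Sum>i=1..n. - ln (f (snd (s i)) (Y (fst (s i)))))" for Y
        using n_pos by (simp add: \<Phi>_def)
      then show ?thesis by (simp only: sum.distrib sum_distrib_left)
    qed
    finally have "real n * \<Phi> X' \<le> real n * ((1 - t) * \<Phi> (($$) Xbar) + t * \<Phi> (($$) X))"
      using n_pos by (simp add: \<Phi>_def[of X'] algebra_simps)
    then have "\<Phi> X' \<le> (1 - t) * \<Phi> (($$) Xbar) + t * \<Phi> (($$) X)" using n_pos by (simp only: mult_le_cancel_left_pos)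
    then show ?thesis by (simp add: algebra_simps)
  qed
  \<comment> \<open>After shrinking, the loss increment is bounded by the deterministic quantity
    \<open>reg * \<rho>\<close>, since t times the nuclear norm is at most \<rho>.\<close>
  have "t * (\<Phi> (($$) X) - \<Phi> (($$) Xbar)) \<le> t * (reg * ?N)" using gap' t01 by (intro mult_left_mono)
  also have "\<dots> \<le> reg * \<rho>" using mult_left_mono[OF tN, of reg] reg_pos by (simp add: mult_ac)
  finally have gap'': "\<Phi> X' - \<Phi> (($$) Xbar) \<le> reg * \<rho>" using conv by linarith
  let ?E = "measure_pmf.expectation (observation_pmf P f Xbar) (loss_diff (t \<cdot>\<^sub>m D))"
  have "(\<Sum>i=1..n. loss_diff (t \<cdot>\<^sub>m D) (s i)) = real n * (\<Phi> X' - \<Phi> (($$) Xbar))"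
    using n_pos by (simp add: \<Phi>_def loss_diff_def X'_def sum_subtractf sum_negf right_diff_distrib)
  moreover have "real n * ?E - (\<Sum>i=1..n. loss_diff (t \<cdot>\<^sub>m D) (s i)) \<le> 9 / 5 * real n * \<rho> * reg"
    using loss unfolding D_def[symmetric] by (simp add: sum_subtractf)
  ultimately have "real n * (?E - (\<Phi> X' - \<Phi> (($$) Xbar))) \<le> real n * (9 / 5 * \<rho> * reg)"
    by (simp add: algebra_simps)
  then have "?E - (\<Phi> X' - \<Phi> (($$) Xbar)) \<le> 9 / 5 * \<rho> * reg" using n_pos by (simp only: mult_le_cancel_left_pos)
  then have E_le: "?E \<le> 14 / 5 * reg * \<rho>" using gap'' by (simp add: algebra_simps)
  have tD: "t \<cdot>\<^sub>m D \<in> carrier_mat m1 m2" using D by simp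
  have "\<kappa> * (\<Sum>k<m1. \<Sum>l<m2. ((t \<cdot>\<^sub>m D) $$ (k, l))\<^sup>2) \<le> ?E"
    unfolding expectation_loss_diff \<kappa>_def by (rule expectation_kl_ge[OF tD box])
  also have "(\<Sum>k<m1. \<Sum>l<m2. ((t \<cdot>\<^sub>m D) $$ (k, l))\<^sup>2) = (t * F)\<^sup>2"
    unfolding power_mult_distrib F2 sum_distrib_left
    by (intro sum.cong refl) (simp add: tD_entry power_mult_distrib)
  finally have quad: "\<kappa> * (t * F)\<^sup>2 \<le> 14 / 5 * reg * \<rho>" using E_le by linarith
  \<comment> \<open>Otherwise t times the nuclear norm is exactly \<rho>. The cone condition squared
    gives the factor 900 and the quadratic bound 14/5, so \<rho> would be at most the threshold in
    \<open>\<rho>_gt\<close>.\<close>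
  have "?N \<le> \<rho>"
  proof (rule ccontr)
    assume "\<not> ?N \<le> \<rho>"
    then have "\<rho> = t * ?N" using \<rho> unfolding t D_def[symmetric] by auto
    also have "\<dots> \<le> t * (30 * sqrt ?r * F)" using cone t01 by (intro mult_left_mono)
    finally have "\<rho>\<^sup>2 \<le> (30 * sqrt ?r * (t * F))\<^sup>2" using \<rho> by (intro power_mono) (auto simp: mult_ac)
    also have "\<dots> = 900 * ?r * (t * F)\<^sup>2" by (simp add: power_mult_distrib)
    finally have "\<kappa> * \<rho>\<^sup>2 \<le> 900 * ?r * (\<kappa> * (t * F)\<^sup>2)"
      using \<kappa> mult_left_mono[of "\<rho>\<^sup>2" "900 * ?r * (t * F)\<^sup>2" \<kappa>] by (simp add: mult_ac)
    also have "\<dots> \<le> 900 * ?r * (14 / 5 * reg * \<rho>)" using quad by (intro mult_left_mono) auto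
    finally have "(\<kappa> * \<rho>) * \<rho> \<le> (2520 * ?r * reg) * \<rho>" by (simp add: power2_eq_square mult_ac)
    then have "\<kappa> * \<rho> \<le> 2520 * ?r * reg" using \<rho> by (simp only: mult_le_cancel_right_pos)
    then show False using \<rho>_gt \<kappa> unfolding \<kappa>_def[symmetric] by (simp add: divide_less_eq mult.commute)
  qed
  then have "t = 1" unfolding t D_def[symmetric] by simp
  then have "\<kappa> * F\<^sup>2 \<le> 14 / 5 * reg * \<rho>" using quad by (simp only: mult_1)
  then have "F\<^sup>2 \<le> 14 / 5 * reg * \<rho> / \<kappa>" by (simp only: pos_le_divide_eq[OF \<kappa>] mult.commute)
  moreover have "(frobenius_norm (Xbar - X))\<^sup>2 = F\<^sup>2"
    unfolding frobenius_norm_diff_sq[OF Xbar(1) X(1)] F2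
    by (intro sum.cong refl) (simp add: D_entry power2_commute)
  ultimately show ?thesis by (simp add: \<kappa>_def)
qed

text \<open>The candidates are indexed by the possible samples \<tau>. An event uniform in \<tau>
  may be specialised to \<tau> = s, which handles the dependence of the estimator on the
  data.\<close>

lemma estimation_error_prob:
  assumes est: "\<forall>s\<in>set_pmf sample. is_estimator m1 m2 n f \<gamma> reg s (Xhat s)" and \<rho>: "\<rho> > 0"
    and \<rho>_gt: "\<rho> > 2520 * real (vec_space.rank m1 Xbar) * reg / (K / (\<mu> * real m1 * real m2))"
  shows "measure_pmf.prob sample {s. (frobenius_norm (Xbar - Xhat s))\<^sup>2 \<le> 14 / 5 * reg * \<rho> / (K / (\<mu> * real m1 * real m2))}
    \<ge> 1 - 2 / real (m1 + m2)"
proof -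
  define T where "T = set_pmf sample"
  have T: "finite T" "T \<noteq> {}" using fin_sample by (auto simp: T_def set_pmf_not_empty)
  define D where "D s = Xhat s - Xbar" for s
  have X: "Xhat s \<in> carrier_mat m1 m2" "sup_norm (Xhat s) \<le> \<gamma>" if "s \<in> T" for s
    using est that unfolding T_def is_estimator_def is_arg_min_linorder by auto
  have D: "D s \<in> carrier_mat m1 m2" for s unfolding D_def by (rule minus_carrier_mat[OF Xbar(1)])
  have N0: "nuclear_norm (D s) \<ge> 0" for s by (rule nuclear_norm_nonneg[OF D])
  define t where "t s = (if nuclear_norm (D s) \<le> \<rho> then 1 else \<rho> / nuclear_norm (D s))" for s
  have t01: "0 \<le> t s" "t s \<le> 1" for s using N0[of s] \<rho> by (auto simp: t_def divide_le_eq)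
  \<comment> \<open>Division by zero gives 0, so a difference of nuclear norm 0 yields the zero
    matrix here.\<close>
  define U where "U s = (1 / nuclear_norm (D s)) \<cdot>\<^sub>m D s" for s
  have U: "U s \<in> carrier_mat m1 m2" "nuclear_norm (U s) \<le> 1" for s
  proof -
    show *: "U s \<in> carrier_mat m1 m2" using D by (simp add: U_def)
    have "nuclear_norm (U s) = 1 / nuclear_norm (D s) * nuclear_norm (D s)"
      using D[of s] N0[of s] by (intro nuclear_norm_scale[OF _ *]) (auto simp: U_def)
    then show "nuclear_norm (U s) \<le> 1" by simp
  qed
  have tD: "t s \<cdot>\<^sub>m D s \<in> carrier_mat m1 m2" "nuclear_norm (t s \<cdot>\<^sub>m D s) \<le> \<rho>" for s
  proof -
    show *: "t s \<cdot>\<^sub>m D s \<in> carrier_mat m1 m2" using D by simp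
    have "nuclear_norm (t s \<cdot>\<^sub>m D s) = t s * nuclear_norm (D s)"
      using D[of s] t01[of s] by (intro nuclear_norm_scale[OF _ *]) auto
    then show "nuclear_norm (t s \<cdot>\<^sub>m D s) \<le> \<rho>" using \<rho> by (auto simp: t_def)
  qed
  have box: "\<bar>Xbar $$ w + (t s \<cdot>\<^sub>m D s) $$ w\<bar> \<le> \<gamma>" if s: "s \<in> T" and w: "w \<in> set_pmf P" for s w
  proof -
    obtain k l where kl: "w = (k, l)" "k < m1" "l < m2" using w P by (cases w) auto
    have b: "\<bar>Xbar $$ w\<bar> \<le> \<gamma>" "\<bar>Xhat s $$ w\<bar> \<le> \<gamma>"
      using abs_entry_le_sup_norm[OF Xbar(1) kl(2,3)] abs_entry_le_sup_norm[OF X(1)[OF s] kl(2,3)] Xbar(2) X(2)[OF s]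
      by (auto simp: kl)
    have "Xbar $$ w + (t s \<cdot>\<^sub>m D s) $$ w = (1 - t s) * Xbar $$ w + t s * Xhat s $$ w"
      using kl X(1)[OF s] Xbar(1) by (simp add: D_def algebra_simps)
    also have "\<bar>\<dots>\<bar> \<le> (1 - t s) * \<bar>Xbar $$ w\<bar> + t s * \<bar>Xhat s $$ w\<bar>"
      using abs_triangle_ineq[of "(1 - t s) * Xbar $$ w" "t s * Xhat s $$ w"] t01[of s]
      by (simp add: abs_mult)
    also have "\<dots> \<le> (1 - t s) * \<gamma> + t s * \<gamma>" using b t01[of s] by (intro add_mono mult_left_mono) auto
    finally show ?thesis by (simp add: algebra_simps)
  qed
  define bad1 where "bad1 = {s. \<exists>\<tau>\<in>T. (\<Sum>i=1..n. score (s i) * U \<tau> $$ fst (s i)) > 9 / 10 * real n * reg}"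
  define bad2 where "bad2 = {s. \<exists>\<tau>\<in>T. (\<Sum>i=1..n. measure_pmf.expectation (observation_pmf P f Xbar) (loss_diff (t \<tau> \<cdot>\<^sub>m D \<tau>))
      - loss_diff (t \<tau> \<cdot>\<^sub>m D \<tau>) (s i)) > 9 / 5 * real n * \<rho> * reg}"
  have p1: "measure_pmf.prob sample bad1 \<le> 1 / real (m1 + m2)"
    unfolding bad1_def by (rule score_deviation_prob[OF T U])
  have p2: "measure_pmf.prob sample bad2 \<le> 1 / real (m1 + m2)"
    unfolding bad2_def by (rule loss_deviation_prob[OF T \<rho> tD box])
  define G where "G = {s. (frobenius_norm (Xbar - Xhat s))\<^sup>2 \<le> 14 / 5 * reg * \<rho> / (K / (\<mu> * real m1 * real m2))}"
  have good: "s \<in> G" if s: "s \<in> T" and nb: "s \<notin> bad1" "s \<notin> bad2" for s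
    unfolding G_def
  proof (rule CollectI, rule estimation_error[OF _ _ \<rho> _ _ _ \<rho>_gt])
    show "s \<in> set_pmf sample" using s by (simp add: T_def)
    show "is_estimator m1 m2 n f \<gamma> reg s (Xhat s)" using est s by (simp add: T_def)
    show "t s = (if nuclear_norm (Xhat s - Xbar) \<le> \<rho> then 1 else \<rho> / nuclear_norm (Xhat s - Xbar))"
      by (simp add: t_def D_def)
    show "(\<Sum>i=1..n. measure_pmf.expectation (observation_pmf P f Xbar) (loss_diff (t s \<cdot>\<^sub>m (Xhat s - Xbar)))
        - loss_diff (t s \<cdot>\<^sub>m (Xhat s - Xbar)) (s i)) \<le> 9 / 5 * real n * \<rho> * reg"
      using nb(2) s unfolding bad2_def D_def by (auto simp: not_less)
    have le: "(\<Sum>i=1..n. score (s i) * U s $$ fst (s i)) \<le> 9 / 10 * real n * reg"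
      using nb(1) s unfolding bad1_def by (auto simp: not_less)
    have entry: "D s $$ w = nuclear_norm (D s) * U s $$ w" if w: "w \<in> {..<m1} \<times> {..<m2}" for w
    proof (cases "nuclear_norm (D s) = 0")
      case False
      then show ?thesis using that D[of s] by (cases w) (auto simp: U_def)
    next
      case True
      \<comment> \<open>Nuclear norm 0 forces a zero matrix: the Frobenius norm bounds the operator
        norm, so duality bounds the squared Frobenius norm by a multiple of the nuclear
        norm.\<close>
      have "minner m1 m2 (entries (D s)) (entries (D s)) \<le> 
          sqrt (minner m1 m2 (entries (D s)) (entries (D s))) * nuclear_norm (D s)"
      proof (rule minner_le_nuclear_norm_times[OF D])
        fix x
        have "ip m1 (mv m2 (entries (D s)) x) (mv m2 (entries (D s)) x) =
            (\<Sum>k<m1. (\<Sum>l<m2. D s $$ (k, l) * x l)\<^sup>2)" by (simp add: ip_def mv_def power2_eq_square)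
        also have "\<dots> \<le> (\<Sum>k<m1. (\<Sum>l<m2. (D s $$ (k, l))\<^sup>2) * (\<Sum>l<m2. (x l)\<^sup>2))"
          by (intro sum_mono Cauchy_Schwarz_ineq_sum)
        also have "\<dots> = (sqrt (minner m1 m2 (entries (D s)) (entries (D s))))\<^sup>2 * ip m2 x x"
          by (simp add: minner_self_nonneg sum_distrib_right[symmetric]) (simp add: minner_def ip_def power2_eq_square)
        finally show "ip m1 (mv m2 (entries (D s)) x) (mv m2 (entries (D s)) x) \<le>
          (sqrt (minner m1 m2 (entries (D s)) (entries (D s))))\<^sup>2 * ip m2 x x" .
      qed (simp add: minner_self_nonneg)
      then have "(\<Sum>p\<in>{..<m1} \<times> {..<m2}. D s $$ p * D s $$ p) \<le> 0"
        using True by (simp add: minner_def sum.cartesian_product split_def)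
      then have "(\<Sum>p\<in>{..<m1} \<times> {..<m2}. D s $$ p * D s $$ p) = 0" by (intro antisym sum_nonneg) auto
      then have "D s $$ w = 0" using that by (subst (asm) sum_nonneg_eq_0_iff) auto
      then show ?thesis using True by simp
    qed
    have "(\<Sum>i=1..n. score (s i) * D s $$ fst (s i)) = nuclear_norm (D s) * (\<Sum>i=1..n. score (s i) * U s $$ fst (s i))"
      unfolding sum_distrib_left
    proof (intro sum.cong refl)
      fix i assume i: "i \<in> {1..n}"
      have "fst (s i) \<in> {..<m1} \<times> {..<m2}" using set_pmf_sample_pmf(1)[OF s[unfolded T_def] i] P by blast
      then show "score (s i) * D s $$ fst (s i) = nuclear_norm (D s) * (score (s i) * U s $$ fst (s i))"
        using entry by simp
    qed
    also have "\<dots> \<le> nuclear_norm (D s) * (9 / 10 * real n * reg)" by (rule mult_left_mono[OF le N0])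
    finally show "(\<Sum>i=1..n. score (s i) * (Xhat s - Xbar) $$ fst (s i)) \<le> 9 / 10 * real n * reg * nuclear_norm (Xhat s - Xbar)"
      unfolding D_def by (simp add: mult_ac)
  qed
  have "1 - measure_pmf.prob sample G = measure_pmf.prob sample (- G)"
    using measure_pmf.prob_compl[of G sample] by (simp add: Compl_eq_Diff_UNIV)
  also have "\<dots> \<le> measure_pmf.prob sample (bad1 \<union> bad2)"
    using good by (intro measure_pmf.finite_measure_mono_AE) (auto simp: AE_measure_pmf_iff T_def)
  also have "\<dots> \<le> measure_pmf.prob sample bad1 + measure_pmf.prob sample bad2"
    by (rule measure_Un_le) auto
  also have "\<dots> \<le> 2 / real (m1 + m2)" using p1 p2 by (simp add: add_divide_distrib[symmetric])
  finally show ?thesis by (simp add: G_def)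
qed

lemma estimation_error_bound:
  assumes est: "\<forall>s\<in>set_pmf sample. is_estimator m1 m2 n f \<gamma> reg s (Xhat s)"
  shows "measure_pmf.prob sample
         {s. (frobenius_norm (Xbar - Xhat s))\<^sup>2 / (real m1 * real m2) \<le>
             \<mu> * max (1016064 * \<mu> * \<nu> * (L\<^sup>2 * real (vec_space.rank m1 Xbar) / K\<^sup>2) * (real (max m1 m2) * ln (real (m1 + m2)) / real n))
                      (exp 1 * H / K * sqrt (ln (real (m1 + m2)) / real n))}
         \<ge> 1 - 2 / real (m1 + m2)"
proof -
  let ?d = "m1 + m2" and ?r = "real (vec_space.rank m1 Xbar)"
  define \<kappa> where "\<kappa> = K / (\<mu> * real m1 * real m2)"
  have \<kappa>: "\<kappa> > 0" using K_pos \<mu> m by (simp add: \<kappa>_def)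
  define fast where "fast = 1016064 * \<mu> * \<nu> * (L\<^sup>2 * ?r / K\<^sup>2) * (real (max m1 m2) * ln (real ?d) / real n)"
  define slow where "slow = exp 1 * H / K * sqrt (ln (real ?d) / real n)"
  have ld: "ln (real ?d) > 0" using m by simp
  have slow: "slow > 0" using H_pos K_pos ld n_pos by (simp add: slow_def)
  have mm: "real m1 * real m2 > 0" using m by simp
  \<comment> \<open>For rank 0 the threshold is 0, and \<rho> is solved from equality with the slow
    term. Otherwise twice the threshold makes the required inequality strict.\<close>
  define \<rho> where "\<rho> = (if vec_space.rank m1 Xbar = 0 then 5 / 14 * \<kappa> * (real m1 * real m2) * \<mu> * slow / reg
    else 2 * (2520 * ?r * reg / \<kappa>))"
  have \<rho>: "\<rho> > 0" using slow \<kappa> m \<mu> reg_pos by (simp add: \<rho>_def)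
  have \<rho>_gt: "\<rho> > 2520 * ?r * reg / \<kappa>"
  proof (cases "vec_space.rank m1 Xbar = 0")
    case True
    then show ?thesis using \<rho> by simp
  next
    case False
    then have "2520 * ?r * reg / \<kappa> > 0" using \<kappa> reg_pos by simp
    moreover have "x < 2 * x" if "x > 0" for x :: real using that by simp
    ultimately have "2520 * ?r * reg / \<kappa> < 2 * (2520 * ?r * reg / \<kappa>)" by blast
    then show ?thesis using False by (simp only: \<rho>_def if_False)
  qed
  have err_le: "14 / 5 * reg * \<rho> / \<kappa> \<le> real m1 * real m2 * (\<mu> * max fast slow)"
  proof (cases "vec_space.rank m1 Xbar = 0")
    case True
    then have "14 / 5 * reg * \<rho> / \<kappa> = real m1 * real m2 * (\<mu> * slow)"
      using \<kappa> reg_pos by (simp add: \<rho>_def)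
    also have "\<dots> \<le> real m1 * real m2 * (\<mu> * max fast slow)" using \<mu> by (intro mult_left_mono) auto
    finally show ?thesis .
  next
    case False
    have reg2: "reg\<^sup>2 = 72 * L\<^sup>2 * \<nu> * ln (real ?d) / (real (min m1 m2) * real n)"
      using ld \<nu> by (simp add: reg_def power_mult_distrib)
    \<comment> \<open>One factor m1 m2 stays outside; in the other the minimum cancels against
      \<open>reg\<^sup>2\<close> and leaves the maximum.\<close>
    have prod: "real m1 * real m2 = real (min m1 m2) * real (max m1 m2)" by (simp add: min_def max_def)
    have min0: "real (min m1 m2) > 0" using m by simp
    have "14 / 5 * reg * \<rho> / \<kappa> = 14112 * ?r * reg\<^sup>2 / \<kappa>\<^sup>2"
      using False by (simp add: \<rho>_def power2_eq_square)
    also have "\<dots> = 14112 * ?r * reg\<^sup>2 * (\<mu>\<^sup>2 * (real m1 * real m2)\<^sup>2 / K\<^sup>2)"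
      using K_pos by (simp add: \<kappa>_def power_divide power_mult_distrib)
    also have "\<dots> = real m1 * real m2 * (\<mu> * fast)"
      unfolding reg2 fast_def prod using min0 n_pos K_pos by (simp add: field_simps power2_eq_square)
    also have "\<dots> \<le> real m1 * real m2 * (\<mu> * max fast slow)" using \<mu> by (intro mult_left_mono) auto
    finally show ?thesis .
  qed
  have "1 - 2 / real ?d \<le> measure_pmf.prob sample {s. (frobenius_norm (Xbar - Xhat s))\<^sup>2 \<le> 14 / 5 * reg * \<rho> / \<kappa>}"
    using estimation_error_prob[OF est \<rho>] \<rho>_gt unfolding \<kappa>_def by blast
  also have "\<dots> \<le> measure_pmf.prob sample {s. (frobenius_norm (Xbar - Xhat s))\<^sup>2 / (real m1 * real m2) \<le> \<mu> * max fast slow}"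
  proof (rule measure_pmf.finite_measure_mono)
    show "{s. (frobenius_norm (Xbar - Xhat s))\<^sup>2 \<le> 14 / 5 * reg * \<rho> / \<kappa>} \<subseteq>
        {s. (frobenius_norm (Xbar - Xhat s))\<^sup>2 / (real m1 * real m2) \<le> \<mu> * max fast slow}"
    proof (intro subsetI CollectI, elim CollectE)
      fix s assume "(frobenius_norm (Xbar - Xhat s))\<^sup>2 \<le> 14 / 5 * reg * \<rho> / \<kappa>"
      then have "(frobenius_norm (Xbar - Xhat s))\<^sup>2 \<le> real m1 * real m2 * (\<mu> * max fast slow)" using err_le by linarith
      then show "(frobenius_norm (Xbar - Xhat s))\<^sup>2 / (real m1 * real m2) \<le> \<mu> * max fast slow"
        using mm by (simp add: divide_le_eq mult.commute)
    qed
  qed simp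
  finally show ?thesis unfolding fast_def slow_def .
qed

end

theorem corollary2:
  shows "\<exists>c::real. c > 0 \<and>
    (\<forall>(m1::nat) (m2::nat) (n::nat) (\<gamma>::real) (\<mu>::real) (\<nu>::real) (H::real) (L::real) (K::real)
       (f :: nat \<Rightarrow> real \<Rightarrow> real) (P :: (nat \<times> nat) pmf) (Xbar :: real mat)
       (Xhat :: (nat \<Rightarrow> observation) \<Rightarrow> real mat) (d::nat) (M::nat) (m::nat) (reg::real).
       1 \<le> m1 \<and> 1 \<le> m2 \<and> d = m1 + m2 \<and> M = max m1 m2 \<and> m = min m1 m2 \<and>
       0 < \<gamma> \<and> Xbar \<in> carrier_mat m1 m2 \<and> sup_norm Xbar \<le> \<gamma> \<and>
       two_link_function f \<and> link_assumption f \<gamma> H L K \<and>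
       set_pmf P \<subseteq> {..<m1} \<times> {..<m2} \<and>
       0 < \<mu> \<and> (\<forall>k<m1. \<forall>l<m2. pmf P (k, l) \<ge> 1 / (\<mu> * real m1 * real m2)) \<and>
       1 \<le> \<nu> \<and> (\<forall>k<m1. \<forall>l<m2. max (row_weight P m2 k) (col_weight P m1 l) \<le> \<nu> / real m) \<and>
       real n \<ge> 2 * real m * ln (real d) / (9 * \<nu>) \<and>
       reg = 6 * L * sqrt (2 * \<nu> * ln (real d) / (real m * real n)) \<and>
       (\<forall>s \<in> set_pmf (sample_pmf n P f Xbar). is_estimator m1 m2 n f \<gamma> reg s (Xhat s))
       \<longrightarrow>
       measure_pmf.prob (sample_pmf n P f Xbar)
         {s. (frobenius_norm (Xbar - Xhat s))\<^sup>2 / (real m1 * real m2) \<le>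
             \<mu> * max (c * \<mu> * \<nu> * (L\<^sup>2 * real (vec_space.rank m1 Xbar) / K\<^sup>2) * (real M * ln (real d) / real n))
                      (exp 1 * H / K * sqrt (ln (real d) / real n))}
         \<ge> 1 - 3 / real d)"
proof (intro exI[of _ 1016064] conjI allI impI)
  show "(0 :: real) < 1016064" by simp
next
  fix m1 m2 n :: nat and \<gamma> \<mu> \<nu> H L K :: real and f :: "nat \<Rightarrow> real \<Rightarrow> real" and P :: "(nat \<times> nat) pmf"
    and Xbar :: "real mat" and Xhat :: "(nat \<Rightarrow> observation) \<Rightarrow> real mat" and d M m :: nat and lam :: real
  assume *: "1 \<le> m1 \<and> 1 \<le> m2 \<and> d = m1 + m2 \<and> M = max m1 m2 \<and> m = min m1 m2 \<and>
       0 < \<gamma> \<and> Xbar \<in> carrier_mat m1 m2 \<and> sup_norm Xbar \<le> \<gamma> \<and>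
       two_link_function f \<and> link_assumption f \<gamma> H L K \<and>
       set_pmf P \<subseteq> {..<m1} \<times> {..<m2} \<and>
       0 < \<mu> \<and> (\<forall>k<m1. \<forall>l<m2. pmf P (k, l) \<ge> 1 / (\<mu> * real m1 * real m2)) \<and>
       1 \<le> \<nu> \<and> (\<forall>k<m1. \<forall>l<m2. max (row_weight P m2 k) (col_weight P m1 l) \<le> \<nu> / real m) \<and>
       real n \<ge> 2 * real m * ln (real d) / (9 * \<nu>) \<and>
       lam = 6 * L * sqrt (2 * \<nu> * ln (real d) / (real m * real n)) \<and>
       (\<forall>s \<in> set_pmf (sample_pmf n P f Xbar). is_estimator m1 m2 n f \<gamma> lam s (Xhat s))"
  then have dims: "d = m1 + m2" "M = max m1 m2" "m = min m1 m2" by blast+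
  interpret completion m1 m2 n \<gamma> \<mu> \<nu> H L K f P Xbar
    by unfold_locales (use * in blast)+
  have lam: "lam = reg" unfolding reg_def using * dims by blast
  have "1 - 3 / real d \<le> 1 - 2 / real (m1 + m2)" unfolding dims by (intro diff_left_mono divide_right_mono) auto
  also have "\<dots> \<le> measure_pmf.prob (sample_pmf n P f Xbar)
         {s. (frobenius_norm (Xbar - Xhat s))\<^sup>2 / (real m1 * real m2) \<le>
             \<mu> * max (1016064 * \<mu> * \<nu> * (L\<^sup>2 * real (vec_space.rank m1 Xbar) / K\<^sup>2) * (real M * ln (real d) / real n))
                      (exp 1 * H / K * sqrt (ln (real d) / real n))}"
    unfolding dims by (rule estimation_error_bound) (use * in \<open>unfold lam, blast\<close>)
  finally show "1 - 3 / real d \<le> measure_pmf.prob (sample_pmf n P f Xbar)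
         {s. (frobenius_norm (Xbar - Xhat s))\<^sup>2 / (real m1 * real m2) \<le>
             \<mu> * max (1016064 * \<mu> * \<nu> * (L\<^sup>2 * real (vec_space.rank m1 Xbar) / K\<^sup>2) * (real M * ln (real d) / real n))
                      (exp 1 * H / K * sqrt (ln (real d) / real n))}" .
qed

end
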